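(* Let $\mathcal{M}$ be a minor-closed class of ribbon graphs containing the bouquets $D_{100}$, $D_{101}$ and $D_{210}$, let $\mathcal{R}$ be a commutative ring with unity, and let $F:\mathcal{M}\to\mathcal{R}$. Put $s=F(D_{210})$, $q=F(D_{100})$, $r=F(D_{101})$. Suppose there are elements $\alpha,x,u,v\in\mathcal{R}$ with $\alpha$ a unit such that: (1) for every $G\in\mathcal{M}$ and edge $e$ of $G$: $F(G)=F(G/e)+F(G\setminus e)$ if $e$ is ordinary, and $F(G)=x\,F(G/e)$ if $e$ is a bridge; (2) for embedded bouquets $G,H$: $F(G\,\dot\cup\, H)=F(G)F(H)$ and $\alpha F(G*H)=F(G)F(H)$, where $G\dot\cup H$ is the disjoint union and $G*H$ is the one-point join whose rotation at the new vertex is the concatenation of the rotations of $G$ and $H$; (3) $F(\mathbf{E})=\alpha^n$ whenever $\mathbf{E}$ is an edgeless graph on $n$ vertices; (4) $(q-\alpha)^2u^2=\alpha(s-2q+\alpha)$, $(q-\alpha)uv=r-\alpha$, and $v=v^2$. Then for every $G\in\mathcal{M}$, $$F(G)=\alpha^{k(G)}\,R\big(G;\,x,\,\alpha^{-1}q-1,\,u,\,v\big),$$ where $k(G)$ is the number of connected components of $G$.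
   Context: A ribbon graph is a graph cellularly embedded in a (not necessarily orientable) surface, equivalently given by a rotation scheme (cyclic order of half-edges) at each vertex and a sign $\pm$ on each edge; equivalently a surface with boundary built from vertex disks and edge ribbons, negative edges carrying a half-twist. Deletion $G\setminus e$ removes the ribbon of $e$; for a non-loop edge $e$, the contraction $G/e$ (after making $e$ positive by flipping an endpoint, which reverses the cyclic order there and toggles signs of its half-edges) deletes $e$ and merges its endpoints into one vertex whose rotation follows the rotation at one endpoint starting where $e$ was, then the rotation at the other endpoint starting where $e$ was. An edge is a bridge if its deletion increases the number of components, and ordinary if it is neither a bridge nor a loop. A class is minor-closed if closed under deletion and contraction. An embedded bouquet is a ribbon graph with one vertex; it is equivalent to a signed chord diagram. $D_{100}$ is the bouquet with a single positive loop, $D_{101}$ the bouquet with a single negative loop, and $D_{210}$ the bouquet with two positive loops whose chords intersect (half-edges in cyclic order $a,b,a,b$). For a ribbon graph $G$ and $A\subseteq E(G)$, consider the spanning ribbon subgraph with edge set $A$: $\kappa(A)$ (also $k$) is its number of components, $r(A)=|V(G)|-\kappa(A)$, $n(A)=|A|-r(A)$, $bc(A)$ its number of boundary components as a surface, and $t(A)=0$ if this surface is orientable and $1$ otherwise; $r(G)=r(E(G))$ etc. The Bollobás–Riordan (topological Tutte) polynomial is $$R(G;x,y,z,w)=\sum_{A\subseteq E(G)}(x-1)^{r(G)-r(A)}y^{n(A)}z^{\kappa(A)-bc(A)+n(A)}w^{t(A)}\in\mathbb{Z}[x,y,z,w]/\langle w^2-w\rangle.$$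
   Formalization: Added: M contains every two-vertex ribbon graph contracting to a bouquet in M, and both parts of any union in M of a bouquet with a disjoint union of bouquets; F(G ∪ H)=F(G)F(H) is assumed also for H a disjoint union of bouquets. Without these the claim fails. *)

theory Defs
  imports Main
begin

text \<open>
  Ribbon graphs are signed rotation systems. The two half-edges of the edge \<open>e\<close> are
  \<open>(e, False)\<close> and \<open>(e, True)\<close>. Vertices and edges are labelled by natural numbers, which is
  no restriction because everything is considered up to \<open>ribbon_equiv\<close> below. The list
  \<open>rotn G v\<close> is the cyclic order at \<open>v\<close>, cut open at an arbitrary point, and \<open>neg G\<close> is the
  set of edges of sign \<open>-\<close>.
\<close>

type_synonym half_edge = "nat \<times> bool"

definition opp :: "half_edge \<Rightarrow> half_edge" where
  "opp h = (fst h, \<not> snd h)"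

record ribbon =
  verts :: "nat set"
  rotn :: "nat \<Rightarrow> half_edge list"
  neg :: "nat set"

definition half_edges :: "ribbon \<Rightarrow> half_edge set" where
  "half_edges G = (\<Union>v\<in>verts G. set (rotn G v))"

definition edges :: "ribbon \<Rightarrow> nat set" where
  "edges G = fst ` half_edges G"

definition ribbon_graph :: "ribbon \<Rightarrow> bool" where
  "ribbon_graph G \<longleftrightarrow>
     finite (verts G) \<and>
     (\<forall>v. v \<notin> verts G \<longrightarrow> rotn G v = []) \<and>
     (\<forall>v\<in>verts G. distinct (rotn G v)) \<and>
     (\<forall>v\<in>verts G. \<forall>w\<in>verts G. v \<noteq> w \<longrightarrow> set (rotn G v) \<inter> set (rotn G w) = {}) \<and>
     (\<forall>h\<in>half_edges G. opp h \<in> half_edges G) \<and>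
     neg G \<subseteq> edges G"

text \<open>The vertex at which a half-edge is attached.\<close>

definition att :: "ribbon \<Rightarrow> half_edge \<Rightarrow> nat" where
  "att G h = (THE v. v \<in> verts G \<and> h \<in> set (rotn G v))"

definition is_loop :: "ribbon \<Rightarrow> nat \<Rightarrow> bool" where
  "is_loop G e \<longleftrightarrow> e \<in> edges G \<and> att G (e, False) = att G (e, True)"


section \<open>Equivalence\<close>

text \<open>
  Reverse the cyclic order at \<open>v\<close> and toggle the sign once for every half-edge at \<open>v\<close>; the sign
  of a loop at \<open>v\<close> is thus toggled twice, that is, unchanged.
\<close>

definition flip_vertex :: "nat \<Rightarrow> ribbon \<Rightarrow> ribbon" where
  "flip_vertex v G = \<lparr>
     verts = verts G,
     rotn = (rotn G)(v := rev (rotn G v)),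
     neg = {e \<in> edges G. (e \<in> neg G) \<noteq>
              (((e, False) \<in> set (rotn G v)) \<noteq> ((e, True) \<in> set (rotn G v)))}\<rparr>"

definition rotate_vertex :: "nat \<Rightarrow> ribbon \<Rightarrow> ribbon" where
  "rotate_vertex v G = G\<lparr>rotn := (rotn G)(v := rotate1 (rotn G v))\<rparr>"

definition relabel :: "(nat \<Rightarrow> nat) \<Rightarrow> (half_edge \<Rightarrow> half_edge) \<Rightarrow> ribbon \<Rightarrow> ribbon" where
  "relabel f g G = \<lparr>
     verts = f ` verts G,
     rotn = (\<lambda>u. if u \<in> f ` verts G then map g (rotn G (inv_into (verts G) f u)) else []),
     neg = (\<lambda>e. fst (g (e, False))) ` neg G\<rparr>"

inductive ribbon_move :: "ribbon \<Rightarrow> ribbon \<Rightarrow> bool" where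
  flip: "ribbon_graph G \<Longrightarrow> v \<in> verts G \<Longrightarrow> ribbon_move G (flip_vertex v G)"
| rotate: "ribbon_graph G \<Longrightarrow> v \<in> verts G \<Longrightarrow> ribbon_move G (rotate_vertex v G)"
| relabel: "ribbon_graph G \<Longrightarrow> inj_on f (verts G) \<Longrightarrow> inj_on g (half_edges G) \<Longrightarrow>
    (\<And>h. h \<in> half_edges G \<Longrightarrow> g (opp h) = opp (g h)) \<Longrightarrow> ribbon_move G (relabel f g G)"

text \<open>
  Two signed rotation systems present the same ribbon graph if they are related by a sequence of
  moves and inverse moves.
\<close>

definition ribbon_equiv :: "ribbon \<Rightarrow> ribbon \<Rightarrow> bool" where
  "ribbon_equiv = equivclp ribbon_move"

definition ribbon_class :: "ribbon set \<Rightarrow> bool" where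
  "ribbon_class M \<longleftrightarrow>
     (\<forall>G\<in>M. ribbon_graph G \<and> (\<forall>H. ribbon_equiv G H \<longrightarrow> H \<in> M))"


section \<open>Deletion and contraction\<close>

text \<open>The spanning ribbon subgraph with edge set \<open>A\<close>.\<close>

definition spanning :: "ribbon \<Rightarrow> nat set \<Rightarrow> ribbon" where
  "spanning G A = \<lparr>
     verts = verts G,
     rotn = (\<lambda>v. filter (\<lambda>h. fst h \<in> A) (rotn G v)),
     neg = neg G \<inter> A\<rparr>"

definition delete :: "ribbon \<Rightarrow> nat \<Rightarrow> ribbon" where
  "delete G e = spanning G (edges G - {e})"

text \<open>The cyclic list \<open>xs\<close> read from the entry after \<open>h\<close> up to the entry before \<open>h\<close>.\<close>

definition open_at :: "half_edge \<Rightarrow> half_edge list \<Rightarrow> half_edge list" where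
  "open_at h xs = tl (dropWhile (\<lambda>k. k \<noteq> h) xs) @ takeWhile (\<lambda>k. k \<noteq> h) xs"

text \<open>Contraction of a positive edge that is not a loop.\<close>

definition contract_pos :: "ribbon \<Rightarrow> nat \<Rightarrow> ribbon" where
  "contract_pos G e =
     (let v = att G (e, False); w = att G (e, True) in \<lparr>
        verts = verts G - {w},
        rotn = (rotn G)
          (v := open_at (e, False) (rotn G v) @ open_at (e, True) (rotn G w), w := []),
        neg = neg G\<rparr>)"

text \<open>
  Only used for edges that are not loops. Flipping the other endpoint instead would give an
  equivalent result.
\<close>

definition contract :: "ribbon \<Rightarrow> nat \<Rightarrow> ribbon" where
  "contract G e =
     contract_pos (if e \<in> neg G then flip_vertex (att G (e, True)) G else G) e"

definition minor_closed :: "ribbon set \<Rightarrow> bool" where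
  "minor_closed M \<longleftrightarrow>
     (\<forall>G\<in>M. \<forall>e\<in>edges G. delete G e \<in> M \<and> (\<not> is_loop G e \<longrightarrow> contract G e \<in> M))"


section \<open>Topological parameters\<close>

definition adjacency :: "ribbon \<Rightarrow> (nat \<times> nat) set" where
  "adjacency G = {(att G h, att G (opp h)) | h. h \<in> half_edges G}"

definition components :: "ribbon \<Rightarrow> nat" where
  "components G = card (verts G // (adjacency G)\<^sup>*)"

definition is_bridge :: "ribbon \<Rightarrow> nat \<Rightarrow> bool" where
  "is_bridge G e \<longleftrightarrow> e \<in> edges G \<and> components (delete G e) > components G"

definition is_ordinary :: "ribbon \<Rightarrow> nat \<Rightarrow> bool" where
  "is_ordinary G e \<longleftrightarrow> e \<in> edges G \<and> \<not> is_bridge G e \<and> \<not> is_loop G e"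

definition rank :: "ribbon \<Rightarrow> nat" where
  "rank G = card (verts G) - components G"

definition nullity :: "ribbon \<Rightarrow> nat" where
  "nullity G = card (edges G) - rank G"

text \<open>
  A half-edge \<open>h\<close> meets its vertex disk in an arc with two ends: \<open>(h, False)\<close>, just before \<open>h\<close>
  in the rotation, and \<open>(h, True)\<close>, just after it. The boundary of the surface is made of the
  arcs of the vertex disks between consecutive half-edges and of the two sides of each ribbon; a
  side of a positive ribbon joins a ``before'' end to an ``after'' end, and a side of a negative
  (half-twisted) ribbon joins two ends of the same kind.
\<close>

definition vertex_arcs :: "ribbon \<Rightarrow> ((half_edge \<times> bool) \<times> (half_edge \<times> bool)) set" where
  "vertex_arcs G =
     {((rotn G v ! i, True), (rotn G v ! (Suc i mod length (rotn G v)), False)) | v i.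
        v \<in> verts G \<and> i < length (rotn G v)}"

definition ribbon_sides :: "ribbon \<Rightarrow> ((half_edge \<times> bool) \<times> (half_edge \<times> bool)) set" where
  "ribbon_sides G =
     {((h, b), (opp h, if fst h \<in> neg G then b else \<not> b)) | h b. h \<in> half_edges G}"

text \<open>Each isolated vertex contributes the boundary circle of its disk.\<close>

definition boundary_components :: "ribbon \<Rightarrow> nat" where
  "boundary_components G =
     card ((half_edges G \<times> UNIV) //
       (vertex_arcs G \<union> (vertex_arcs G)\<inverse> \<union> ribbon_sides G \<union> (ribbon_sides G)\<inverse>)\<^sup>*)
     + card {v \<in> verts G. rotn G v = []}"

text \<open>
  The surface is orientable iff the vertex disks can be oriented compatibly with all ribbons;
  \<open>f v\<close> tells whether the given orientation of the disk at \<open>v\<close> is reversed.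
\<close>

definition orientable :: "ribbon \<Rightarrow> bool" where
  "orientable G \<longleftrightarrow>
     (\<exists>f :: nat \<Rightarrow> bool. \<forall>e\<in>edges G.
        e \<in> neg G \<longleftrightarrow> f (att G (e, False)) \<noteq> f (att G (e, True)))"

definition nonorientability :: "ribbon \<Rightarrow> nat" where
  "nonorientability G = (if orientable G then 0 else 1)"

text \<open>
  The value of the Bollobas--Riordan polynomial at \<open>x\<close>, \<open>y\<close>, \<open>z\<close>, \<open>w\<close>, meant for \<open>w\<^sup>2 = w\<close>. All
  differences of natural numbers are exact: the rank is monotone under inclusion of edge sets,
  and the exponent of \<open>z\<close> is the Euler genus, hence nonnegative.
\<close>

definition bollobas_riordan :: "ribbon \<Rightarrow> 'r \<Rightarrow> 'r \<Rightarrow> 'r \<Rightarrow> 'r \<Rightarrow> 'r::comm_ring_1" where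
  "bollobas_riordan G x y z w =
     (\<Sum>A\<in>Pow (edges G).
        (x - 1) ^ (rank G - rank (spanning G A)) *
        y ^ nullity (spanning G A) *
        z ^ (components (spanning G A) + nullity (spanning G A)
               - boundary_components (spanning G A)) *
        w ^ nonorientability (spanning G A))"


section \<open>Bouquets\<close>

definition is_bouquet :: "ribbon \<Rightarrow> bool" where
  "is_bouquet G \<longleftrightarrow> ribbon_graph G \<and> card (verts G) = 1"

text \<open>A nonempty disjoint union of bouquets: a ribbon graph all of whose edges are loops.\<close>

definition is_bouquet_union :: "ribbon \<Rightarrow> bool" where
  "is_bouquet_union G \<longleftrightarrow>
     ribbon_graph G \<and> verts G \<noteq> {} \<and> (\<forall>e\<in>edges G. is_loop G e)"

definition chord_diagram :: "half_edge list \<Rightarrow> nat set \<Rightarrow> ribbon" where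
  "chord_diagram xs N = \<lparr>verts = {0}, rotn = (\<lambda>v. if v = 0 then xs else []), neg = N\<rparr>"

definition D100 :: ribbon where
  "D100 = chord_diagram [(0, False), (0, True)] {}"

definition D101 :: ribbon where
  "D101 = chord_diagram [(0, False), (0, True)] {0}"

definition D210 :: ribbon where
  "D210 = chord_diagram [(0, False), (1, False), (0, True), (1, True)] {}"

text \<open>Disjoint union, for \<open>G\<close> and \<open>H\<close> without common vertices or edges.\<close>

definition dunion :: "ribbon \<Rightarrow> ribbon \<Rightarrow> ribbon" where
  "dunion G H = \<lparr>
     verts = verts G \<union> verts H,
     rotn = (\<lambda>v. if v \<in> verts G then rotn G v else rotn H v),
     neg = neg G \<union> neg H\<rparr>"

text \<open>
  One-point join, for bouquets \<open>G\<close> and \<open>H\<close> without common edges. It depends on where the two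
  rotations are cut open; quantifying over all presentations covers all choices.
\<close>

definition join :: "ribbon \<Rightarrow> ribbon \<Rightarrow> ribbon" where
  "join G H = \<lparr>
     verts = verts G,
     rotn = (\<lambda>v. if v \<in> verts G then rotn G v @ rotn H (the_elem (verts H)) else []),
     neg = neg G \<union> neg H\<rparr>"

section \<open>Closure conditions on a class besides being minor-closed\<close>

text \<open>
  Deletion and contraction alone never lead from a bouquet to a graph with an ordinary edge: the
  ribbon graphs all of whose edges are loops form a minor-closed class, on which the
  deletion--contraction relations are void and the values on bouquets that are not joins are
  arbitrary. The relations constrain a bouquet through the two-vertex ribbon graphs that contract
  to it, which therefore have to belong to the class.
\<close>

definition expansion_closed :: "ribbon set \<Rightarrow> bool" where
  "expansion_closed M \<longleftrightarrow>
     (\<forall>G e. ribbon_graph G \<and> e \<in> edges G \<and> \<not> is_loop G e \<and>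
        is_bouquet (contract G e) \<and> contract G e \<in> M \<longrightarrow> G \<in> M)"

text \<open>Needed for multiplicativity to be meaningful on each disjoint union in the class.\<close>

definition summand_closed :: "ribbon set \<Rightarrow> bool" where
  "summand_closed M \<longleftrightarrow>
     (\<forall>G H. is_bouquet G \<and> is_bouquet_union H \<and>
        verts G \<inter> verts H = {} \<and> edges G \<inter> edges H = {} \<and> dunion G H \<in> M \<longrightarrow>
        G \<in> M \<and> H \<in> M)"

end

(*
  Put P G = alpha^k(G) R(G). Like F, the invariant P satisfies the deletion-contraction and bridge
  relations and is multiplicative on disjoint unions and joins, so it remains to compare F and P on
  bouquets. If e and f are two ordinary edges of a two-vertex ribbon graph L, then
  F(L/e) + F(L - e) = F(L) = F(L/f) + F(L - f), and likewise for P; since F = P holds inductively at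
  smaller nullity, F - P takes the same value on the bouquets L/e and L/f, which differ by a chord
  slide. Slides turn every bouquet into a join of smaller bouquets or into D100, D101, D210: a
  negative chord, or a positive chord that crosses no other, splits off by itself, and two crossing
  positive chords split off together. On the three exceptional bouquets F = P says exactly that
  the parameters satisfy condition (4).

  Boundary components are the connected components of a relation on the ends of the half-edges.
  Deleting a half-edge amounts to joining its two ends, contracting a ribbon amounts to deleting its
  half-edges after exchanging two ends, and a parity argument settles the deletion of a bridge.
*)
theory Submission
  imports Defs
begin

section \<open>Counting connected components of a relation\<close>

text \<open>Nullity governs the induction because contracting a non-loop edge preserves it and
  deleting an ordinary edge lowers it; the number of edges would not do, since the two-vertex graph
  behind a slide has one edge more than the bouquets it connects. The value substituted for y is
  forced by \<open>D100\<close>, whose polynomial is 1 + y: it must satisfy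
  \<open>\<alpha> * (1 + y) = q\<close>. Orientability contributes 0 or 1, so on a union it behaves
  like a maximum and not like a sum; idempotence of \<open>v\<close> restores multiplicativity. The
  exponent of z is a truncated difference: deletion and contraction only need its parts to shift
  alike, but multiplicativity needs it to be exact, which is proved where it is used, for graphs all
  of whose edges are loops. Boundary curves of a graph and of its deletion are never matched with
  each other. Both are counted on the point set of the original rotation system, and only the
  relation on these points changes.\<close>

definition conn :: "'a rel \<Rightarrow> 'a rel" where
  "conn R = (R \<union> R\<inverse>)\<^sup>*"

text \<open>Classes are taken in the whole type, and those meeting \<open>S\<close> are
  counted.\<close>

definition ccount :: "'a set \<Rightarrow> 'a rel \<Rightarrow> nat" where
  "ccount S R = card (S // conn R)"

lemma conn_refl [simp]: "(x, x) \<in> conn R"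
  by (simp add: conn_def)

lemma conn_sym: "(x, y) \<in> conn R \<Longrightarrow> (y, x) \<in> conn R"
  unfolding conn_def by (rule symD[OF sym_rtrancl[OF sym_Un_converse]])

lemma conn_trans: "(x, y) \<in> conn R \<Longrightarrow> (y, z) \<in> conn R \<Longrightarrow> (x, z) \<in> conn R"
  unfolding conn_def by (rule rtrancl_trans)

lemma conn_base: "(x, y) \<in> R \<Longrightarrow> (x, y) \<in> conn R"
  unfolding conn_def by blast

lemma conn_base': "(x, y) \<in> R \<Longrightarrow> (y, x) \<in> conn R"
  unfolding conn_def by blast

lemma equiv_conn: "equiv UNIV (conn R)"
  by (auto intro!: equivI reflI symI transI intro: conn_sym conn_trans)

lemma conn_class_eq_iff: "conn R `` {x} = conn R `` {y} \<longleftrightarrow> (x, y) \<in> conn R"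
  by (simp add: eq_equiv_class_iff[OF equiv_conn])

lemma conn_class_eqI: "(x, y) \<in> conn R \<Longrightarrow> conn R `` {x} = conn R `` {y}"
  by (simp add: conn_class_eq_iff)

lemma conn_least:
  assumes "(x, y) \<in> conn R" and "\<And>a b. (a, b) \<in> R \<Longrightarrow> (f a, f b) \<in> conn Q"
  shows "(f x, f y) \<in> conn Q"
  using assms(1) unfolding conn_def[of R]
proof induction
  case (step a b)
  then have "(f a, f b) \<in> conn Q" using assms(2)[of a b] conn_sym[OF assms(2)[of b a]] by blast
  with step(3) show ?case by (rule conn_trans)
qed simp

lemma conn_mono: "(x, y) \<in> conn R \<Longrightarrow> R \<subseteq> conn Q \<Longrightarrow> (x, y) \<in> conn Q"
  using conn_least[of x y R "\<lambda>a. a" Q] by blast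

lemma conn_eqI: "R \<subseteq> conn Q \<Longrightarrow> Q \<subseteq> conn R \<Longrightarrow> conn R = conn Q"
  by (auto intro: conn_mono)

lemma conn_closed:
  assumes "(x, y) \<in> conn R" "x \<in> C" "\<And>a b. (a, b) \<in> R \<Longrightarrow> a \<in> C \<longleftrightarrow> b \<in> C"
  shows "y \<in> C"
  using assms(1) unfolding conn_def
  by induction (use assms(2,3) in auto)

lemma quotient_eq_image: "S // E = (\<lambda>x. E `` {x}) ` S"
  by (auto simp: quotient_def)

text \<open>The size of an image depends only on the partition into fibres, so the classes of two
  relations can be counted against each other without a bijection between them.\<close>

lemma card_image_cong_kernel:
  assumes "\<And>x y. x \<in> S \<Longrightarrow> y \<in> S \<Longrightarrow> f x = f y \<longleftrightarrow> g x = g y"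
  shows "card (f ` S) = card (g ` S)"
proof -
  have eq: "g (inv_into S f (f x)) = g x" if "x \<in> S" for x
    using that assms[of "inv_into S f (f x)" x] by (simp add: inv_into_into f_inv_into_f)
  have "inj_on (\<lambda>c. g (inv_into S f c)) (f ` S)"
    by (rule inj_onI) (use eq assms in auto)
  moreover have "(\<lambda>c. g (inv_into S f c)) ` f ` S = g ` S"
    using eq by (auto simp: image_image)
  ultimately show ?thesis using card_image by fastforce
qed

lemma ccount_eq_card_image: "ccount S R = card ((\<lambda>x. conn R `` {x}) ` S)"
  by (simp add: ccount_def quotient_eq_image)

text \<open>A quotient map criterion: \<open>\<phi>\<close> identifies only points that are
  connected anyway, and every generator of \<open>R'\<close> lifts to a connected pair.\<close>

lemma ccount_map:
  assumes onto: "\<phi> ` S = S'"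
    and rel: "\<And>x y. (x, y) \<in> R \<Longrightarrow> (\<phi> x, \<phi> y) \<in> conn R'"
    and onto_rel: "\<And>x y. (x, y) \<in> R' \<Longrightarrow> \<exists>a\<in>S. \<exists>b\<in>S. \<phi> a = x \<and> \<phi> b = y \<and> (a, b) \<in> conn R"
    and fib: "\<And>x y. x \<in> S \<Longrightarrow> y \<in> S \<Longrightarrow> \<phi> x = \<phi> y \<Longrightarrow> (x, y) \<in> conn R"
  shows "ccount S R = ccount S' R'"
proof -
  \<comment> \<open>Path lifting: \<open>onto_rel\<close> lifts each step of a path, and
    \<open>fib\<close> passes between different lifts of the same point.\<close>
  have lift: "(x, y) \<in> conn R" if x: "x \<in> S" and y: "y \<in> S" and "(\<phi> x, \<phi> y) \<in> conn R'" for x y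
  proof -
    have "\<forall>y\<in>S. \<phi> y = z \<longrightarrow> (x, y) \<in> conn R" if "(\<phi> x, z) \<in> (R' \<union> R'\<inverse>)\<^sup>*" for z
      using that
    proof induction
      case base
      then show ?case using fib x by metis
    next
      case (step b c)
      from step(2) obtain a' b' where "a' \<in> S" "b' \<in> S" "\<phi> a' = b" "\<phi> b' = c" "(a', b') \<in> conn R"
        using onto_rel conn_sym by (metis UnE converseD)
      with step(3) have "(x, b') \<in> conn R" by (blast intro: conn_trans)
      then show ?case using fib[OF \<open>b' \<in> S\<close>] \<open>\<phi> b' = c\<close> by (blast intro: conn_trans)
    qed
    with that show ?thesis by (simp add: conn_def)
  qed
  have "ccount S' R' = card ((\<lambda>x. conn R' `` {\<phi> x}) ` S)"
    by (simp add: ccount_eq_card_image onto[symmetric] image_image)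
  also have "\<dots> = card ((\<lambda>x. conn R `` {x}) ` S)"
    by (rule card_image_cong_kernel) (use lift conn_least[where f=\<phi>, OF _ rel] in \<open>auto simp: conn_class_eq_iff\<close>)
  finally show ?thesis by (simp add: ccount_eq_card_image)
qed

lemma ccount_bij:
  assumes "bij_betw \<phi> S S'" "R \<subseteq> S \<times> S" "R' = map_prod \<phi> \<phi> ` R"
  shows "ccount S R = ccount S' R'"
proof (rule ccount_map)
  show "\<phi> ` S = S'" using assms(1) by (simp add: bij_betw_def)
  show "(x, y) \<in> conn R" if "x \<in> S" "y \<in> S" "\<phi> x = \<phi> y" for x y
    using that assms(1) by (auto simp: bij_betw_def inj_on_def)
  show "\<exists>a\<in>S. \<exists>b\<in>S. \<phi> a = x \<and> \<phi> b = y \<and> (a, b) \<in> conn R" if "(x, y) \<in> R'" for x y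
    using that assms(2,3) by (force intro: conn_base)
  show "(\<phi> x, \<phi> y) \<in> conn R'" if "(x, y) \<in> R" for x y
    using that assms(3) by (force intro: conn_base)
qed

lemma ccount_le_card: "finite S \<Longrightarrow> ccount S R \<le> card S"
  by (simp add: ccount_eq_card_image card_image_le)

lemma ccount_empty_rel: "ccount S {} = card S"
proof -
  have "ccount S {} = card ((\<lambda>x. {x}) ` S)"
    by (simp add: ccount_eq_card_image conn_def)
  then show ?thesis by (simp add: card_image)
qed

lemma ccount_one:
  assumes "x \<in> S" "\<And>y. y \<in> S \<Longrightarrow> (x, y) \<in> conn R"
  shows "ccount S R = 1"
proof -
  have "(\<lambda>x. conn R `` {x}) ` S = {conn R `` {x}}"
    using assms(1) conn_class_eqI[OF assms(2), symmetric] by (intro equalityI image_subsetI subsetI) blast+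
  then show ?thesis by (simp add: ccount_eq_card_image)
qed

lemma ccount_antimono:
  assumes "finite S" "R \<subseteq> conn Q"
  shows "ccount S Q \<le> ccount S R"
proof -
  have "(\<lambda>x. conn Q `` {x}) ` S = (\<lambda>c. conn Q `` c) ` ((\<lambda>x. conn R `` {x}) ` S)"
  proof -
    have "conn Q `` (conn R `` {x}) = conn Q `` {x}" for x
      using conn_mono[OF _ assms(2)] conn_trans by fastforce
    then show ?thesis by (simp add: image_image)
  qed
  then show ?thesis using assms(1)
    by (metis card_image_le ccount_eq_card_image finite_imageI)
qed

lemma ccount_Un:
  assumes "finite S" "finite T" "S \<inter> T = {}" "R \<subseteq> S \<times> S" "Q \<subseteq> T \<times> T"
  shows "ccount (S \<union> T) (R \<union> Q) = ccount S R + ccount T Q"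
proof -
  have inS: "(x, y) \<in> conn R" if "x \<in> S" "(x, y) \<in> conn (R \<union> Q)" for x y
  proof -
    have "y \<in> S \<and> (x, y) \<in> conn R"
      using that(2) unfolding conn_def[of "R \<union> Q"]
    proof induction
      case (step b c)
      then have "(b, c) \<in> R \<union> R\<inverse>" "c \<in> S" using assms(3-5) by auto
      with step show ?case by (auto intro: conn_base conn_base' elim: conn_trans)
    qed (use that in simp)
    then show ?thesis ..
  qed
  have inT: "(x, y) \<in> conn Q" if "x \<in> T" "(x, y) \<in> conn (R \<union> Q)" for x y
  proof -
    have "y \<in> T \<and> (x, y) \<in> conn Q"
      using that(2) unfolding conn_def[of "R \<union> Q"]
    proof induction
      case (step b c)
      then have "(b, c) \<in> Q \<union> Q\<inverse>" "c \<in> T" using assms(3-5) by auto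
      with step show ?case by (auto intro: conn_base conn_base' elim: conn_trans)
    qed (use that in simp)
    then show ?thesis ..
  qed
  have inc: "conn R \<subseteq> conn (R \<union> Q)" "conn Q \<subseteq> conn (R \<union> Q)"
    by (auto intro: conn_mono conn_base)
  let ?f = "\<lambda>x. conn (R \<union> Q) `` {x}"
  have 1: "card (?f ` S) = ccount S R"
    unfolding ccount_eq_card_image
    by (rule card_image_cong_kernel) (use inS inc in \<open>auto simp: conn_class_eq_iff\<close>)
  have 2: "card (?f ` T) = ccount T Q"
    unfolding ccount_eq_card_image
    by (rule card_image_cong_kernel) (use inT inc in \<open>auto simp: conn_class_eq_iff\<close>)
  have cl: "y \<in> S" if "x \<in> S" "(x, y) \<in> conn (R \<union> Q)" for x y
    by (rule conn_closed[OF that(2,1)]) (use assms(3-5) in auto)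
  have "?f ` S \<inter> ?f ` T = {}"
  proof (rule equals0I)
    fix c assume "c \<in> ?f ` S \<inter> ?f ` T"
    then obtain a b where "a \<in> S" "b \<in> T" "?f a = ?f b" by fast
    then show False using cl[of a b] assms(3) by (auto simp: conn_class_eq_iff)
  qed
  then show ?thesis using assms(1,2) 1 2
    by (simp add: ccount_eq_card_image[of "S \<union> T"] image_Un card_Un_disjoint)
qed

text \<open>A connecting path needs the new pair at most once, in one of its two directions.\<close>

lemma conn_insert:
  "(a, b) \<in> conn (insert (x, y) R) \<longleftrightarrow>
     (a, b) \<in> conn R \<or> (a, x) \<in> conn R \<and> (y, b) \<in> conn R \<or> (a, y) \<in> conn R \<and> (x, b) \<in> conn R"
proof -
  have *: "insert (x, y) R \<union> (insert (x, y) R)\<inverse> = insert (x, y) (insert (y, x) (R \<union> R\<inverse>))" by auto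
  show ?thesis
    unfolding conn_def * rtrancl_insert
    by (auto intro: rtrancl_trans)
qed

lemma conn_insert_absorb: "(x, y) \<in> conn R \<Longrightarrow> conn (insert (x, y) R) = conn R"
  by (rule conn_eqI) (auto intro: conn_base)

lemma conn_insert_swap: "conn (insert (x, y) R) = conn (insert (y, x) R)"
proof -
  have "insert (x, y) R \<union> (insert (x, y) R)\<inverse> = insert (y, x) R \<union> (insert (y, x) R)\<inverse>" by auto
  then show ?thesis by (simp add: conn_def)
qed

lemma ccount_insert:
  assumes "finite S" "x \<in> S" "y \<in> S" "(x, y) \<notin> conn R"
  shows "ccount S R = Suc (ccount S (insert (x, y) R))"
proof -
  let ?f = "\<lambda>a. conn R `` {a}" and ?g = "\<lambda>a. conn (insert (x, y) R) `` {a}"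
  \<comment> \<open>Outside the class of \<open>x\<close> both relations induce the same partition;
    for the larger relation this part still meets every class, because it contains
    \<open>y\<close>.\<close>
  let ?T = "{a \<in> S. (x, a) \<notin> conn R}"
  have "?f ` S = insert (?f x) (?f ` ?T)"
  proof (intro equalityI image_subsetI)
    fix a assume "a \<in> S"
    then show "?f a \<in> insert (?f x) (?f ` ?T)"
      using conn_class_eqI[of x a R] by (cases "(x, a) \<in> conn R") blast+
  qed (use assms(2) in blast)
  moreover have "?f x \<notin> ?f ` ?T"
  proof
    assume "?f x \<in> ?f ` ?T"
    then obtain a where "a \<in> ?T" "?f x = ?f a" by blast
    then show False by (simp add: conn_class_eq_iff)
  qed
  ultimately have 1: "card (?f ` S) = Suc (card (?f ` ?T))"
    using assms(1) by simp
  have "?g ` S = ?g ` ?T"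
  proof -
    have "?g a = ?g y" if "(x, a) \<in> conn R" for a
      using conn_sym[OF that] by (simp add: conn_class_eq_iff conn_insert)
    moreover have "y \<in> ?T" using assms by auto
    ultimately have "?g a \<in> ?g ` ?T" if "a \<in> S" for a
      using that by (cases "(x, a) \<in> conn R") auto
    then show ?thesis by auto
  qed
  moreover have "card (?f ` ?T) = card (?g ` ?T)"
  proof (rule card_image_cong_kernel)
    fix a b assume "a \<in> ?T" "b \<in> ?T"
    then have "(a, x) \<notin> conn R" "(x, b) \<notin> conn R" using conn_sym[of a x R] by auto
    then show "?f a = ?f b \<longleftrightarrow> ?g a = ?g b" by (simp add: conn_class_eq_iff conn_insert)
  qed
  ultimately show ?thesis using 1 by (simp add: ccount_eq_card_image)
qed

lemma ccount_insert_le: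
  assumes "finite S" "x \<in> S" "y \<in> S"
  shows "ccount S R \<le> Suc (ccount S (insert (x, y) R))"
  using ccount_insert[OF assms] conn_insert_absorb[of x y R]
  by (cases "(x, y) \<in> conn R") (auto simp: ccount_def)

text \<open>Adding the pair \<open>(a, c)\<close> to the first relation also connects
  \<open>b\<close> with \<open>d\<close>, and one added pair lowers the count by at most one.
  Re-pairing four points in this way is what deleting a ribbon does to its half-edge ends.\<close>

lemma ccount_switch_le:
  assumes "finite S" "a \<in> S" "c \<in> S"
  shows "ccount S (insert (a, b) (insert (c, d) R)) \<le> Suc (ccount S (insert (a, c) (insert (b, d) R)))"
proof -
  let ?Q = "insert (a, c) (insert (a, b) (insert (c, d) R))"
  have e: "(a, c) \<in> conn ?Q" "(b, a) \<in> conn ?Q" "(c, d) \<in> conn ?Q"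
    by (simp_all add: conn_base conn_base')
  then have "(b, d) \<in> conn ?Q" using conn_trans by metis
  with e have "ccount S ?Q \<le> ccount S (insert (a, c) (insert (b, d) R))"
    by (intro ccount_antimono[OF assms(1)]) (auto intro: conn_base)
  then show ?thesis using ccount_insert_le[OF assms, of "insert (a, b) (insert (c, d) R)"] by simp
qed

text \<open>The two inner points of the path p - x - y - q are erased by collapsing \<open>x\<close>
  to \<open>p\<close> and \<open>y\<close> to \<open>q\<close>. This is the boundary passing by a
  removed half-edge.\<close>

lemma ccount_suppress:
  assumes "p \<in> S" "q \<in> S" "x \<notin> S" "y \<notin> S" "x \<noteq> y" "R \<subseteq> S \<times> S"
  shows "ccount (insert x (insert y S)) (insert (x, y) (insert (p, x) (insert (y, q) R))) =
    ccount S (insert (p, q) R)"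
proof (rule ccount_map[where \<phi> = "\<lambda>a. if a = x then p else if a = y then q else a"], goal_cases)
  case 1
  then show ?case using assms by auto
next
  case (2 a b)
  then show ?case using assms by (auto intro: conn_base)
next
  case (3 a b)
  let ?Q = "insert (x, y) (insert (p, x) (insert (y, q) R))"
  have "(p, x) \<in> conn ?Q" "(x, y) \<in> conn ?Q" "(y, q) \<in> conn ?Q" by (simp_all add: conn_base)
  then have "(p, q) \<in> conn ?Q" using conn_trans by metis
  moreover have "(a, b) = (p, q) \<or> (a, b) \<in> R" using 3 by auto
  ultimately have "(a, b) \<in> conn ?Q" by (auto intro: conn_base)
  moreover have "a \<in> S" "b \<in> S" "a \<noteq> x" "a \<noteq> y" "b \<noteq> x" "b \<noteq> y" using 3 assms by auto
  ultimately show ?case by (intro bexI[where x = a] bexI[where x = b]) (simp_all split: if_splits)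
next
  case (4 a b)
  let ?Q = "insert (x, y) (insert (p, x) (insert (y, q) R))"
  have e: "(p, x) \<in> conn ?Q" "(x, y) \<in> conn ?Q" "(y, q) \<in> conn ?Q" by (simp_all add: conn_base)
  then have "(p, y) \<in> conn ?Q" "(x, q) \<in> conn ?Q" using conn_trans by metis+
  with e 4 e[THEN conn_sym] this[THEN conn_sym] show ?case by (auto split: if_splits)
qed

lemma even_card_involution:
  assumes "finite S" "\<And>x. x \<in> S \<Longrightarrow> f x \<in> S \<and> f (f x) = x \<and> f x \<noteq> x"
  shows "even (card S)"
  using assms
proof (induction "card S" arbitrary: S rule: less_induct)
  case less
  show ?case
  proof (cases "S = {}")
    case False
    then obtain x where x: "x \<in> S" by blast
    let ?T = "S - {x, f x}"
    have "card S = card ?T + card {x, f x}"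
      using less(2) less(3)[OF x] x by (subst card_Diff_subset) (auto simp: card_mono)
    then have c: "card S = Suc (Suc (card ?T))"
      using less(3)[OF x] by (auto simp: card_insert_if eq_commute[of x])
    have "even (card ?T)"
    proof (rule less(1))
      show "f y \<in> ?T \<and> f (f y) = y \<and> f y \<noteq> y" if "y \<in> ?T" for y
        using less(3)[of y] less(3)[OF x] that by (metis Diff_iff insert_iff singletonD)
    qed (use less(2) c in auto)
    with c show ?thesis by simp
  qed simp
qed

section \<open>Boundary components of rotation systems\<close>

text \<open>The rotation cut open: without the closing arc, concatenated words can be
  decomposed.\<close>

fun path_arcs :: "'a list \<Rightarrow> ('a \<times> bool) rel" where
  "path_arcs (x # y # zs) = insert ((x, True), (y, False)) (path_arcs (y # zs))"
| "path_arcs _ = {}"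

definition list_arcs :: "'a list \<Rightarrow> ('a \<times> bool) rel" where
  "list_arcs xs = {((xs ! i, True), (xs ! (Suc i mod length xs), False)) | i. i < length xs}"

lemma path_arcs_eq: "path_arcs xs = {((xs ! i, True), (xs ! Suc i, False)) | i. Suc i < length xs}"
proof (induction xs rule: path_arcs.induct)
  case (1 x y zs)
  have "(\<exists>i. P i \<and> Suc i < length (x # y # zs)) \<longleftrightarrow> P 0 \<or> (\<exists>i. P (Suc i) \<and> Suc i < length (y # zs))"
    for P :: "nat \<Rightarrow> bool"
    by (metis Suc_less_eq length_Cons not0_implies_Suc zero_less_Suc)
  with 1 show ?case by (simp add: set_eq_iff)
qed auto

lemma list_arcs_eq:
  "list_arcs xs = (if xs = [] then {} else insert ((last xs, True), (hd xs, False)) (path_arcs xs))"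
proof (cases "xs = []")
  case False
  then obtain n where n: "length xs = Suc n" by (cases xs) auto
  let ?f = "\<lambda>i. ((xs ! i, True), (xs ! (Suc i mod Suc n), False))"
  have "list_arcs xs = ?f ` {..<Suc n}" by (auto simp: list_arcs_def n)
  also have "\<dots> = insert (?f n) (?f ` {..<n})" by (simp add: lessThan_Suc)
  also have "?f ` {..<n} = path_arcs xs" by (auto simp: path_arcs_eq n)
  finally show ?thesis using False by (simp add: n last_conv_nth hd_conv_nth)
qed (simp add: list_arcs_def)

lemma path_arcs_append:
  "path_arcs (xs @ ys) = path_arcs xs \<union> path_arcs ys \<union>
     (if xs = [] \<or> ys = [] then {} else {((last xs, True), (hd ys, False))})"
proof (induction xs rule: path_arcs.induct)
  case ("2_2" x)
  then show ?case by (cases ys) auto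
qed auto

lemma list_arcs_append_commute: "list_arcs (xs @ ys) = list_arcs (ys @ xs)"
  by (auto simp: list_arcs_eq path_arcs_append hd_append last_append)

lemma path_arcs_subset: "path_arcs xs \<subseteq> (set xs \<times> {True}) \<times> (set (tl xs) \<times> {False})"
proof -
  have "xs ! Suc i \<in> set (tl xs)" if "Suc i < length xs" for i
    using that nth_mem[of i "tl xs"] by (simp add: nth_tl)
  then show ?thesis by (auto simp: path_arcs_eq)
qed

lemma list_arcs_subset: "list_arcs xs \<subseteq> (set xs \<times> {True}) \<times> (set xs \<times> {False})"
  by (auto simp: list_arcs_def intro!: nth_mem mod_less_divisor)

text \<open>Reading backwards exchanges "before" and "after" at each half-edge, so an arc changes
  both its labels and its direction.\<close>

lemma path_arcs_rev:
  "path_arcs (rev xs) = (\<lambda>((a, s), (b, t)). ((b, \<not> t), (a, \<not> s))) ` path_arcs xs"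
proof (induction xs rule: path_arcs.induct)
  case (1 x y zs)
  then show ?case using path_arcs_append[of "rev (y # zs)" "[x]"] by simp
qed auto

lemma list_arcs_rev:
  "list_arcs (rev xs) = (\<lambda>((a, s), (b, t)). ((b, \<not> t), (a, \<not> s))) ` list_arcs xs"
  by (simp add: list_arcs_eq path_arcs_rev hd_rev last_rev)

definition halves :: "nat set \<Rightarrow> (nat \<Rightarrow> 'a list) \<Rightarrow> 'a set" where
  "halves V rot = (\<Union>v\<in>V. set (rot v))"

definition arcs :: "nat set \<Rightarrow> (nat \<Rightarrow> 'a list) \<Rightarrow> ('a \<times> bool) rel" where
  "arcs V rot = (\<Union>v\<in>V. list_arcs (rot v))"

text \<open>Here the relation \<open>\<sigma>\<close> need not come from the sides of ribbons.\<close>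

definition faces :: "nat set \<Rightarrow> (nat \<Rightarrow> 'a list) \<Rightarrow> ('a \<times> bool) rel \<Rightarrow> nat" where
  "faces V rot \<sigma> = ccount (halves V rot \<times> UNIV) (arcs V rot \<union> \<sigma>) + card {v \<in> V. rot v = []}"

text \<open>Half-edges need not come in opposite pairs and signs are absent, so that half-edges can
  be removed one at a time.\<close>

definition rotation_system :: "nat set \<Rightarrow> (nat \<Rightarrow> 'a list) \<Rightarrow> bool" where
  "rotation_system V rot \<longleftrightarrow> finite V \<and> (\<forall>v\<in>V. distinct (rot v)) \<and>
     (\<forall>v\<in>V. \<forall>w\<in>V. v \<noteq> w \<longrightarrow> set (rot v) \<inter> set (rot w) = {})"

lemma rotation_systemD:
  assumes "rotation_system V rot"
  shows "finite V" "v \<in> V \<Longrightarrow> distinct (rot v)"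
    "v \<in> V \<Longrightarrow> w \<in> V \<Longrightarrow> h \<in> set (rot v) \<Longrightarrow> h \<in> set (rot w) \<Longrightarrow> v = w"
  using assms unfolding rotation_system_def by blast+

lemma rotation_systemI:
  assumes "finite V" "\<And>v. v \<in> V \<Longrightarrow> distinct (rot v)"
    "\<And>v w h. v \<in> V \<Longrightarrow> w \<in> V \<Longrightarrow> h \<in> set (rot v) \<Longrightarrow> h \<in> set (rot w) \<Longrightarrow> v = w"
  shows "rotation_system V rot"
  using assms unfolding rotation_system_def by blast

lemma rotation_system_filter:
  "rotation_system V rot \<Longrightarrow> rotation_system V (\<lambda>v. filter P (rot v))"
  by (rule rotation_systemI) (auto dest: rotation_systemD)

lemma rotation_system_merge:
  assumes rs: "rotation_system V rot" and "v \<in> V" "w \<in> V" "v \<noteq> w"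
    and "distinct xs" "set xs \<subseteq> set (rot v) \<union> set (rot w)"
  shows "rotation_system (V - {w}) (rot(v := xs))"
proof (rule rotation_systemI)
  fix u u' h assume u: "u \<in> V - {w}" "u' \<in> V - {w}" "h \<in> set ((rot(v := xs)) u)" "h \<in> set ((rot(v := xs)) u')"
  then have "\<exists>t\<in>{u, w}. h \<in> set (rot t) \<and> (t = w \<longrightarrow> u = v)" "\<exists>t\<in>{u', w}. h \<in> set (rot t) \<and> (t = w \<longrightarrow> u' = v)"
    using assms by (auto split: if_splits)
  then show "u = u'" using u assms(3) rotation_systemD(3)[OF rs] by blast
qed (use assms rotation_systemD[OF rs] in auto)

lemma boundary_components_eq_faces:
  "boundary_components G = faces (verts G) (rotn G) (ribbon_sides G)"
proof -
  have "vertex_arcs G = arcs (verts G) (rotn G)"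
    by (auto simp: vertex_arcs_def arcs_def list_arcs_def)
  moreover have "A \<union> A\<inverse> \<union> B \<union> B\<inverse> = (A \<union> B) \<union> (A \<union> B)\<inverse>"
    for A B :: "(half_edge \<times> bool) rel" by auto
  ultimately show ?thesis
    by (simp add: boundary_components_def faces_def ccount_def conn_def halves_def half_edges_def)
qed

lemma faces_cong:
  assumes "\<And>v. v \<in> V \<Longrightarrow> rot v = rot' v"
  shows "faces V rot \<sigma> = faces V rot' \<sigma>"
proof -
  have "{v \<in> V. rot v = []} = {v \<in> V. rot' v = []}" using assms by auto
  with assms show ?thesis by (simp add: faces_def halves_def arcs_def)
qed

lemma faces_rotate:
  assumes "rot v = xs @ ys"
  shows "faces V (rot(v := ys @ xs)) \<sigma> = faces V rot \<sigma>"
proof -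
  have "set ((rot(v := ys @ xs)) w) = set (rot w)" "list_arcs ((rot(v := ys @ xs)) w) = list_arcs (rot w)"
    "(rot(v := ys @ xs)) w = [] \<longleftrightarrow> rot w = []" for w
    using assms by (auto simp: list_arcs_append_commute)
  then show ?thesis by (simp add: faces_def halves_def arcs_def)
qed

section \<open>Removing half-edges and contracting ribbons in rotation systems\<close>

lemma arcs_subset: "arcs V rot \<subseteq> (halves V rot \<times> UNIV) \<times> (halves V rot \<times> UNIV)"
  using list_arcs_subset by (fastforce simp: arcs_def halves_def)

lemma halves_split: "v \<in> V \<Longrightarrow> halves V rot = set (rot v) \<union> halves (V - {v}) rot"
  by (auto simp: halves_def)

lemma arcs_split: "v \<in> V \<Longrightarrow> arcs V rot = list_arcs (rot v) \<union> arcs (V - {v}) rot"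
  by (auto simp: arcs_def)

lemma halves_upd: "v \<notin> V \<Longrightarrow> halves V (rot(v := xs)) = halves V rot"
  unfolding halves_def by (rule SUP_cong) auto

lemma arcs_upd: "v \<notin> V \<Longrightarrow> arcs V (rot(v := xs)) = arcs V rot"
  unfolding arcs_def by (rule SUP_cong) auto

lemma finite_halves: "finite V \<Longrightarrow> finite (halves V rot)"
  by (simp add: halves_def)

text \<open>Joining the two ends of \<open>h\<close> lets the boundary run past \<open>h\<close>. If
  other half-edges remain at the vertex, the two points are merely suppressed; if not, they form a
  circle of their own, which reappears on the right as the boundary of an isolated vertex.\<close>

lemma faces_remove_Cons:
  assumes fin: "finite V" and v: "v \<in> V" "rot v = h # zs" and h: "h \<notin> set zs" "h \<notin> halves (V - {v}) rot"
    and \<sigma>: "\<sigma> \<subseteq> (halves V (rot(v := zs)) \<times> UNIV) \<times> (halves V (rot(v := zs)) \<times> UNIV)"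
  shows "faces V rot (insert ((h, False), (h, True)) \<sigma>) = faces V (rot(v := zs)) \<sigma>"
proof -
  let ?S = "halves V (rot(v := zs)) \<times> (UNIV :: bool set)"
  let ?A = "arcs (V - {v}) rot"
  have S': "halves V rot \<times> UNIV = insert (h, False) (insert (h, True) ?S)"
    using v by (auto simp: halves_split[OF v(1)] halves_upd)
  have hS: "(h, b) \<notin> ?S" for b
    using h by (auto simp: halves_split[OF v(1)] halves_upd)
  have A: "?A \<subseteq> ?S \<times> ?S"
    using arcs_subset[of "V - {v}" rot] by (auto simp: halves_split[OF v(1)] halves_upd)
  have arcs': "arcs V (rot(v := zs)) = list_arcs zs \<union> ?A"
    by (simp add: arcs_split[OF v(1)] arcs_upd)
  have finS: "finite ?S" using fin by (simp add: finite_halves)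
  show ?thesis
  proof (cases "zs = []")
    case True
    let ?T = "{(h, False), (h, True)}"
    have "ccount (halves V rot \<times> UNIV) (arcs V rot \<union> insert ((h, False), (h, True)) \<sigma>) =
      ccount (?S \<union> ?T) ((?A \<union> \<sigma>) \<union> {((h, True), (h, False)), ((h, False), (h, True))})"
      by (simp add: S' arcs_split[OF v(1)] v(2) True list_arcs_eq insert_commute Un_commute)
    also have "\<dots> = ccount ?S (?A \<union> \<sigma>) + ccount ?T {((h, True), (h, False)), ((h, False), (h, True))}"
      using hS A \<sigma> finS by (intro ccount_Un) auto
    also have "ccount ?T {((h, True), (h, False)), ((h, False), (h, True))} = 1"
      by (rule ccount_one[of "(h, True)"]) (auto intro: conn_base)
    finally have 1: "ccount (halves V rot \<times> UNIV) (arcs V rot \<union> insert ((h, False), (h, True)) \<sigma>) =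
      Suc (ccount ?S (?A \<union> \<sigma>))" by (simp del: fun_upd_apply)
    have "{w \<in> V. (rot(v := zs)) w = []} = insert v {w \<in> V. rot w = []}" using v True by auto
    moreover have "v \<notin> {w \<in> V. rot w = []}" using v by simp
    ultimately have "card {w \<in> V. (rot(v := zs)) w = []} = Suc (card {w \<in> V. rot w = []})"
      using fin by simp
    moreover have "arcs V (rot(v := zs)) = ?A" unfolding arcs' by (simp add: True list_arcs_eq)
    ultimately show ?thesis using 1 by (simp add: faces_def del: fun_upd_apply)
  next
    case False
    let ?p = "(last zs, True)" and ?q = "(hd zs, False)"
    have pq: "?p \<in> ?S" "?q \<in> ?S" using False by (auto simp: halves_split[OF v(1)])
    have P: "path_arcs zs \<union> ?A \<union> \<sigma> \<subseteq> ?S \<times> ?S"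
      using A \<sigma> path_arcs_subset[of zs] list.set_sel(2)[of zs] False
      by (fastforce simp: halves_split[OF v(1)])
    have "arcs V rot \<union> insert ((h, False), (h, True)) \<sigma> =
      insert ((h, False), (h, True)) (insert (?p, (h, False)) (insert ((h, True), ?q)
        (path_arcs zs \<union> ?A \<union> \<sigma>)))"
      using False path_arcs_append[of "[h]" zs] by (auto simp: arcs_split[OF v(1)] v(2) list_arcs_eq)
    then have "ccount (halves V rot \<times> UNIV) (arcs V rot \<union> insert ((h, False), (h, True)) \<sigma>) =
      ccount ?S (insert (?p, ?q) (path_arcs zs \<union> ?A \<union> \<sigma>))"
      using ccount_suppress[OF pq hS[of False] hS[of True] _ P] by (simp add: S')
    also have "insert (?p, ?q) (path_arcs zs \<union> ?A \<union> \<sigma>) = arcs V (rot(v := zs)) \<union> \<sigma>"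
      using False by (auto simp: arcs' list_arcs_eq)
    finally have "ccount (halves V rot \<times> UNIV) (arcs V rot \<union> insert ((h, False), (h, True)) \<sigma>) =
      ccount ?S (arcs V (rot(v := zs)) \<union> \<sigma>)" .
    moreover have "{w \<in> V. rot w = []} = {w \<in> V. (rot(v := zs)) w = []}" using v False by auto
    ultimately show ?thesis by (simp add: faces_def del: fun_upd_apply)
  qed
qed

lemma faces_remove:
  assumes rs: "rotation_system V rot" and h: "h \<in> halves V rot"
    and \<sigma>: "\<sigma> \<subseteq> ((halves V rot - {h}) \<times> UNIV) \<times> ((halves V rot - {h}) \<times> UNIV)"
  shows "faces V rot (insert ((h, False), (h, True)) \<sigma>) = faces V (\<lambda>v. filter (\<lambda>k. k \<noteq> h) (rot v)) \<sigma>"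
proof -
  obtain v xs ys where v: "v \<in> V" "rot v = xs @ h # ys"
    using h by (auto simp: halves_def dest: split_list)
  let ?r = "rot(v := h # ys @ xs)"
  have d: "h \<notin> set xs" "h \<notin> set ys" using rs v by (auto simp: rotation_system_def)
  have o: "h \<notin> set (rot w)" if "w \<in> V" "w \<noteq> v" for w
    using rs v that by (fastforce simp: rotation_system_def)
  have H: "halves V rot - {h} = halves V (?r(v := ys @ xs))"
    using d o v by (auto simp: halves_split[OF v(1)] halves_upd) (auto simp: halves_def)
  have "faces V rot (insert ((h, False), (h, True)) \<sigma>) = faces V ?r (insert ((h, False), (h, True)) \<sigma>)"
    using faces_rotate[of rot v xs "h # ys" V] v(2) by simp
  also have "\<dots> = faces V (?r(v := ys @ xs)) \<sigma>"
  proof (rule faces_remove_Cons)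
    show "h \<notin> halves (V - {v}) ?r" using o by (auto simp: halves_def)
    show "\<sigma> \<subseteq> (halves V (?r(v := ys @ xs)) \<times> UNIV) \<times> (halves V (?r(v := ys @ xs)) \<times> UNIV)"
      using \<sigma> unfolding H .
  qed (use rs v d in \<open>auto simp: rotation_system_def\<close>)
  also have "\<dots> = faces V (rot(v := xs @ ys)) \<sigma>"
    using faces_rotate[of "rot(v := xs @ ys)" v xs ys V \<sigma>] by simp
  also have "\<dots> = faces V (\<lambda>v. filter (\<lambda>k. k \<noteq> h) (rot v)) \<sigma>"
  proof (rule faces_cong)
    fix w assume "w \<in> V"
    have "filter (\<lambda>k. k \<noteq> h) zs = zs" if "h \<notin> set zs" for zs
      using that by (auto intro: filter_True)
    then show "(rot(v := xs @ ys)) w = filter (\<lambda>k. k \<noteq> h) (rot w)"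
      using d v o[of w] \<open>w \<in> V\<close> by simp
  qed
  finally show ?thesis .
qed

text \<open>
  Exchanging the points \<open>(h, False)\<close> and \<open>(h', False)\<close> turns the contraction of a ribbon into the
  removal of two half-edges from the merged vertex.
\<close>

lemma faces_contract:
  assumes rs: "rotation_system V rot" and vw: "v \<in> V" "w \<in> V" "v \<noteq> w"
    and rot: "rot v = h # a" "rot w = h' # b"
    and \<sigma>: "\<sigma> \<subseteq> ((halves V rot - {h, h'}) \<times> UNIV) \<times> ((halves V rot - {h, h'}) \<times> UNIV)"
  shows "faces V rot (insert ((h, False), (h', True)) (insert ((h', False), (h, True)) \<sigma>)) =
    faces (V - {w}) (rot(v := a @ b)) \<sigma>"
proof -
  let ?V = "V - {w}" and ?r = "rot(v := h # a @ h' # b)" and ?A = "arcs (V - {v} - {w}) rot"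
  let ?\<phi> = "\<lambda>x. if x = (h, False) then (h', False) else if x = (h', False) then (h, False) else x"
  have v': "v \<in> ?V" and w': "w \<in> V - {v}" using vw by auto
  have d: "distinct (h # a @ h' # b)"
    using rs vw rot unfolding rotation_system_def by (metis disjoint_iff distinct_append append_Cons)
  have o: "h \<notin> set (rot u)" "h' \<notin> set (rot u)" if "u \<in> V" "u \<noteq> v" "u \<noteq> w" for u
    using rs vw rot that unfolding rotation_system_def by (metis disjoint_iff list.set_intros(1))+
  have hV: "h \<in> halves V rot" "h' \<in> halves V rot"
    using rot by (simp_all add: halves_split[OF vw(1)]) (simp add: halves_split[OF w'])
  have Vw: "V - {w} - {v} = V - {v} - {w}" by auto
  have H: "halves ?V ?r = halves V rot"
    using vw rot by (auto simp: halves_split[OF v'] halves_split[OF vw(1)] halves_split[OF w'] halves_upd Vw)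
  have Af: "?A \<subseteq> ((halves V rot - {h, h'}) \<times> UNIV) \<times> ((halves V rot - {h, h'}) \<times> UNIV)"
    using arcs_subset[of "V - {v} - {w}" rot] o by (fastforce simp: halves_def)
  have fix_off: "map_prod ?\<phi> ?\<phi> ` X = X"
    if off: "\<And>p q. (p, q) \<in> X \<Longrightarrow> p \<notin> {(h, False), (h', False)} \<and> q \<notin> {(h, False), (h', False)}" for X
  proof -
    have "map_prod ?\<phi> ?\<phi> z = z" if "z \<in> X" for z
      using off[of "fst z" "snd z"] that by (cases z) auto
    then show ?thesis by simp
  qed
  have P: "map_prod ?\<phi> ?\<phi> ` path_arcs (h # a) = path_arcs (h # a)"
    "map_prod ?\<phi> ?\<phi> ` path_arcs (h' # b) = path_arcs (h' # b)"
  proof -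
    have "p \<notin> {(h, False), (h', False)} \<and> q \<notin> {(h, False), (h', False)}"
      if "(p, q) \<in> path_arcs xs" "h \<notin> set (tl xs)" "h' \<notin> set (tl xs)" for p q xs
      using subsetD[OF path_arcs_subset that(1)] that(2,3) by auto
    then show "map_prod ?\<phi> ?\<phi> ` path_arcs (h # a) = path_arcs (h # a)"
      "map_prod ?\<phi> ?\<phi> ` path_arcs (h' # b) = path_arcs (h' # b)"
      using d by (intro fix_off; simp)+
  qed
  have A: "map_prod ?\<phi> ?\<phi> ` ?A = ?A" and \<sigma>': "map_prod ?\<phi> ?\<phi> ` \<sigma> = \<sigma>"
    by (intro fix_off; use Af \<sigma> in blast)+
  \<comment> \<open>The exchange has two effects: it redirects the two closing arcs, which fuses the
    two cyclic orders into one, and it turns the two sides of the ribbon into pairs joining the ends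
    of a single half-edge, as \<open>faces_remove\<close> requires.\<close>
  let ?R = "arcs V rot \<union> insert ((h, False), (h', True)) (insert ((h', False), (h, True)) \<sigma>)"
  let ?R' = "arcs ?V ?r \<union> insert ((h, False), (h, True)) (insert ((h', False), (h', True)) \<sigma>)"
  have "?R = insert ((h, False), (h', True)) (insert ((h', False), (h, True))
     (insert ((last (h # a), True), (h, False)) (insert ((last (h' # b), True), (h', False))
       (path_arcs (h # a) \<union> path_arcs (h' # b) \<union> ?A \<union> \<sigma>))))"
    using vw rot by (auto simp: arcs_split[OF vw(1)] arcs_split[OF w'] list_arcs_eq)
  moreover have "?R' = insert ((h', False), (h', True)) (insert ((h, False), (h, True))
     (insert ((last (h # a), True), (h', False)) (insert ((last (h' # b), True), (h, False))
       (path_arcs (h # a) \<union> path_arcs (h' # b) \<union> ?A \<union> \<sigma>))))"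
    using vw rot path_arcs_append[of "h # a" "h' # b"]
    by (auto simp: arcs_split[OF v'] arcs_upd list_arcs_eq Vw)
  ultimately have R': "?R' = map_prod ?\<phi> ?\<phi> ` ?R"
    using d by (simp only: image_insert image_Un P A \<sigma>') auto
  have bij: "bij_betw ?\<phi> (halves V rot \<times> UNIV) (halves V rot \<times> UNIV)"
    using hV by (intro bij_betw_byWitness[where f' = ?\<phi>]) auto
  have "?R \<subseteq> (halves V rot \<times> UNIV) \<times> (halves V rot \<times> UNIV)"
    using arcs_subset[of V rot] \<sigma> hV by auto
  then have "ccount (halves V rot \<times> UNIV) ?R = ccount (halves V rot \<times> UNIV) ?R'"
    by (rule ccount_bij[OF bij _ R'])
  moreover have "{u \<in> V. rot u = []} = {u \<in> ?V. ?r u = []}" using vw rot by auto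
  ultimately have "faces V rot (insert ((h, False), (h', True)) (insert ((h', False), (h, True)) \<sigma>)) =
      faces ?V ?r (insert ((h, False), (h, True)) (insert ((h', False), (h', True)) \<sigma>))"
    by (simp add: faces_def H)
  also have "\<dots> = faces ?V (\<lambda>u. filter (\<lambda>k. k \<noteq> h) (?r u)) (insert ((h', False), (h', True)) \<sigma>)"
  proof (rule faces_remove)
    show "rotation_system ?V ?r"
      by (rule rotation_system_merge[OF rs vw d]) (auto simp: rot)
    show "h \<in> halves ?V ?r" using hV by (simp add: H)
    show "insert ((h', False), (h', True)) \<sigma> \<subseteq>
        ((halves ?V ?r - {h}) \<times> UNIV) \<times> ((halves ?V ?r - {h}) \<times> UNIV)"
      unfolding H using \<sigma> d hV by auto
  qed
  also have "\<dots> = faces ?V (\<lambda>u. filter (\<lambda>k. k \<noteq> h') (filter (\<lambda>k. k \<noteq> h) (?r u))) \<sigma>"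
  proof (rule faces_remove)
    show "rotation_system ?V (\<lambda>u. filter (\<lambda>k. k \<noteq> h) (?r u))"
      by (intro rotation_system_filter rotation_system_merge[OF rs vw d]) (auto simp: rot)
    have *: "halves ?V (\<lambda>u. filter (\<lambda>k. k \<noteq> h) (?r u)) = halves V rot - {h}"
      unfolding H[symmetric] by (auto simp: halves_def)
    show "h' \<in> halves ?V (\<lambda>u. filter (\<lambda>k. k \<noteq> h) (?r u))"
      using d hV unfolding * by auto
    show "\<sigma> \<subseteq> ((halves ?V (\<lambda>u. filter (\<lambda>k. k \<noteq> h) (?r u)) - {h'}) \<times> UNIV) \<times>
        ((halves ?V (\<lambda>u. filter (\<lambda>k. k \<noteq> h) (?r u)) - {h'}) \<times> UNIV)"
      unfolding * using \<sigma> by auto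
  qed
  also have "\<dots> = faces ?V (rot(v := a @ b)) \<sigma>"
  proof (rule faces_cong)
    fix u assume u: "u \<in> ?V"
    have "filter (\<lambda>k. k \<noteq> h') (filter (\<lambda>k. k \<noteq> h) zs) = zs" if "h \<notin> set zs" "h' \<notin> set zs" for zs
      using that by (auto intro!: filter_True)
    then show "filter (\<lambda>k. k \<noteq> h') (filter (\<lambda>k. k \<noteq> h) (?r u)) = (rot(v := a @ b)) u"
      using o[of u] u d by auto
  qed
  finally show ?thesis .
qed

section \<open>Ribbon graphs\<close>

lemma opp_opp [simp]: "opp (opp h) = h"
  by (simp add: opp_def)

lemma fst_opp [simp]: "fst (opp h) = fst h"
  by (simp add: opp_def)

lemma opp_pair [simp]: "opp (e, b) = (e, \<not> b)"
  by (simp add: opp_def)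

lemma fst_eq_iff: "fst (h :: half_edge) = fst k \<longleftrightarrow> h = k \<or> h = opp k"
  by (cases h; cases k) (auto simp: opp_def)

lemma ribbon_graph_iff:
  "ribbon_graph G \<longleftrightarrow> rotation_system (verts G) (rotn G) \<and> (\<forall>v. v \<notin> verts G \<longrightarrow> rotn G v = []) \<and>
     (\<forall>h\<in>half_edges G. opp h \<in> half_edges G) \<and> neg G \<subseteq> edges G"
  by (auto simp: ribbon_graph_def rotation_system_def)

lemma halves_eq_half_edges: "halves (verts G) (rotn G) = half_edges G"
  by (simp add: halves_def half_edges_def)

lemma ribbon_graphD:
  assumes "ribbon_graph G"
  shows "rotation_system (verts G) (rotn G)" "finite (verts G)" "v \<notin> verts G \<Longrightarrow> rotn G v = []"
    "h \<in> half_edges G \<Longrightarrow> opp h \<in> half_edges G" "neg G \<subseteq> edges G"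
    "distinct (rotn G v)"
  using assms by (cases "v \<in> verts G"; auto simp: ribbon_graph_iff rotation_system_def)+

lemma half_edge_iff: "ribbon_graph G \<Longrightarrow> h \<in> half_edges G \<longleftrightarrow> fst h \<in> edges G"
proof
  assume G: "ribbon_graph G" and "fst h \<in> edges G"
  then obtain k where k: "k \<in> half_edges G" "fst h = fst k" by (auto simp: edges_def)
  then have "h = k \<or> h = opp k" by (cases h; cases k) (auto simp: opp_def)
  then show "h \<in> half_edges G" using k(1) ribbon_graphD(4)[OF G k(1)] by auto
qed (simp add: edges_def)

lemma half_edges_eq: "ribbon_graph G \<Longrightarrow> half_edges G = edges G \<times> UNIV"
  using half_edge_iff by (metis UNIV_I mem_Times_iff subsetI subset_antisym)

lemma finite_half_edges: "ribbon_graph G \<Longrightarrow> finite (half_edges G)"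
  by (simp add: half_edges_def ribbon_graphD(2))

lemma finite_edges: "ribbon_graph G \<Longrightarrow> finite (edges G)"
  by (simp add: edges_def finite_half_edges)

lemma att_eq:
  assumes "ribbon_graph G" "v \<in> verts G" "h \<in> set (rotn G v)"
  shows "att G h = v"
  unfolding att_def using assms rotation_systemD(3)[OF ribbon_graphD(1)[OF assms(1)]]
  by (intro the_equality) blast+

lemma att_mem:
  assumes "ribbon_graph G" "h \<in> half_edges G"
  shows "att G h \<in> verts G" "h \<in> set (rotn G (att G h))"
proof -
  obtain v where "v \<in> verts G" "h \<in> set (rotn G v)" using assms(2) by (auto simp: half_edges_def)
  with att_eq[OF assms(1) this] show "att G h \<in> verts G" "h \<in> set (rotn G (att G h))" by simp_all
qed

lemma att_mem_edge:
  assumes "ribbon_graph G" "e \<in> edges G"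
  shows "att G (e, b) \<in> verts G" "(e, b) \<in> set (rotn G (att G (e, b)))"
  using att_mem[OF assms(1)] assms by (simp_all add: half_edge_iff)

lemma mem_rotn_iff:
  assumes "ribbon_graph G"
  shows "h \<in> set (rotn G v) \<longleftrightarrow> h \<in> half_edges G \<and> att G h = v"
  using assms att_mem[OF assms, of h] att_eq[OF assms, of v h] ribbon_graphD(3)[OF assms, of v]
  by (cases "v \<in> verts G") (auto simp: half_edges_def)

text \<open>One pair per edge suffices because \<open>conn\<close> symmetrizes; adding an edge then
  inserts a single pair.\<close>

definition ends :: "ribbon \<Rightarrow> nat rel" where
  "ends G = {(att G (e, False), att G (e, True)) | e. e \<in> edges G}"

lemma endsI: "e \<in> edges G \<Longrightarrow> (att G (e, False), att G (e, True)) \<in> ends G"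
  unfolding ends_def by blast

lemma components_eq_ccount:
  assumes "ribbon_graph G"
  shows "components G = ccount (verts G) (ends G)"
proof -
  have "adjacency G = ends G \<union> (ends G)\<inverse>"
  proof (rule set_eqI)
    fix p
    have "p \<in> adjacency G \<longleftrightarrow> (\<exists>e b. e \<in> edges G \<and> p = (att G (e, b), att G (e, \<not> b)))"
      unfolding adjacency_def half_edges_eq[OF assms] by auto
    also have "\<dots> \<longleftrightarrow> p \<in> ends G \<union> (ends G)\<inverse>"
      unfolding ends_def by (cases p) (auto simp: ex_bool_eq)
    finally show "p \<in> adjacency G \<longleftrightarrow> p \<in> ends G \<union> (ends G)\<inverse>" .
  qed
  then show ?thesis by (simp add: components_def ccount_def conn_def)
qed

lemma ends_subset: "ribbon_graph G \<Longrightarrow> ends G \<subseteq> verts G \<times> verts G"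
  by (auto simp: ends_def att_mem_edge)

text \<open>A one-directional form of \<open>ribbon_sides\<close>. The edge set is a parameter, so
  the two sides of one ribbon can be split off.\<close>

definition sides :: "nat set \<Rightarrow> nat set \<Rightarrow> (half_edge \<times> bool) rel" where
  "sides N A = {(((e, False), b), ((e, True), if e \<in> N then b else \<not> b)) | e b. e \<in> A}"

lemma faces_sym_cong:
  assumes "\<sigma> \<union> \<sigma>\<inverse> = \<tau> \<union> \<tau>\<inverse>"
  shows "faces V rot \<sigma> = faces V rot \<tau>"
proof -
  have "conn (arcs V rot \<union> \<sigma>) = conn (arcs V rot \<union> \<tau>)"
    using assms by (intro conn_eqI subsetI) (auto intro: conn_base conn_base')
  then show ?thesis by (simp add: faces_def ccount_def)
qed

lemma boundary_components_eq:
  assumes "ribbon_graph G"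
  shows "boundary_components G = faces (verts G) (rotn G) (sides (neg G) (edges G))"
proof -
  have "ribbon_sides G \<union> (ribbon_sides G)\<inverse> = sides (neg G) (edges G) \<union> (sides (neg G) (edges G))\<inverse>"
    (is "?L = ?R")
  proof (rule set_eqI)
    fix p
    have "p \<in> ?L \<longleftrightarrow> (\<exists>e c b. e \<in> edges G \<and> p = (((e, c), b), ((e, \<not> c), if e \<in> neg G then b else \<not> b)))"
      unfolding ribbon_sides_def half_edges_eq[OF assms] by (cases p) auto
    also have "\<dots> \<longleftrightarrow> p \<in> ?R"
      unfolding sides_def by (cases p) (auto simp: ex_bool_eq)
    finally show "p \<in> ?L \<longleftrightarrow> p \<in> ?R" .
  qed
  then show ?thesis unfolding boundary_components_eq_faces by (rule faces_sym_cong)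
qed

lemma boundary_components_ccount:
  "ribbon_graph G \<Longrightarrow> boundary_components G =
    ccount (half_edges G \<times> UNIV) (arcs (verts G) (rotn G) \<union> sides (neg G) (edges G)) +
    card {v \<in> verts G. rotn G v = []}"
  by (simp add: boundary_components_eq faces_def halves_eq_half_edges)

lemma sides_insert:
  "sides N (insert e A) = insert (((e, False), False), ((e, True), e \<notin> N))
     (insert (((e, False), True), ((e, True), e \<in> N)) (sides N A))"
  unfolding sides_def by (auto simp: ex_bool_eq)

lemma sides_mono_neg: "N \<inter> A = N' \<inter> A \<Longrightarrow> sides N A = sides N' A"
  unfolding sides_def by (intro Collect_cong ex_cong1) auto

lemma sides_subset: "sides N A \<subseteq> ((A \<times> UNIV) \<times> UNIV) \<times> ((A \<times> UNIV) \<times> UNIV)"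
  by (auto simp: sides_def)

section \<open>Spanning subgraphs and deletion\<close>

lemma spanning_simps [simp]:
  "verts (spanning G A) = verts G"
  "rotn (spanning G A) v = filter (\<lambda>h. fst h \<in> A) (rotn G v)"
  "neg (spanning G A) = neg G \<inter> A"
  by (simp_all add: spanning_def)

lemma half_edges_spanning: "half_edges (spanning G A) = {h \<in> half_edges G. fst h \<in> A}"
  by (auto simp: half_edges_def)

lemma edges_spanning [simp]: "edges (spanning G A) = edges G \<inter> A"
  by (auto simp: edges_def half_edges_spanning)

lemma ribbon_graph_spanning:
  assumes "ribbon_graph G" shows "ribbon_graph (spanning G A)"
proof -
  have "rotation_system (verts (spanning G A)) (rotn (spanning G A))"
    using rotation_system_filter[OF ribbon_graphD(1)[OF assms]] by (simp add: spanning_def)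
  moreover have "neg (spanning G A) \<subseteq> edges (spanning G A)"
    using ribbon_graphD(5)[OF assms] by auto
  ultimately show ?thesis
    using ribbon_graphD(3,4)[OF assms] by (simp add: ribbon_graph_iff half_edges_spanning)
qed

lemma att_spanning:
  assumes "ribbon_graph G" "h \<in> half_edges G" "fst h \<in> A"
  shows "att (spanning G A) h = att G h"
  using att_mem[OF assms(1,2)] assms(3) by (intro att_eq ribbon_graph_spanning assms(1)) auto

lemma ends_spanning:
  assumes "ribbon_graph G" "A \<subseteq> edges G"
  shows "ends (spanning G A) = {(att G (e, False), att G (e, True)) | e. e \<in> A}"
proof -
  have "att (spanning G A) (e, b) = att G (e, b)" if "e \<in> A" for e b
    using assms that by (intro att_spanning) (auto simp: half_edge_iff)
  moreover have "edges G \<inter> A = A" using assms(2) by auto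
  ultimately show ?thesis unfolding ends_def edges_spanning by (intro Collect_cong ex_cong1) auto
qed

lemma spanning_spanning: "spanning (spanning G A) B = spanning G (A \<inter> B)"
  by (simp add: spanning_def conj_commute Int_assoc)

lemma spanning_delete:
  "A \<subseteq> edges G - {e} \<Longrightarrow> spanning (delete G e) A = spanning G A"
  by (simp add: delete_def spanning_spanning Int_absorb1)

lemma spanning_edges: "ribbon_graph G \<Longrightarrow> spanning G (edges G) = G"
proof -
  assume G: "ribbon_graph G"
  have "filter (\<lambda>h. fst h \<in> edges G) (rotn G v) = rotn G v" for v
    using mem_rotn_iff[OF G] half_edge_iff[OF G] by (auto intro!: filter_True)
  then show ?thesis using ribbon_graphD(5)[OF G] by (simp add: spanning_def Int_absorb2)
qed

lemma ribbon_graph_delete: "ribbon_graph G \<Longrightarrow> ribbon_graph (delete G e)"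
  by (simp add: delete_def ribbon_graph_spanning)

lemma edges_delete [simp]: "edges (delete G e) = edges G - {e}"
  by (auto simp: delete_def)

lemma verts_delete [simp]: "verts (delete G e) = verts G"
  by (simp add: delete_def)

text \<open>The deletion is expressed on the rotation system of \<open>G\<close> itself by undoing
  two applications of \<open>faces_remove\<close>. Compare \<open>boundary_components_split\<close>:
  only the pairing of the four ends at \<open>e\<close> differs.\<close>

lemma boundary_components_delete:
  assumes G: "ribbon_graph G" and e: "e \<in> edges G"
  shows "boundary_components (delete G e) = faces (verts G) (rotn G)
    (insert (((e, False), False), ((e, False), True)) (insert (((e, True), False), ((e, True), True))
      (sides (neg G) (edges G - {e}))))"
proof -
  let ?A = "edges G - {e}" and ?r = "\<lambda>v. filter (\<lambda>k. k \<noteq> (e, False)) (rotn G v)"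
  have H: "halves (verts G) (rotn G) = edges G \<times> UNIV"
    using G by (simp add: halves_eq_half_edges half_edges_eq)
  have H': "halves (verts G) ?r = edges G \<times> UNIV - {(e, False)}"
    unfolding H[symmetric] by (auto simp: halves_def)
  have "faces (verts G) (rotn G) (insert (((e, False), False), ((e, False), True))
      (insert (((e, True), False), ((e, True), True)) (sides (neg G) ?A))) =
    faces (verts G) ?r (insert (((e, True), False), ((e, True), True)) (sides (neg G) ?A))"
    using e sides_subset[of "neg G" ?A] by (intro faces_remove ribbon_graphD(1)[OF G]) (auto simp: H)
  also have "\<dots> = faces (verts G) (\<lambda>v. filter (\<lambda>k. k \<noteq> (e, True)) (?r v)) (sides (neg G) ?A)"
    using e sides_subset[of "neg G" ?A]
    by (intro faces_remove rotation_system_filter ribbon_graphD(1)[OF G]) (auto simp: H')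
  also have "\<dots> = faces (verts G) (rotn (delete G e)) (sides (neg G) ?A)"
  proof (rule faces_cong)
    fix v
    have "(k \<noteq> (e, True) \<and> k \<noteq> (e, False)) = (fst k \<in> edges G - {e})" if "k \<in> set (rotn G v)" for k
    proof -
      have "fst k \<in> edges G" using that mem_rotn_iff[OF G] half_edge_iff[OF G] by blast
      moreover have "fst k = e \<longleftrightarrow> k = (e, True) \<or> k = (e, False)" by (cases k) auto
      ultimately show ?thesis by auto
    qed
    then show "filter (\<lambda>k. k \<noteq> (e, True)) (?r v) = rotn (delete G e) v"
      by (auto simp: delete_def intro!: filter_cong)
  qed
  finally have "faces (verts G) (rotn (delete G e)) (sides (neg G) ?A) = faces (verts G) (rotn G)
    (insert (((e, False), False), ((e, False), True)) (insert (((e, True), False), ((e, True), True))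
      (sides (neg G) ?A)))" ..
  moreover have "sides (neg (delete G e)) (edges (delete G e)) = sides (neg G) ?A"
    unfolding edges_delete by (intro sides_mono_neg) (auto simp: delete_def)
  ultimately show ?thesis
    using boundary_components_eq[OF ribbon_graph_delete[OF G, of e]] by simp
qed

lemma boundary_components_split:
  assumes "ribbon_graph G" "e \<in> edges G"
  shows "boundary_components G = faces (verts G) (rotn G)
    (insert (((e, False), False), ((e, True), e \<notin> neg G)) (insert (((e, False), True), ((e, True), e \<in> neg G))
      (sides (neg G) (edges G - {e}))))"
  using assms sides_insert[of "neg G" e "edges G - {e}"]
  by (simp add: boundary_components_eq insert_absorb)

text \<open>On the common point set, putting \<open>e\<close> back re-pairs the four ends of its
  half-edges, which raises the count by at most one.\<close>

lemma boundary_components_le_delete: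
  assumes G: "ribbon_graph G" and e: "e \<in> edges G"
  shows "boundary_components G \<le> Suc (boundary_components (delete G e))"
proof -
  let ?R = "arcs (verts G) (rotn G) \<union> sides (neg G) (edges G - {e})"
  let ?S = "half_edges G \<times> (UNIV :: bool set)"
  have "ccount ?S (insert (((e, False), False), ((e, True), e \<notin> neg G))
      (insert (((e, False), True), ((e, True), e \<in> neg G)) ?R)) \<le>
    Suc (ccount ?S (insert (((e, False), False), ((e, False), True))
      (insert (((e, True), e \<notin> neg G), ((e, True), e \<in> neg G)) ?R)))"
    using G e by (intro ccount_switch_le) (auto simp: half_edge_iff finite_half_edges)
  \<comment> \<open>The sign of \<open>e\<close> decides in which order the switch lists the ends of
    \<open>(e, True)\<close>; as a connection the order is immaterial.\<close>
  also have "ccount ?S (insert (((e, False), False), ((e, False), True))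
      (insert (((e, True), e \<notin> neg G), ((e, True), e \<in> neg G)) ?R)) =
    ccount ?S (insert (((e, False), False), ((e, False), True))
      (insert (((e, True), False), ((e, True), True)) ?R))"
    using conn_insert_swap[of "((e, True), True)" "((e, True), False)"
        "insert (((e, False), False), ((e, False), True)) ?R"]
    by (cases "e \<in> neg G") (simp_all add: insert_commute ccount_def)
  finally show ?thesis
    by (simp add: boundary_components_split[OF G e] boundary_components_delete[OF G e] faces_def
        halves_eq_half_edges)
qed

lemma boundary_components_edgeless:
  assumes "ribbon_graph G" "edges G = {}"
  shows "boundary_components G = card (verts G)"
proof -
  have h: "half_edges G = {}" using assms by (simp add: edges_def)
  then have "{v \<in> verts G. rotn G v = []} = verts G" by (auto simp: half_edges_def)
  with h show ?thesis by (simp add: boundary_components_def)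
qed

text \<open>The edgeless graph has one boundary circle per vertex, and each edge adds at most one.
  For graphs of loops this bound is the nonnegativity of the Euler genus.\<close>

lemma boundary_components_le:
  "ribbon_graph G \<Longrightarrow> boundary_components G \<le> card (verts G) + card (edges G)"
proof (induction "card (edges G)" arbitrary: G)
  case 0
  then show ?case by (simp add: boundary_components_edgeless finite_edges)
next
  case (Suc n)
  then obtain e where e: "e \<in> edges G" by fastforce
  then have "n = card (edges (delete G e))" using Suc(2) by simp
  from Suc(1)[OF this ribbon_graph_delete[OF Suc(3)]]
  have "boundary_components (delete G e) \<le> card (verts G) + n" using \<open>n = _\<close> by simp
  then show ?case using boundary_components_le_delete[OF Suc(3) e] Suc(2) by linarith
qed

section \<open>Bridges\<close>

lemma length_filter_rotate1: "length (filter P (rotate1 xs)) = length (filter P xs)"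
  by (cases xs) auto

text \<open>Arcs match the points \<open>(h, True)\<close> of \<open>C\<close> with the points \<open>(k, False)\<close> of \<open>C\<close>.\<close>

lemma even_card_arcs_closed:
  assumes rs: "rotation_system V rot" and C: "C \<subseteq> halves V rot \<times> UNIV"
    and closed: "\<And>p q. (p, q) \<in> arcs V rot \<Longrightarrow> p \<in> C \<longleftrightarrow> q \<in> C"
  shows "even (card C)"
proof -
  let ?n = "\<lambda>b. card {h \<in> halves V rot. (h, b) \<in> C}"
  have card_set: "card {h \<in> set xs. P h} = length (filter P xs)" if "distinct xs" for P and xs :: "'a list"
    using that distinct_card[of "filter P xs"] by simp
  have vertex: "card {h \<in> set (rot v). (h, True) \<in> C} = card {h \<in> set (rot v). (h, False) \<in> C}"
    if v: "v \<in> V" for v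
  proof -
    let ?xs = "rot v"
    \<comment> \<open>\<open>rotate1\<close> aligns each half-edge with its cyclic successor, so an
      arc compares equal positions of the two lists.\<close>
    have "(?xs ! i, True) \<in> C \<longleftrightarrow> (rotate1 ?xs ! i, False) \<in> C" if "i < length ?xs" for i
    proof (rule closed)
      have "((?xs ! i, True), (?xs ! (Suc i mod length ?xs), False)) \<in> list_arcs ?xs"
        using that by (auto simp: list_arcs_def)
      then show "((?xs ! i, True), (rotate1 ?xs ! i, False)) \<in> arcs V rot"
        using that v by (auto simp: nth_rotate1 arcs_def)
    qed
    then have "length (filter (\<lambda>h. (h, True) \<in> C) ?xs) = length (filter (\<lambda>h. (h, False) \<in> C) (rotate1 ?xs))"
      by (auto simp: length_filter_conv_card intro!: arg_cong[where f = card])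
    then show ?thesis
      using rotation_systemD(2)[OF rs v] by (simp add: card_set length_filter_rotate1)
  qed
  have "?n b = (\<Sum>v\<in>V. card {h \<in> set (rot v). (h, b) \<in> C})" for b
  proof -
    have "{h \<in> halves V rot. (h, b) \<in> C} = (\<Union>v\<in>V. {h \<in> set (rot v). (h, b) \<in> C})"
      by (auto simp: halves_def)
    also have "card \<dots> = (\<Sum>v\<in>V. card {h \<in> set (rot v). (h, b) \<in> C})"
      using rotation_systemD(1,3)[OF rs] by (intro card_UN_disjoint) auto
    finally show ?thesis .
  qed
  then have eq: "?n True = ?n False" using vertex by simp
  have fin: "finite (halves V rot)" using rs by (simp add: finite_halves rotation_systemD(1))
  have "C = (\<lambda>h. (h, True)) ` {h \<in> halves V rot. (h, True) \<in> C} \<union>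
      (\<lambda>h. (h, False)) ` {h \<in> halves V rot. (h, False) \<in> C}"
    (is "_ = ?D")
  proof (rule set_eqI)
    fix p show "p \<in> C \<longleftrightarrow> p \<in> ?D" using C by (cases p; cases "snd p") auto
  qed
  also have "card \<dots> = ?n True + ?n False"
    using fin by (subst card_Un_disjoint) (auto simp: card_image inj_on_def)
  finally show ?thesis using eq by simp
qed

text \<open>
  Arcs match all points, and the sides of the other ribbons match all points but the four ends of
  the half-edges of \<open>e\<close>, so every connected component contains an even number of these four.
\<close>

lemma half_edge_ends_conn:
  assumes G: "ribbon_graph G" and e: "e \<in> edges G"
    and cut: "\<And>b'. (((e, c), b), ((e, \<not> c), b')) \<notin> conn (arcs (verts G) (rotn G) \<union> sides (neg G) (edges G - {e}))"
  shows "(((e, c), b), ((e, c), \<not> b)) \<in> conn (arcs (verts G) (rotn G) \<union> sides (neg G) (edges G - {e}))"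
proof (rule ccontr)
  let ?R = "arcs (verts G) (rotn G) \<union> sides (neg G) (edges G - {e})"
  let ?S = "half_edges G \<times> (UNIV :: bool set)"
  let ?p = "((e, c), b)"
  let ?C = "conn ?R `` {?p}"
  let ?f = "\<lambda>(h, b). (opp h, if fst h \<in> neg G then b else \<not> b)"
  assume no: "(?p, ((e, c), \<not> b)) \<notin> conn ?R"
  have RS: "?R \<subseteq> ?S \<times> ?S"
    using arcs_subset[of "verts G" "rotn G"] sides_subset[of "neg G" "edges G - {e}"]
    by (auto simp: halves_eq_half_edges half_edges_eq[OF G])
  have pS: "?p \<in> ?S" using G e by (simp add: half_edge_iff)
  have closed: "x \<in> ?C \<longleftrightarrow> y \<in> ?C" if "(x, y) \<in> conn ?R" for x y
    using that conn_trans conn_sym by (metis Image_singleton_iff)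
  have CS: "?C \<subseteq> ?S"
  proof
    fix q assume "q \<in> ?C"
    then have "(?p, q) \<in> conn ?R" by simp
    then show "q \<in> ?S" by (rule conn_closed) (use pS RS in blast)+
  qed
  have finC: "finite ?C" using finite_subset[OF CS] finite_half_edges[OF G] by simp
  have "even (card ?C)"
  proof (rule even_card_arcs_closed[OF ribbon_graphD(1)[OF G]])
    show "?C \<subseteq> halves (verts G) (rotn G) \<times> UNIV" using CS by (simp add: halves_eq_half_edges)
    show "x \<in> ?C \<longleftrightarrow> y \<in> ?C" if "(x, y) \<in> arcs (verts G) (rotn G)" for x y
      by (rule closed[OF conn_base]) (simp add: that)
  qed
  \<comment> \<open>By \<open>cut\<close> and the assumption \<open>no\<close>, \<open>?p\<close> is
    the only one of the four ends of \<open>e\<close> in its class. On the rest, crossing a ribbon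
    along a side is an involution without fixed points, which contradicts the evenness of the whole
    class.\<close>
  moreover have "even (card (?C - {?p}))"
  proof (rule even_card_involution[where f = ?f])
    fix x assume x: "x \<in> ?C - {?p}"
    obtain a d b' where xeq: "x = ((a, d), b')" by (metis surj_pair)
    have "a \<noteq> e"
    proof
      assume "a = e"
      with x xeq have "(?p, ((e, d), b')) \<in> conn ?R" "((e, d), b') \<noteq> ?p" by auto
      then show False using cut no by (cases "d = c"; cases "b' = b") auto
    qed
    moreover have "a \<in> edges G" using x CS xeq by (auto simp: half_edges_eq[OF G])
    ultimately have "(x, ?f x) \<in> sides (neg G) (edges G - {e}) \<or> (?f x, x) \<in> sides (neg G) (edges G - {e})"
      unfolding xeq sides_def by (cases d) auto
    then have "(x, ?f x) \<in> conn ?R"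
      using conn_base[of x "?f x" ?R] conn_base'[of "?f x" x ?R] by blast
    from closed[OF this] have "?f x \<in> ?C" using x by blast
    moreover have "?f x \<noteq> ?p" using \<open>a \<noteq> e\<close> xeq by auto
    ultimately show "?f x \<in> ?C - {?p} \<and> ?f (?f x) = x \<and> ?f x \<noteq> x" using xeq by auto
  qed (use finC in simp)
  moreover have "card ?C = Suc (card (?C - {?p}))"
    by (rule card.remove) (simp_all add: finC)
  ultimately show False by (metis even_Suc)
qed

text \<open>Without \<open>e\<close>, no boundary curve meets both half-edges of \<open>e\<close>,
  and by parity the two ends of each half-edge lie on one curve. Hence capping the half-edges
  changes nothing, while the first side of the ribbon merges two curves and the second side is then
  redundant.\<close>

lemma boundary_components_delete_bridge:
  assumes G: "ribbon_graph G" and e: "e \<in> edges G"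
    and br: "(att G (e, False), att G (e, True)) \<notin> conn (ends (delete G e))"
  shows "boundary_components (delete G e) = Suc (boundary_components G)"
proof -
  let ?R = "arcs (verts G) (rotn G) \<union> sides (neg G) (edges G - {e})"
  let ?S = "half_edges G \<times> (UNIV :: bool set)"
  \<comment> \<open>Moving along the boundary projects to moving along edges other than
    \<open>e\<close>.\<close>
  have att: "(att G (fst p), att G (fst q)) \<in> conn (ends (delete G e))" if "(p, q) \<in> conn ?R" for p q
    using that
  proof (rule conn_least)
    fix p q :: "half_edge \<times> bool" assume "(p, q) \<in> ?R"
    then show "(att G (fst p), att G (fst q)) \<in> conn (ends (delete G e))"
    proof
      assume "(p, q) \<in> arcs (verts G) (rotn G)"
      then obtain v where v: "v \<in> verts G" "(p, q) \<in> list_arcs (rotn G v)" by (auto simp: arcs_def)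
      then have "fst p \<in> set (rotn G v)" "fst q \<in> set (rotn G v)"
        using list_arcs_subset[of "rotn G v"] by auto
      then show ?thesis using att_eq[OF G v(1)] by simp
    next
      assume "(p, q) \<in> sides (neg G) (edges G - {e})"
      then have "(att G (fst p), att G (fst q)) \<in> ends (delete G e)"
        unfolding delete_def ends_spanning[OF G Diff_subset] by (auto simp: sides_def)
      then show ?thesis by (rule conn_base)
    qed
  qed
  have cut: "(((e, c), b), ((e, \<not> c), b')) \<notin> conn ?R" for c b b'
    using att[of "((e, c), b)" "((e, \<not> c), b')"] br conn_sym[of "att G (e, c)" "att G (e, \<not> c)"]
    by (cases c) auto
  have ends: "(((e, c), b), ((e, c), b')) \<in> conn ?R" for c b b'
    using half_edge_ends_conn[OF G e cut, of c b] by (cases "b' = b") auto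
  have inS: "((e, c), b) \<in> ?S" for c b using G e by (simp add: half_edge_iff)
  have finS: "finite ?S" using finite_half_edges[OF G] by simp
  have "ccount ?S (insert (((e, False), False), ((e, False), True)) (insert (((e, True), False), ((e, True), True)) ?R)) =
      ccount ?S ?R"
    unfolding ccount_def
    by (subst conn_insert_absorb, simp add: conn_insert ends, subst conn_insert_absorb) (simp_all add: ends)
  also have "\<dots> = Suc (ccount ?S (insert (((e, False), False), ((e, True), e \<notin> neg G)) ?R))"
    using cut[of False] by (intro ccount_insert finS inS) simp
  also have "ccount ?S (insert (((e, False), False), ((e, True), e \<notin> neg G)) ?R) =
      ccount ?S (insert (((e, False), True), ((e, True), e \<in> neg G))
        (insert (((e, False), False), ((e, True), e \<notin> neg G)) ?R))"
    unfolding ccount_def by (subst conn_insert_absorb) (simp_all add: conn_insert ends)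
  finally show ?thesis
    by (simp add: boundary_components_split[OF G e] boundary_components_delete[OF G e] faces_def
        halves_eq_half_edges insert_commute)
qed

section \<open>Contraction\<close>

lemma open_at_eq:
  assumes "h \<notin> set xs" shows "open_at h (xs @ h # ys) = ys @ xs"
proof -
  have "dropWhile (\<lambda>k. k \<noteq> h) (xs @ h # ys) = h # ys" "takeWhile (\<lambda>k. k \<noteq> h) (xs @ h # ys) = xs"
    using assms by (simp_all add: dropWhile_append3 takeWhile_tail) (induction xs; auto)+
  then show ?thesis by (simp add: open_at_def)
qed

lemma open_at_split:
  assumes "distinct xs" "h \<in> set xs"
  obtains ys zs where "xs = ys @ h # zs" "open_at h xs = zs @ ys" "h \<notin> set ys" "h \<notin> set zs"
  using assms open_at_eq[of h] by (metis distinct.simps(2) distinct_append disjoint_iff list.set_intros(1) split_list)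

lemma set_open_at: "distinct xs \<Longrightarrow> h \<in> set xs \<Longrightarrow> set (open_at h xs) = set xs - {h}"
  by (rule open_at_split[of xs h]) auto

lemma distinct_open_at: "distinct xs \<Longrightarrow> h \<in> set xs \<Longrightarrow> distinct (open_at h xs)"
  by (rule open_at_split[of xs h]) auto

lemma filter_open_at:
  assumes "distinct xs" "h \<in> set xs" "P h"
  shows "filter P (open_at h xs) = open_at h (filter P xs)"
  using assms(1,2) by (rule open_at_split) (use assms(3) in \<open>simp add: open_at_eq\<close>)

text \<open>The merged vertex keeps the name \<open>v\<close>. The locale is interpreted both for a
  graph and for its spanning subgraphs that contain \<open>e\<close>.\<close>

locale positive_link =
  fixes G e v w
  assumes G: "ribbon_graph G" and e: "e \<in> edges G" "e \<notin> neg G" "\<not> is_loop G e"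
  defines "v \<equiv> att G (e, False)" and "w \<equiv> att G (e, True)"
begin

lemma vw: "v \<in> verts G" "w \<in> verts G" "v \<noteq> w"
  "(e, False) \<in> set (rotn G v)" "(e, True) \<in> set (rotn G w)"
  using att_mem_edge[OF G e(1)] e by (auto simp: v_def w_def is_loop_def)

lemma not_mem: "(e, True) \<notin> set (rotn G v)" "(e, False) \<notin> set (rotn G w)"
  using mem_rotn_iff[OF G] vw(3) by (auto simp: v_def w_def)

lemma contract_pos_simps [simp]:
  "verts (contract_pos G e) = verts G - {w}"
  "neg (contract_pos G e) = neg G"
  "rotn (contract_pos G e) = (rotn G)
     (v := open_at (e, False) (rotn G v) @ open_at (e, True) (rotn G w), w := [])"
  by (simp_all add: contract_pos_def Let_def v_def w_def)

lemma set_merged: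
  "set (open_at (e, False) (rotn G v) @ open_at (e, True) (rotn G w)) =
     set (rotn G v) \<union> set (rotn G w) - {(e, False), (e, True)}"
  using vw not_mem by (auto simp: set_open_at ribbon_graphD(6)[OF G])

lemma half_edges_contract_pos: "half_edges (contract_pos G e) = half_edges G - {(e, False), (e, True)}"
proof -
  have "h \<in> half_edges (contract_pos G e) \<longleftrightarrow> h \<in> half_edges G - {(e, False), (e, True)}" for h
  proof -
    have "h \<in> half_edges (contract_pos G e) \<longleftrightarrow>
        (\<exists>u\<in>verts G. u \<noteq> w \<and> (if u = v then h \<in> set (rotn G v) \<union> set (rotn G w) - {(e, False), (e, True)}
           else h \<in> set (rotn G u)))"
      unfolding half_edges_def set_merged[symmetric] using vw by auto
    also have "\<dots> \<longleftrightarrow> h \<in> half_edges G - {(e, False), (e, True)}"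
    proof
      assume "h \<in> half_edges G - {(e, False), (e, True)}"
      then show "\<exists>u\<in>verts G. u \<noteq> w \<and> (if u = v then h \<in> set (rotn G v) \<union> set (rotn G w) - {(e, False), (e, True)}
           else h \<in> set (rotn G u))"
        using vw att_mem[OF G, of h] by (intro bexI[where x = "if att G h = w then v else att G h"]) auto
    next
      assume "\<exists>u\<in>verts G. u \<noteq> w \<and> (if u = v then h \<in> set (rotn G v) \<union> set (rotn G w) - {(e, False), (e, True)}
           else h \<in> set (rotn G u))"
      then show "h \<in> half_edges G - {(e, False), (e, True)}"
        using mem_rotn_iff[OF G] by (auto simp: v_def w_def split: if_splits)
    qed
    finally show ?thesis .
  qed
  then show ?thesis by blast
qed

lemma edges_contract_pos: "edges (contract_pos G e) = edges G - {e}"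
proof -
  have "half_edges (contract_pos G e) = (edges G - {e}) \<times> UNIV"
    by (auto simp: half_edges_contract_pos half_edges_eq[OF G])
  then show ?thesis by (simp add: edges_def[of "contract_pos G e"])
qed

lemma ribbon_graph_contract_pos: "ribbon_graph (contract_pos G e)"
  unfolding ribbon_graph_iff
proof (intro conjI allI impI ballI)
  have "rotation_system (verts G - {w}) ((rotn G)(v := open_at (e, False) (rotn G v) @ open_at (e, True) (rotn G w)))"
  proof (rule rotation_system_merge[OF ribbon_graphD(1)[OF G] vw(1-3)])
    show "distinct (open_at (e, False) (rotn G v) @ open_at (e, True) (rotn G w))"
      using vw mem_rotn_iff[OF G] by (auto simp: distinct_open_at set_open_at ribbon_graphD(6)[OF G])
  qed (use set_merged in auto)
  then show "rotation_system (verts (contract_pos G e)) (rotn (contract_pos G e))"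
    by (auto simp: rotation_system_def)
  show "neg (contract_pos G e) \<subseteq> edges (contract_pos G e)"
    using ribbon_graphD(5)[OF G] e by (auto simp: edges_contract_pos)
  show "rotn (contract_pos G e) u = []" if "u \<notin> verts (contract_pos G e)" for u
    using that ribbon_graphD(3)[OF G] vw by auto
  show "opp h \<in> half_edges (contract_pos G e)" if "h \<in> half_edges (contract_pos G e)" for h
    using that unfolding half_edges_contract_pos half_edges_eq[OF G] by (cases h) auto
qed

lemma att_contract_pos:
  assumes "f \<in> edges G" "f \<noteq> e"
  shows "att (contract_pos G e) (f, b) = (if att G (f, b) = w then v else att G (f, b))"
proof (rule att_eq[OF ribbon_graph_contract_pos])
  let ?u = "att G (f, b)"
  have u: "?u \<in> verts G" "(f, b) \<in> set (rotn G ?u)" using att_mem_edge[OF G assms(1)] by auto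
  show "(if ?u = w then v else ?u) \<in> verts (contract_pos G e)" using u vw by auto
  have "(f, b) \<in> set (open_at (e, False) (rotn G v) @ open_at (e, True) (rotn G w))" if "?u \<in> {v, w}"
    unfolding set_merged using that u assms(2) by auto
  then show "(f, b) \<in> set (rotn (contract_pos G e) (if ?u = w then v else ?u))"
    using u vw by auto
qed

text \<open>Collapsing \<open>w\<close> to \<open>v\<close> identifies only two vertices that
  \<open>e\<close> connects.\<close>

lemma components_contract_pos: "components (contract_pos G e) = components G"
proof -
  let ?\<phi> = "\<lambda>u. if u = w then v else u"
  have conn_vw: "(v, w) \<in> conn (ends G)" using e by (auto simp: ends_def v_def w_def intro: conn_base)
  have "ccount (verts G) (ends G) = ccount (verts G - {w}) (ends (contract_pos G e))"
  proof (rule ccount_map[where \<phi> = ?\<phi>])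
    show "?\<phi> ` verts G = verts G - {w}" using vw by auto
    show "(?\<phi> x, ?\<phi> y) \<in> conn (ends (contract_pos G e))" if xy: "(x, y) \<in> ends G" for x y
    proof -
      obtain f where f: "f \<in> edges G" "x = att G (f, False)" "y = att G (f, True)"
        using xy by (auto simp: ends_def)
      show ?thesis
      proof (cases "f = e")
        case True
        then show ?thesis using f by (simp add: v_def[symmetric] w_def[symmetric])
      next
        case False
        then have "(?\<phi> x, ?\<phi> y) \<in> ends (contract_pos G e)"
          using endsI[of f "contract_pos G e"] f(1) False
          unfolding f(2,3) by (simp add: edges_contract_pos att_contract_pos)
        then show ?thesis by (rule conn_base)
      qed
    qed
    show "\<exists>a\<in>verts G. \<exists>b\<in>verts G. ?\<phi> a = x \<and> ?\<phi> b = y \<and> (a, b) \<in> conn (ends G)"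
      if xy: "(x, y) \<in> ends (contract_pos G e)" for x y
    proof -
      obtain f where f: "f \<in> edges G" "f \<noteq> e" "x = att (contract_pos G e) (f, False)"
          "y = att (contract_pos G e) (f, True)"
        using xy by (auto simp: ends_def edges_contract_pos)
      then have "x = ?\<phi> (att G (f, False))" "y = ?\<phi> (att G (f, True))"
        by (simp_all add: att_contract_pos)
      moreover have "(att G (f, False), att G (f, True)) \<in> conn (ends G)"
        using f by (auto simp: ends_def intro: conn_base)
      ultimately show ?thesis using att_mem_edge(1)[OF G f(1)] by blast
    qed
    show "(x, y) \<in> conn (ends G)" if "?\<phi> x = ?\<phi> y" for x y
      using that conn_vw conn_sym[OF conn_vw] by (auto split: if_splits)
  qed
  then show ?thesis by (simp add: components_eq_ccount G ribbon_graph_contract_pos)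
qed

lemma boundary_components_contract_pos: "boundary_components (contract_pos G e) = boundary_components G"
proof -
  let ?h = "(e, False)" and ?h' = "(e, True)" and ?\<sigma> = "sides (neg G) (edges G - {e})"
  obtain a1 a2 where a: "rotn G v = a1 @ ?h # a2" "open_at ?h (rotn G v) = a2 @ a1"
    using open_at_split[OF ribbon_graphD(6)[OF G] vw(4)] by metis
  obtain b1 b2 where b: "rotn G w = b1 @ ?h' # b2" "open_at ?h' (rotn G w) = b2 @ b1"
    using open_at_split[OF ribbon_graphD(6)[OF G] vw(5)] by metis
  \<comment> \<open>Both rotations are cut open at \<open>e\<close>, the form in which
    \<open>faces_contract\<close> applies.\<close>
  let ?r1 = "(rotn G)(v := (?h # a2) @ a1)" and ?r = "(rotn G)(v := ?h # a2 @ a1, w := ?h' # b2 @ b1)"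
  have H: "halves (verts G) ?r = edges G \<times> UNIV"
    unfolding half_edges_eq[OF G, symmetric] half_edges_def halves_def
    by (rule SUP_cong) (use a b vw(3) in auto)
  have rs: "rotation_system (verts G) ?r"
  proof -
    have "set (?r u) = set (rotn G u)" "distinct (?r u) \<longleftrightarrow> distinct (rotn G u)" for u
      using a b vw(3) by auto
    then show ?thesis using ribbon_graphD(1)[OF G] by (simp add: rotation_system_def)
  qed
  have "boundary_components G = faces (verts G) (rotn G)
      (insert ((?h, False), (?h', True)) (insert ((?h, True), (?h', False)) ?\<sigma>))"
    using e by (simp add: boundary_components_split[OF G])
  also have "\<dots> = faces (verts G) (rotn G)
      (insert ((?h, False), (?h', True)) (insert ((?h', False), (?h, True)) ?\<sigma>))"
    by (rule faces_sym_cong) auto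
  also have "\<dots> = faces (verts G) ?r1
      (insert ((?h, False), (?h', True)) (insert ((?h', False), (?h, True)) ?\<sigma>))"
    by (rule faces_rotate[symmetric]) (use a in simp)
  also have "\<dots> = faces (verts G) (?r1(w := (?h' # b2) @ b1))
      (insert ((?h, False), (?h', True)) (insert ((?h', False), (?h, True)) ?\<sigma>))"
    by (rule faces_rotate[symmetric]) (use b vw in simp)
  also have "\<dots> = faces (verts G - {w}) (?r(v := (a2 @ a1) @ (b2 @ b1))) ?\<sigma>"
    unfolding append_Cons
  proof (rule faces_contract[OF rs vw(1-3)])
    show "?\<sigma> \<subseteq> ((halves (verts G) ?r - {?h, ?h'}) \<times> UNIV) \<times> ((halves (verts G) ?r - {?h, ?h'}) \<times> UNIV)"
      unfolding H using sides_subset[of "neg G" "edges G - {e}"] by auto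
  qed (use vw in auto)
  also have "\<dots> = faces (verts G - {w}) (rotn (contract_pos G e)) ?\<sigma>"
    by (rule faces_cong) (use a b in auto)
  finally show ?thesis
    by (simp add: boundary_components_eq[OF ribbon_graph_contract_pos] edges_contract_pos)
qed

text \<open>The positive edge \<open>e\<close> forces equal choices at \<open>v\<close> and
  \<open>w\<close>, so compatible orientations of the graph and of its contraction correspond; the
  value at \<open>w\<close> is recovered from \<open>v\<close>.\<close>

lemma orientable_contract_pos: "orientable (contract_pos G e) \<longleftrightarrow> orientable G"
proof
  assume "orientable (contract_pos G e)"
  then obtain g :: "nat \<Rightarrow> bool" where g: "\<forall>f\<in>edges G - {e}.
      f \<in> neg G \<longleftrightarrow> g (att (contract_pos G e) (f, False)) \<noteq> g (att (contract_pos G e) (f, True))"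
    unfolding orientable_def edges_contract_pos contract_pos_simps by blast
  let ?g = "g(w := g v)"
  have "f \<in> neg G \<longleftrightarrow> ?g (att G (f, False)) \<noteq> ?g (att G (f, True))" if "f \<in> edges G" for f
  proof (cases "f = e")
    case True
    then show ?thesis using e vw by (simp add: v_def[symmetric] w_def[symmetric])
  next
    case False
    then show ?thesis using g[rule_format, of f] that by (simp add: att_contract_pos)
  qed
  then show "orientable G" unfolding orientable_def by blast
next
  assume "orientable G"
  then obtain g :: "nat \<Rightarrow> bool" where g: "\<And>f. f \<in> edges G \<Longrightarrow> f \<in> neg G \<longleftrightarrow> g (att G (f, False)) \<noteq> g (att G (f, True))"
    by (auto simp: orientable_def)
  then have "g v = g w" using e by (simp add: v_def w_def)
  then have "f \<in> neg G \<longleftrightarrow> g (att (contract_pos G e) (f, False)) \<noteq> g (att (contract_pos G e) (f, True))"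
    if "f \<in> edges G - {e}" for f
    using g[of f] that by (simp add: att_contract_pos)
  then show "orientable (contract_pos G e)"
    unfolding orientable_def edges_contract_pos contract_pos_simps by blast
qed

text \<open>Matches the subsets of the contracted graph with the subsets of \<open>edges G\<close>
  that contain \<open>e\<close>, one half of the sum defining the polynomial.\<close>

lemma spanning_contract_pos:
  assumes "A \<subseteq> edges G - {e}"
  shows "spanning (contract_pos G e) A = contract_pos (spanning G (insert e A)) e"
proof -
  let ?P = "\<lambda>h. fst h \<in> insert e A"
  have eq: "filter (\<lambda>h. fst h \<in> A) (open_at (e, b) (rotn G u)) = open_at (e, b) (filter ?P (rotn G u))"
    if "(e, b) \<in> set (rotn G u)" "(e, \<not> b) \<notin> set (rotn G u)" for b u
  proof -
    have "open_at (e, b) (filter ?P (rotn G u)) = filter ?P (open_at (e, b) (rotn G u))"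
      using that by (intro filter_open_at[symmetric] ribbon_graphD(6)[OF G]) auto
    also have "\<dots> = filter (\<lambda>h. fst h \<in> A) (open_at (e, b) (rotn G u))"
    proof (rule filter_cong)
      fix h assume "h \<in> set (open_at (e, b) (rotn G u))"
      then have "h \<noteq> (e, b)" "h \<noteq> (e, \<not> b)"
        using that set_open_at[OF ribbon_graphD(6)[OF G]] by auto
      then have "fst h \<noteq> e" by (cases h) auto
      then show "?P h = (fst h \<in> A)" by simp
    qed simp
    finally show ?thesis ..
  qed
  have oth: "filter (\<lambda>h. fst h \<in> A) (rotn G u) = filter ?P (rotn G u)" if "u \<noteq> v" "u \<noteq> w" for u
  proof (rule filter_cong)
    fix h assume "h \<in> set (rotn G u)"
    then have "att G h = u" using mem_rotn_iff[OF G] by simp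
    then have "fst h \<noteq> e" using that by (cases h; cases "snd h") (auto simp: v_def w_def)
    then show "(fst h \<in> A) = ?P h" by simp
  qed simp
  have att: "att (spanning G (insert e A)) (e, b) = att G (e, b)" for b
    using e by (intro att_spanning[OF G]) (auto simp: half_edge_iff[OF G])
  have "neg G \<inter> A = neg G \<inter> insert e A" using e by auto
  moreover have "(\<lambda>u. filter (\<lambda>h. fst h \<in> A) (rotn (contract_pos G e) u)) =
      (\<lambda>u. filter ?P (rotn G u))(v := open_at (e, False) (filter ?P (rotn G v)) @
         open_at (e, True) (filter ?P (rotn G w)), w := [])"
    using eq[of False v] eq[of True w] vw not_mem oth by auto
  ultimately show ?thesis
    unfolding spanning_def[of "contract_pos G e"] contract_pos_def[of "spanning G _"] Let_def att
    by (simp add: v_def[symmetric] w_def[symmetric])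
      (simp add: spanning_def)
qed

end

section \<open>Invariance of the topological parameters\<close>

lemma same_halves_att:
  assumes "verts H = verts G" "\<And>v. set (rotn H v) = set (rotn G v)"
  shows "half_edges H = half_edges G" "edges H = edges G" "att H h = att G h" "ends H = ends G"
proof -
  show *: "half_edges H = half_edges G" "att H h = att G h" for h
    using assms by (simp_all add: half_edges_def att_def)
  then show "edges H = edges G" by (simp add: edges_def)
  with * show "ends H = ends G" by (simp add: ends_def)
qed

lemma flip_vertex_simps [simp]:
  "verts (flip_vertex v G) = verts G"
  "rotn (flip_vertex v G) = (rotn G)(v := rev (rotn G v))"
  "set (((rotn G)(v := rev (rotn G v))) u) = set (rotn G u)"
  by (simp_all add: flip_vertex_def)

lemma flip_vertex_same [simp]:
  "half_edges (flip_vertex v G) = half_edges G" "edges (flip_vertex v G) = edges G"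
  "att (flip_vertex v G) h = att G h" "ends (flip_vertex v G) = ends G"
  by (rule same_halves_att; simp)+

lemma neg_flip_vertex:
  assumes "ribbon_graph G"
  shows "e \<in> neg (flip_vertex v G) \<longleftrightarrow>
    e \<in> edges G \<and> ((e \<in> neg G) \<noteq> ((att G (e, False) = v) \<noteq> (att G (e, True) = v)))"
  using mem_rotn_iff[OF assms] half_edge_iff[OF assms] by (auto simp: flip_vertex_def)

lemma ribbon_graph_flip_vertex:
  assumes "ribbon_graph G" shows "ribbon_graph (flip_vertex v G)"
proof -
  have "distinct (((rotn G)(v := rev (rotn G v))) u) = distinct (rotn G u)" for u by simp
  then have "rotation_system (verts G) ((rotn G)(v := rev (rotn G v)))"
    using ribbon_graphD(1)[OF assms] flip_vertex_simps(3)[of G v] by (simp add: rotation_system_def del: fun_upd_apply)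
  then show ?thesis
    using ribbon_graphD(3,4)[OF assms] neg_flip_vertex[OF assms, of _ v]
    by (auto simp: ribbon_graph_iff)
qed

lemma flip_vertex_flip_vertex:
  assumes "ribbon_graph G" shows "flip_vertex v (flip_vertex v G) = G"
proof (rule ribbon.equality)
  show "neg (flip_vertex v (flip_vertex v G)) = neg G"
    using neg_flip_vertex[OF ribbon_graph_flip_vertex[OF assms]] neg_flip_vertex[OF assms]
      ribbon_graphD(5)[OF assms] by auto
qed simp_all

lemma components_flip_vertex:
  "ribbon_graph G \<Longrightarrow> components (flip_vertex v G) = components G"
  by (simp add: components_eq_ccount ribbon_graph_flip_vertex)

text \<open>Turning a disk over exchanges the two ends of every half-edge at \<open>v\<close>. Arcs
  at \<open>v\<close> are reversed accordingly, and a ribbon with exactly one half-edge at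
  \<open>v\<close> is corrected by its toggled sign.\<close>

lemma boundary_components_flip_vertex:
  assumes "ribbon_graph G"
  shows "boundary_components (flip_vertex v G) = boundary_components G"
proof -
  define \<phi> :: "half_edge \<times> bool \<Rightarrow> half_edge \<times> bool"
    where "\<phi> = (\<lambda>(h, b). (h, (att G h = v) \<noteq> b))"
  let ?R = "\<lambda>G. arcs (verts G) (rotn G) \<union> sides (neg G) (edges G)"
  \<comment> \<open>Stated for any \<open>H\<close> with the attachments of \<open>G\<close>, so
    that it also applies to the flipped graph and yields the inverse direction.\<close>
  have rel: "(\<phi> p, \<phi> q) \<in> conn (?R (flip_vertex v H))"
    if H: "ribbon_graph H" "\<And>h. att H h = att G h" and pq: "(p, q) \<in> ?R H" for H p q
    using pq
  proof
    assume "(p, q) \<in> arcs (verts H) (rotn H)"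
    then obtain u where u: "u \<in> verts H" "(p, q) \<in> list_arcs (rotn H u)" by (auto simp: arcs_def)
    then have "fst p \<in> set (rotn H u)" "fst q \<in> set (rotn H u)"
      using list_arcs_subset[of "rotn H u"] by auto
    then have att: "att G (fst p) = u" "att G (fst q) = u" using att_eq[OF H(1) u(1)] H(2) by auto
    show ?thesis
    proof (cases "u = v")
      case True
      have "(\<phi> q, \<phi> p) \<in> list_arcs (rev (rotn H u))"
        unfolding list_arcs_rev using u(2) att True
        by (intro image_eqI[of _ _ "(p, q)"]) (auto simp: \<phi>_def split: prod.splits)
      then have "(\<phi> q, \<phi> p) \<in> ?R (flip_vertex v H)"
        using u(1) True by (auto simp: arcs_def)
      then show ?thesis by (rule conn_base')
    next
      case False
      then have "\<phi> p = p" "\<phi> q = q" using att by (auto simp: \<phi>_def split: prod.splits)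
      then have "(\<phi> p, \<phi> q) \<in> ?R (flip_vertex v H)"
        using u False by (auto simp: arcs_def)
      then show ?thesis by (rule conn_base)
    qed
  next
    assume "(p, q) \<in> sides (neg H) (edges H)"
    then obtain e b where e: "e \<in> edges H" "p = ((e, False), b)" "q = ((e, True), if e \<in> neg H then b else \<not> b)"
      by (auto simp: sides_def)
    let ?b = "(att G (e, False) = v) \<noteq> b"
    have "(\<phi> p, \<phi> q) = (((e, False), ?b), ((e, True), if e \<in> neg (flip_vertex v H) then ?b else \<not> ?b))"
      using e neg_flip_vertex[OF H(1), of e v] H(2) by (auto simp: \<phi>_def)
    then have "(\<phi> p, \<phi> q) \<in> ?R (flip_vertex v H)"
      unfolding sides_def using e(1) by auto
    then show ?thesis by (rule conn_base)
  qed
  have inv: "\<phi> (\<phi> p) = p" for p by (cases p) (auto simp: \<phi>_def)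
  have "ccount (half_edges G \<times> UNIV) (?R G) = ccount (half_edges G \<times> UNIV) (?R (flip_vertex v G))"
  proof (rule ccount_map[where \<phi> = \<phi>])
    have mem: "\<phi> p \<in> half_edges G \<times> UNIV" if "p \<in> half_edges G \<times> UNIV" for p
      using that by (auto simp: \<phi>_def)
    show "\<phi> ` (half_edges G \<times> UNIV) = half_edges G \<times> UNIV"
      by (intro equalityI image_subsetI subsetI mem) (assumption, metis inv mem image_eqI)
    show "(\<phi> x, \<phi> y) \<in> conn (?R (flip_vertex v G))" if "(x, y) \<in> ?R G" for x y
      using rel[OF assms _ that] by simp
    show "\<exists>a\<in>half_edges G \<times> UNIV. \<exists>b\<in>half_edges G \<times> UNIV. \<phi> a = x \<and> \<phi> b = y \<and> (a, b) \<in> conn (?R G)"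
      if "(x, y) \<in> ?R (flip_vertex v G)" for x y
    proof (intro bexI conjI)
      show "(\<phi> x, \<phi> y) \<in> conn (?R G)"
        using rel[OF ribbon_graph_flip_vertex[OF assms, of v] _ that] by (simp add: flip_vertex_flip_vertex[OF assms])
      have "x \<in> half_edges G \<times> UNIV" "y \<in> half_edges G \<times> UNIV"
        using that arcs_subset[of "verts (flip_vertex v G)" "rotn (flip_vertex v G)"]
          sides_subset[of "neg (flip_vertex v G)" "edges G"]
        unfolding halves_eq_half_edges flip_vertex_same half_edges_eq[OF assms] by blast+
      then show "\<phi> x \<in> half_edges G \<times> UNIV" "\<phi> y \<in> half_edges G \<times> UNIV" by (auto simp: \<phi>_def)
    qed (rule inv)+
    show "(x, y) \<in> conn (?R G)" if "\<phi> x = \<phi> y" for x y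
    proof -
      have "x = y" using inv[of x] inv[of y] unfolding that by simp
      then show ?thesis by simp
    qed
  qed
  moreover have "{u \<in> verts G. rotn (flip_vertex v G) u = []} = {u \<in> verts G. rotn G u = []}" by auto
  ultimately show ?thesis
    by (simp add: boundary_components_ccount assms ribbon_graph_flip_vertex del: flip_vertex_simps(2))
qed

lemma orientable_flip_vertex:
  assumes "ribbon_graph G"
  shows "orientable (flip_vertex v G) \<longleftrightarrow> orientable G"
proof -
  have imp: "orientable (flip_vertex v H)" if H: "ribbon_graph H" "orientable H" for H
  proof -
    obtain f :: "nat \<Rightarrow> bool" where f: "\<forall>e\<in>edges H. e \<in> neg H \<longleftrightarrow> f (att H (e, False)) \<noteq> f (att H (e, True))"
      using H(2) unfolding orientable_def by blast
    \<comment> \<open>Reversing the choice at \<open>v\<close> absorbs the toggled signs; a loop at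
      \<open>v\<close> sees two reversals.\<close>
    let ?f = "\<lambda>u. (u = v) \<noteq> f u"
    have "\<forall>e\<in>edges H. e \<in> neg (flip_vertex v H) \<longleftrightarrow> ?f (att H (e, False)) \<noteq> ?f (att H (e, True))"
      using f neg_flip_vertex[OF H(1)] by auto
    then show ?thesis unfolding orientable_def flip_vertex_same by (rule exI[of _ ?f])
  qed
  show ?thesis
    using imp[OF assms] imp[OF ribbon_graph_flip_vertex[OF assms]] flip_vertex_flip_vertex[OF assms] by metis
qed

lemma spanning_flip_vertex:
  assumes "ribbon_graph G" "A \<subseteq> edges G"
  shows "spanning (flip_vertex v G) A = flip_vertex v (spanning G A)"
proof (rule ribbon.equality)
  have "att (spanning G A) (e, b) = att G (e, b)" if "e \<in> A" for e b
    using assms that by (intro att_spanning) (auto simp: half_edge_iff)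
  then have "e \<in> neg (spanning (flip_vertex v G) A) \<longleftrightarrow> e \<in> neg (flip_vertex v (spanning G A))" for e
    using assms(2) neg_flip_vertex[OF assms(1), of e v]
      neg_flip_vertex[OF ribbon_graph_spanning[OF assms(1), of A], of e v] by (cases "e \<in> A") auto
  then show "neg (spanning (flip_vertex v G) A) = neg (flip_vertex v (spanning G A))" by blast
  show "rotn (spanning (flip_vertex v G) A) = rotn (flip_vertex v (spanning G A))"
    by (auto simp: rev_filter)
qed simp_all

lemma delete_flip_vertex:
  "ribbon_graph G \<Longrightarrow> delete (flip_vertex v G) e = flip_vertex v (delete G e)"
  by (simp add: delete_def spanning_flip_vertex)

text \<open>Finer than \<open>ribbon_equiv\<close>: labels and signs are kept, so the relation
  passes to the spanning subgraphs on the same edge set.\<close>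

definition cyclic_equal :: "ribbon \<Rightarrow> ribbon \<Rightarrow> bool" where
  "cyclic_equal G H \<longleftrightarrow> verts H = verts G \<and> neg H = neg G \<and>
     (\<forall>v. \<exists>xs ys. rotn G v = xs @ ys \<and> rotn H v = ys @ xs)"

lemma cyclic_equal_sets:
  assumes "cyclic_equal G H"
  shows "verts H = verts G" "neg H = neg G" "set (rotn H v) = set (rotn G v)"
    "distinct (rotn H v) \<longleftrightarrow> distinct (rotn G v)" "list_arcs (rotn H v) = list_arcs (rotn G v)"
    "rotn H v = [] \<longleftrightarrow> rotn G v = []"
proof -
  obtain xs ys where "rotn G v = xs @ ys" "rotn H v = ys @ xs"
    using assms unfolding cyclic_equal_def by blast
  then show "set (rotn H v) = set (rotn G v)"
    "distinct (rotn H v) \<longleftrightarrow> distinct (rotn G v)" "list_arcs (rotn H v) = list_arcs (rotn G v)"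
    "rotn H v = [] \<longleftrightarrow> rotn G v = []"
    by (auto simp: list_arcs_append_commute)
qed (use assms in \<open>simp_all add: cyclic_equal_def\<close>)

lemma cyclic_equal_same:
  assumes "cyclic_equal G H"
  shows "half_edges H = half_edges G" "edges H = edges G" "att H h = att G h" "ends H = ends G"
  by (rule same_halves_att; simp add: cyclic_equal_sets[OF assms])+

lemma ribbon_graph_cyclic_equal:
  assumes "cyclic_equal G H" "ribbon_graph G" shows "ribbon_graph H"
  using assms(2) by (simp add: ribbon_graph_def cyclic_equal_sets[OF assms(1)] cyclic_equal_same[OF assms(1)])

lemma cyclic_equal_spanning:
  assumes "cyclic_equal G H" shows "cyclic_equal (spanning G A) (spanning H A)"
  unfolding cyclic_equal_def
proof (intro conjI allI)
  fix v
  obtain xs ys where "rotn G v = xs @ ys" "rotn H v = ys @ xs"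
    using assms unfolding cyclic_equal_def by blast
  then show "\<exists>xs ys. rotn (spanning G A) v = xs @ ys \<and> rotn (spanning H A) v = ys @ xs" by auto
qed (simp_all add: cyclic_equal_sets[OF assms])

section \<open>The Bollobas--Riordan polynomial\<close>

text \<open>A summand of the polynomial depends on its subgraph only through these data.\<close>

definition params :: "ribbon \<Rightarrow> nat \<times> nat \<times> nat \<times> nat \<times> bool" where
  "params G = (card (verts G), card (edges G), components G, boundary_components G, orientable G)"

lemma params_flip_vertex: "ribbon_graph G \<Longrightarrow> params (flip_vertex v G) = params G"
  by (simp add: params_def components_flip_vertex boundary_components_flip_vertex orientable_flip_vertex)

lemma params_cyclic_equal:
  assumes "cyclic_equal G H" "ribbon_graph G" shows "params H = params G"
  using cyclic_equal_sets[OF assms(1)] cyclic_equal_same[OF assms(1)] assms(2)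
    ribbon_graph_cyclic_equal[OF assms]
  by (simp add: params_def components_eq_ccount boundary_components_eq orientable_def faces_def arcs_def halves_def)

text \<open>The rank \<open>n\<close> of the ambient graph is kept apart from \<open>S\<close>,
  because terms of \<open>delete G e\<close> are also weighed with the rank of \<open>G\<close>,
  which differs when \<open>e\<close> is a bridge.\<close>

definition br_term :: "nat \<Rightarrow> 'r \<Rightarrow> 'r \<Rightarrow> 'r \<Rightarrow> 'r \<Rightarrow> ribbon \<Rightarrow> 'r::comm_ring_1" where
  "br_term n x y z w S = (x - 1) ^ (n - rank S) * y ^ nullity S *
     z ^ (components S + nullity S - boundary_components S) * w ^ nonorientability S"

lemma bollobas_riordan_eq_sum:
  "bollobas_riordan G x y z w = (\<Sum>A\<in>Pow (edges G). br_term (rank G) x y z w (spanning G A))"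
  by (simp add: bollobas_riordan_def br_term_def)

lemma br_term_cong: "params S = params T \<Longrightarrow> br_term n x y z w S = br_term n x y z w T"
  by (simp add: params_def br_term_def rank_def nullity_def nonorientability_def)

lemma bollobas_riordan_cong:
  assumes "ribbon_graph G" "ribbon_graph H" "edges H = edges G"
    and "\<And>A. A \<subseteq> edges G \<Longrightarrow> params (spanning H A) = params (spanning G A)"
  shows "bollobas_riordan H x y z w = bollobas_riordan G x y z w" "components H = components G"
proof -
  have p: "params H = params G"
    using assms(4)[OF subset_refl] spanning_edges assms(1-3) by metis
  then show "components H = components G" by (simp add: params_def)
  from p have "rank H = rank G" by (simp add: params_def rank_def)
  then show "bollobas_riordan H x y z w = bollobas_riordan G x y z w"
    unfolding bollobas_riordan_eq_sum assms(3)
    by (intro sum.cong refl) (simp add: br_term_cong[OF assms(4)])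
qed

lemma bollobas_riordan_flip_vertex:
  assumes "ribbon_graph G"
  shows "bollobas_riordan (flip_vertex v G) x y z w = bollobas_riordan G x y z w"
  using assms by (intro bollobas_riordan_cong)
    (auto simp: ribbon_graph_flip_vertex spanning_flip_vertex params_flip_vertex ribbon_graph_spanning)

lemma bollobas_riordan_cyclic_equal:
  assumes "ribbon_graph G" "cyclic_equal G H"
  shows "bollobas_riordan H x y z w = bollobas_riordan G x y z w" "components H = components G"
  using assms by (intro bollobas_riordan_cong;
    auto simp: ribbon_graph_cyclic_equal cyclic_equal_same intro: params_cyclic_equal cyclic_equal_spanning ribbon_graph_spanning)+

section \<open>Deletion and contraction of the polynomial, term by term\<close>

lemma components_le: "ribbon_graph G \<Longrightarrow> components G \<le> card (verts G)"
  by (simp add: components_eq_ccount ccount_le_card ribbon_graphD(2))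

lemma components_antimono:
  assumes "ribbon_graph G" "A \<subseteq> B" "B \<subseteq> edges G"
  shows "components (spanning G B) \<le> components (spanning G A)"
proof -
  have "ends (spanning G A) \<subseteq> ends (spanning G B)"
    using assms by (auto simp: ends_spanning)
  then show ?thesis
    using assms(1) by (auto simp: components_eq_ccount ribbon_graph_spanning ribbon_graphD(2) intro!: ccount_antimono conn_base)
qed

lemma sum_Pow_insert:
  fixes f :: "'a set \<Rightarrow> 'b::comm_monoid_add"
  assumes "finite E" "e \<notin> E"
  shows "(\<Sum>A\<in>Pow (insert e E). f A) = (\<Sum>A\<in>Pow E. f A) + (\<Sum>A\<in>Pow E. f (insert e A))"
proof -
  have "inj_on (insert e) (Pow E)" using assms(2) by (auto simp: inj_on_def)
  moreover have "Pow E \<inter> insert e ` Pow E = {}" using assms(2) by auto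
  ultimately show ?thesis
    using assms(1) by (simp add: Pow_insert sum.union_disjoint sum.reindex)
qed

text \<open>Contraction removes one vertex and one edge and keeps components, boundary and
  orientability. Both ranks drop by one and the nullity stays, so no exponent changes.\<close>

lemma br_term_contract_pos:
  assumes G: "ribbon_graph G" and e: "e \<in> edges G" "e \<notin> neg G" "\<not> is_loop G e" and A: "A \<subseteq> edges G - {e}"
  shows "br_term (rank (contract_pos G e)) x y z w (spanning (contract_pos G e) A) =
    br_term (rank G) x y z w (spanning G (insert e A))"
proof -
  let ?S = "spanning G (insert e A)"
  have S: "ribbon_graph ?S" using G by (rule ribbon_graph_spanning)
  have att: "att ?S (e, b) = att G (e, b)" for b
    using e G by (intro att_spanning) (auto simp: half_edge_iff)
  interpret g: positive_link G e "att G (e, False)" "att G (e, True)"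
    by unfold_locales (use G e in simp_all)
  interpret s: positive_link ?S e "att ?S (e, False)" "att ?S (e, True)"
    by unfold_locales (use S e att in \<open>simp_all add: is_loop_def\<close>)
  have span: "spanning (contract_pos G e) A = contract_pos ?S e" by (rule g.spanning_contract_pos[OF A])
  have verts: "card (verts (contract_pos G e)) = card (verts G) - 1"
    "card (verts (contract_pos ?S e)) = card (verts G) - 1"
    using g.vw s.vw by (simp_all add: ribbon_graphD(2)[OF G])
  \<comment> \<open>The contraction has as many components on one vertex fewer; hence both ranks are
    positive and the subtractions of one are exact.\<close>
  have le: "components G \<le> card (verts G) - 1" "components ?S \<le> card (verts G) - 1"
    using components_le[OF g.ribbon_graph_contract_pos] components_le[OF s.ribbon_graph_contract_pos]
    unfolding verts g.components_contract_pos s.components_contract_pos by simp_all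
  have pos: "0 < card (verts G)" using g.vw ribbon_graphD(2)[OF G] by (metis card_gt_0_iff empty_iff)
  have fin: "finite (insert e A)" using finite_subset[OF A] finite_edges[OF G] by simp
  have "edges ?S = insert e A" using A e by auto
  then have "card (edges ?S) = Suc (card A)" "card (edges (contract_pos ?S e)) = card A"
    using fin A by (auto simp: s.edges_contract_pos insert_Diff_if Diff_insert_absorb subset_Diff_insert)
  moreover have rank: "rank (contract_pos G e) = card (verts G) - 1 - components G"
    "rank (contract_pos ?S e) = card (verts G) - 1 - components ?S"
    "rank ?S = card (verts G) - components ?S"
    by (simp_all only: rank_def verts g.components_contract_pos s.components_contract_pos spanning_simps)
  ultimately have "nullity (contract_pos ?S e) = nullity ?S"
    using le pos unfolding nullity_def by simp
  moreover have "rank (contract_pos G e) - rank (contract_pos ?S e) = rank G - rank ?S"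
    using le pos unfolding rank by (simp add: rank_def)
  ultimately show ?thesis
    unfolding span by (simp add: br_term_def nonorientability_def s.components_contract_pos
        s.boundary_components_contract_pos s.orientable_contract_pos)
qed

text \<open>The second sum uses the rank of \<open>G\<close>: it is the polynomial of the deletion
  for an ordinary \<open>e\<close>, and x - 1 times it for a bridge.\<close>

lemma bollobas_riordan_split:
  assumes "ribbon_graph G" "e \<in> edges G"
  shows "bollobas_riordan G x y z w =
    (\<Sum>A\<in>Pow (edges G - {e}). br_term (rank G) x y z w (spanning G (insert e A))) +
    (\<Sum>A\<in>Pow (edges G - {e}). br_term (rank G) x y z w (spanning (delete G e) A))"
proof -
  have "(\<Sum>A\<in>Pow (edges G). br_term (rank G) x y z w (spanning G A)) =
    (\<Sum>A\<in>Pow (edges G - {e}). br_term (rank G) x y z w (spanning G A)) +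
    (\<Sum>A\<in>Pow (edges G - {e}). br_term (rank G) x y z w (spanning G (insert e A)))"
    using sum_Pow_insert[of "edges G - {e}" e] assms finite_edges[OF assms(1)] by (simp add: insert_absorb)
  then show ?thesis
    by (simp add: bollobas_riordan_eq_sum spanning_delete add.commute cong: sum.cong_simp)
qed

lemma bollobas_riordan_contract_pos_sum:
  assumes "ribbon_graph G" "e \<in> edges G" "e \<notin> neg G" "\<not> is_loop G e"
  shows "bollobas_riordan (contract_pos G e) x y z w =
    (\<Sum>A\<in>Pow (edges G - {e}). br_term (rank G) x y z w (spanning G (insert e A)))"
proof -
  interpret positive_link G e "att G (e, False)" "att G (e, True)"
    by unfold_locales (use assms in simp_all)
  show ?thesis
    unfolding bollobas_riordan_eq_sum edges_contract_pos
    by (intro sum.cong refl br_term_contract_pos assms) auto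
qed

lemma components_delete_ordinary:
  assumes G: "ribbon_graph G" and e: "e \<in> edges G" "\<not> is_bridge G e"
  shows "components (delete G e) = components G"
  using components_antimono[OF G Diff_subset subset_refl, of "{e}"] e
  by (simp add: spanning_edges[OF G] is_bridge_def delete_def)

lemma bridge_not_conn:
  assumes G: "ribbon_graph G" and br: "is_bridge G e"
  shows "(att G (e, False), att G (e, True)) \<notin> conn (ends (delete G e))"
proof
  assume c: "(att G (e, False), att G (e, True)) \<in> conn (ends (delete G e))"
  have "ends G = insert (att G (e, False), att G (e, True)) (ends (delete G e))"
    using br unfolding delete_def ends_spanning[OF G Diff_subset] by (auto simp: ends_def is_bridge_def)
  then have "components G = components (delete G e)"
    using G conn_insert_absorb[OF c] by (simp add: components_eq_ccount ribbon_graph_delete ccount_def)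
  with br show False by (simp add: is_bridge_def)
qed

lemma bridge_not_loop: "ribbon_graph G \<Longrightarrow> is_bridge G e \<Longrightarrow> \<not> is_loop G e"
  using bridge_not_conn[of G e] by (auto simp: is_loop_def)

lemma att_delete:
  "ribbon_graph G \<Longrightarrow> f \<in> edges G \<Longrightarrow> f \<noteq> e \<Longrightarrow> att (delete G e) (f, b) = att G (f, b)"
  unfolding delete_def by (rule att_spanning) (simp_all add: half_edge_iff)

text \<open>Phrased by disconnected endpoints and not by \<open>is_bridge\<close>, which is the form
  that passes to spanning subgraphs.\<close>

lemma params_delete_bridge:
  assumes G: "ribbon_graph G" and e: "e \<in> edges G"
    and br: "(att G (e, False), att G (e, True)) \<notin> conn (ends (delete G e))"
  shows "components (delete G e) = Suc (components G)"
    "boundary_components (delete G e) = Suc (boundary_components G)"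
    "orientable (delete G e) \<longleftrightarrow> orientable G"
proof -
  have "ends G = insert (att G (e, False), att G (e, True)) (ends (delete G e))"
    using e unfolding delete_def ends_spanning[OF G Diff_subset] by (auto simp: ends_def)
  then show "components (delete G e) = Suc (components G)"
    using G ccount_insert[OF ribbon_graphD(2)[OF G] att_mem_edge(1)[OF G e] att_mem_edge(1)[OF G e] br]
    by (simp add: components_eq_ccount ribbon_graph_delete)
  show "boundary_components (delete G e) = Suc (boundary_components G)"
    by (rule boundary_components_delete_bridge[OF G e br])
  have neg: "f \<in> neg (delete G e) \<longleftrightarrow> f \<in> neg G" if "f \<in> edges G - {e}" for f
    using that by (auto simp: delete_def)
  show "orientable (delete G e) \<longleftrightarrow> orientable G"
  proof
    assume "orientable G"
    then obtain f :: "nat \<Rightarrow> bool" where "\<forall>d\<in>edges G. d \<in> neg G \<longleftrightarrow> f (att G (d, False)) \<noteq> f (att G (d, True))"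
      unfolding orientable_def by blast
    then have "\<forall>d\<in>edges G - {e}. d \<in> neg (delete G e) \<longleftrightarrow>
        f (att (delete G e) (d, False)) \<noteq> f (att (delete G e) (d, True))"
      using neg by (auto simp: att_delete[OF G])
    then show "orientable (delete G e)" unfolding orientable_def edges_delete by (intro exI[where x = f])
  next
    assume "orientable (delete G e)"
    then obtain f :: "nat \<Rightarrow> bool" where f: "\<forall>d\<in>edges G - {e}. d \<in> neg (delete G e) \<longleftrightarrow>
        f (att (delete G e) (d, False)) \<noteq> f (att (delete G e) (d, True))"
      unfolding orientable_def edges_delete by blast
    let ?v = "att G (e, False)" and ?w = "att G (e, True)"
    \<comment> \<open>If \<open>f\<close> disagrees with the sign of \<open>e\<close>, all choices
      in the component of one endpoint are reversed. No other edge leaves that component.\<close>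
    define g where "g = (\<lambda>u. f u \<noteq> ((?v, u) \<in> conn (ends (delete G e)) \<and> (e \<in> neg G) \<noteq> (f ?v \<noteq> f ?w)))"
    have "d \<in> neg G \<longleftrightarrow> g (att G (d, False)) \<noteq> g (att G (d, True))" if d: "d \<in> edges G" for d
    proof (cases "d = e")
      case True
      then show ?thesis using br by (auto simp: g_def)
    next
      case False
      then have "(att G (d, False), att G (d, True)) \<in> ends (delete G e)"
        using endsI[of d "delete G e"] d by (simp add: att_delete[OF G])
      then have "(?v, att G (d, False)) \<in> conn (ends (delete G e)) \<longleftrightarrow> (?v, att G (d, True)) \<in> conn (ends (delete G e))"
        using conn_base conn_base' conn_trans by metis
      then show ?thesis using f neg[of d] d False by (auto simp: g_def att_delete[OF G])
    qed
    then show "orientable G" unfolding orientable_def by blast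
  qed
qed

text \<open>Removing the bridge adds one component and one boundary component, so nullity and the
  exponent of z are unchanged while the rank drops by one. The ambient rank drops too in the first
  claim; in the second it does not, which leaves a factor x - 1.\<close>

lemma br_term_bridge:
  assumes G: "ribbon_graph G" and br: "is_bridge G e" and A: "A \<subseteq> edges G - {e}"
  shows "br_term (rank (delete G e)) x y z w (spanning (delete G e) A) = br_term (rank G) x y z w (spanning G (insert e A))"
    and "br_term (rank G) x y z w (spanning (delete G e) A) = (x - 1) * br_term (rank G) x y z w (spanning G (insert e A))"
proof -
  let ?S = "spanning G (insert e A)"
  have e: "e \<in> edges G" using br by (simp add: is_bridge_def)
  have S: "ribbon_graph ?S" using G by (rule ribbon_graph_spanning)
  have edgesS: "edges ?S = insert e A" using A e by auto
  have T: "spanning (delete G e) A = delete ?S e"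
    unfolding spanning_delete[OF A] delete_def edgesS spanning_spanning
    using A by (intro arg_cong[where f = "spanning G"]) auto
  have att: "att ?S (e, b) = att G (e, b)" for b
    using e G by (intro att_spanning) (auto simp: half_edge_iff)
  \<comment> \<open>A bridge of \<open>G\<close> still separates its endpoints in every subgraph,
    which has fewer connections.\<close>
  have "ends (delete ?S e) \<subseteq> ends (delete G e)"
    unfolding T[symmetric] spanning_delete[OF A]
    using A unfolding delete_def by (subst ends_spanning[OF G], auto)+
  then have "(att ?S (e, False), att ?S (e, True)) \<notin> conn (ends (delete ?S e))"
    unfolding att using bridge_not_conn[OF G br] conn_base
    by (metis (no_types, lifting) conn_mono subset_iff surj_pair)
  from params_delete_bridge[OF S _ this] have
    S': "components (delete ?S e) = Suc (components ?S)"
      "boundary_components (delete ?S e) = Suc (boundary_components ?S)"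
      "orientable (delete ?S e) \<longleftrightarrow> orientable ?S" using e by auto
  have G': "components (delete G e) = Suc (components G)"
    by (rule params_delete_bridge(1)[OF G e bridge_not_conn[OF G br]])
  have le: "components G \<le> components ?S" "Suc (components ?S) \<le> card (verts G)"
    using components_antimono[OF G, of "insert e A" "edges G"] components_le[OF ribbon_graph_delete[OF S, of e]]
      A e S' by (auto simp: spanning_edges[OF G])
  have "finite A" using A finite_edges[OF G] by (meson finite_Diff finite_subset)
  then have card: "card (edges ?S) = Suc (card A)" "card (edges (delete ?S e)) = card A"
    unfolding edges_delete edgesS using A by (auto simp: subset_Diff_insert)
  then have null: "nullity (delete ?S e) = nullity ?S"
    using le by (simp add: nullity_def rank_def S')
  have "rank (delete G e) - rank (delete ?S e) = rank G - rank ?S"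
    using le by (simp add: rank_def S' G')
  then show "br_term (rank (delete G e)) x y z w (spanning (delete G e) A) = br_term (rank G) x y z w ?S"
    unfolding T by (simp add: br_term_def nonorientability_def S' null)
  have "rank G - rank (delete ?S e) = Suc (rank G - rank ?S)"
    using le by (simp add: rank_def S')
  then show "br_term (rank G) x y z w (spanning (delete G e) A) = (x - 1) * br_term (rank G) x y z w ?S"
    unfolding T by (simp add: br_term_def nonorientability_def S' null algebra_simps)
qed

lemma is_loop_flip_vertex [simp]: "is_loop (flip_vertex v G) e \<longleftrightarrow> is_loop G e"
  by (simp add: is_loop_def)

lemma is_bridge_flip_vertex:
  "ribbon_graph G \<Longrightarrow> is_bridge (flip_vertex v G) e \<longleftrightarrow> is_bridge G e"
  by (simp add: is_bridge_def delete_flip_vertex components_flip_vertex ribbon_graph_delete)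

text \<open>Flipping an endpoint of a negative edge reduces its contraction to the positive case.\<close>

lemma contract_cases:
  assumes G: "ribbon_graph G" and e: "e \<in> edges G" "\<not> is_loop G e"
  obtains H where "ribbon_graph H" "e \<in> edges H" "e \<notin> neg H" "\<not> is_loop H e" "edges H = edges G"
    "verts H = verts G" "contract G e = contract_pos H e" "is_bridge H e \<longleftrightarrow> is_bridge G e"
    "components H = components G" "components (delete H e) = components (delete G e)"
    "\<And>x y z w. bollobas_riordan H x y z w = (bollobas_riordan G x y z w :: 'r::comm_ring_1)"
    "\<And>x y z w. bollobas_riordan (delete H e) x y z w = (bollobas_riordan (delete G e) x y z w :: 'r)"
proof (cases "e \<in> neg G")
  case False
  then show ?thesis using that[of G] assms by (simp add: contract_def)
next
  case True
  let ?H = "flip_vertex (att G (e, True)) G"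
  have "e \<notin> neg ?H" using True e by (simp add: neg_flip_vertex[OF G] is_loop_def)
  then show ?thesis
    using that[of ?H] assms True
    by (simp add: contract_def ribbon_graph_flip_vertex is_bridge_flip_vertex components_flip_vertex
        delete_flip_vertex ribbon_graph_delete bollobas_riordan_flip_vertex)
qed

lemma contract_facts:
  assumes "ribbon_graph G" "e \<in> edges G" "\<not> is_loop G e"
  shows "ribbon_graph (contract G e)" "edges (contract G e) = edges G - {e}"
    "components (contract G e) = components G"
    "card (verts (contract G e)) = card (verts G) - 1"
proof -
  obtain H where H: "ribbon_graph H" "e \<in> edges H" "e \<notin> neg H" "\<not> is_loop H e" "edges H = edges G"
    "verts H = verts G" "contract G e = contract_pos H e" "components H = components G"
    using contract_cases[OF assms] by metis
  interpret positive_link H e "att H (e, False)" "att H (e, True)"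
    by unfold_locales (use H in simp_all)
  show "ribbon_graph (contract G e)" "edges (contract G e) = edges G - {e}"
    "components (contract G e) = components G"
    unfolding H(7) H(5)[symmetric] H(8)[symmetric]
    by (rule ribbon_graph_contract_pos edges_contract_pos components_contract_pos)+
  show "card (verts (contract G e)) = card (verts G) - 1"
    unfolding H(7) using vw H(6) by (simp add: ribbon_graphD(2)[OF assms(1)])
qed

lemma bollobas_riordan_ordinary:
  assumes G: "ribbon_graph G" and e: "is_ordinary G e"
  shows "bollobas_riordan G x y z w = bollobas_riordan (contract G e) x y z w + bollobas_riordan (delete G e) x y z w"
proof -
  have e': "e \<in> edges G" "\<not> is_loop G e" "\<not> is_bridge G e" using e by (simp_all add: is_ordinary_def)
  obtain H where H: "ribbon_graph H" "e \<in> edges H" "e \<notin> neg H" "\<not> is_loop H e" "contract G e = contract_pos H e"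
      "is_bridge H e \<longleftrightarrow> is_bridge G e" "bollobas_riordan H x y z w = bollobas_riordan G x y z w"
      "bollobas_riordan (delete H e) x y z w = bollobas_riordan (delete G e) x y z w"
    using contract_cases[OF G e'(1,2)] by metis
  have "rank (delete H e) = rank H"
    using components_delete_ordinary[OF H(1,2)] H(6) e' by (simp add: rank_def)
  then have "bollobas_riordan (delete H e) x y z w =
      (\<Sum>A\<in>Pow (edges H - {e}). br_term (rank H) x y z w (spanning (delete H e) A))"
    by (simp add: bollobas_riordan_eq_sum)
  with bollobas_riordan_split[OF H(1,2), of x y z w] bollobas_riordan_contract_pos_sum[OF H(1-4), of x y z w]
  show ?thesis by (simp add: H(5,7,8)[symmetric])
qed

text \<open>The subsets containing \<open>e\<close> contribute the contraction once, the others x -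
  1 times; together this is the factor \<open>x\<close>.\<close>

lemma bollobas_riordan_bridge:
  assumes G: "ribbon_graph G" and br: "is_bridge G e"
  shows "bollobas_riordan (delete G e) x y z w = bollobas_riordan (contract G e) x y z w"
    and "bollobas_riordan G x y z w = x * bollobas_riordan (contract G e) x y z w"
proof -
  have e: "e \<in> edges G" "\<not> is_loop G e" using br bridge_not_loop[OF G] by (simp_all add: is_bridge_def)
  obtain H where H: "ribbon_graph H" "e \<in> edges H" "e \<notin> neg H" "\<not> is_loop H e" "contract G e = contract_pos H e"
      "is_bridge H e \<longleftrightarrow> is_bridge G e" "bollobas_riordan H x y z w = bollobas_riordan G x y z w"
      "bollobas_riordan (delete H e) x y z w = bollobas_riordan (delete G e) x y z w"
    using contract_cases[OF G e] by metis
  note terms = br_term_bridge[OF H(1) H(6)[THEN iffD2, OF br], where x = x and y = y and z = z and w = w]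
  note sums = bollobas_riordan_contract_pos_sum[OF H(1-4), of x y z w]
  have "bollobas_riordan (delete H e) x y z w = bollobas_riordan (contract_pos H e) x y z w"
    unfolding sums bollobas_riordan_eq_sum[of "delete H e"] edges_delete by (intro sum.cong refl terms) auto
  then show "bollobas_riordan (delete G e) x y z w = bollobas_riordan (contract G e) x y z w"
    by (simp add: H)
  have "(\<Sum>A\<in>Pow (edges H - {e}). br_term (rank H) x y z w (spanning (delete H e) A)) =
      (x - 1) * bollobas_riordan (contract_pos H e) x y z w"
    unfolding sums sum_distrib_left by (intro sum.cong refl terms) auto
  with bollobas_riordan_split[OF H(1,2), of x y z w] sums
  have "bollobas_riordan H x y z w = x * bollobas_riordan (contract_pos H e) x y z w"
    by (simp add: algebra_simps)
  then show "bollobas_riordan G x y z w = x * bollobas_riordan (contract G e) x y z w"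
    by (simp add: H(5,7))
qed

section \<open>Disjoint unions\<close>

locale disjoint_pair =
  fixes G H
  assumes G: "ribbon_graph G" and H: "ribbon_graph H"
    and disj: "verts G \<inter> verts H = {}" "edges G \<inter> edges H = {}"
begin

lemma dunion_simps [simp]:
  "verts (dunion G H) = verts G \<union> verts H" "neg (dunion G H) = neg G \<union> neg H"
  "v \<in> verts G \<Longrightarrow> rotn (dunion G H) v = rotn G v" "v \<in> verts H \<Longrightarrow> rotn (dunion G H) v = rotn H v"
  using disj by (auto simp: dunion_def)

lemma half_edges_dunion: "half_edges (dunion G H) = half_edges G \<union> half_edges H"
  by (auto simp: half_edges_def)

lemma edges_dunion [simp]: "edges (dunion G H) = edges G \<union> edges H"
  by (simp add: edges_def half_edges_dunion image_Un)

lemma half_edges_disjoint: "half_edges G \<inter> half_edges H = {}"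
  using disj(2) by (auto simp: edges_def)

lemma ribbon_graph_dunion: "ribbon_graph (dunion G H)"
proof -
  have "rotation_system (verts (dunion G H)) (rotn (dunion G H))"
  proof (rule rotation_systemI)
    fix v assume "v \<in> verts (dunion G H)"
    then show "distinct (rotn (dunion G H) v)"
      using ribbon_graphD(6)[OF G] ribbon_graphD(6)[OF H] by auto
  next
    fix v w h
    assume *: "v \<in> verts (dunion G H)" "w \<in> verts (dunion G H)"
      "h \<in> set (rotn (dunion G H) v)" "h \<in> set (rotn (dunion G H) w)"
    have mem: "(h \<in> half_edges G \<and> att G h = t) \<or> (h \<in> half_edges H \<and> att H h = t)"
      if "t \<in> verts (dunion G H)" "h \<in> set (rotn (dunion G H) t)" for t
      using that by (auto simp: mem_rotn_iff[OF G] mem_rotn_iff[OF H])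
    from mem[OF *(1,3)] mem[OF *(2,4)] show "v = w" using half_edges_disjoint by blast
  qed (use ribbon_graphD(2)[OF G] ribbon_graphD(2)[OF H] in simp)
  moreover have "\<forall>v. v \<notin> verts (dunion G H) \<longrightarrow> rotn (dunion G H) v = []"
    using ribbon_graphD(3)[OF H] by (auto simp: dunion_def)
  moreover have "neg (dunion G H) \<subseteq> edges (dunion G H)"
    using ribbon_graphD(5)[OF G] ribbon_graphD(5)[OF H] by auto
  ultimately show ?thesis
    using ribbon_graphD(4)[OF G] ribbon_graphD(4)[OF H] by (auto simp: ribbon_graph_iff half_edges_dunion)
qed

lemma att_dunion:
  "e \<in> edges G \<Longrightarrow> att (dunion G H) (e, b) = att G (e, b)"
  "e \<in> edges H \<Longrightarrow> att (dunion G H) (e, b) = att H (e, b)"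
  using att_mem_edge[OF G] att_mem_edge[OF H] by (auto intro!: att_eq[OF ribbon_graph_dunion])

lemma ends_dunion: "ends (dunion G H) = ends G \<union> ends H"
proof -
  have "ends (dunion G H) = {(att (dunion G H) (e, False), att (dunion G H) (e, True)) | e. e \<in> edges G} \<union>
      {(att (dunion G H) (e, False), att (dunion G H) (e, True)) | e. e \<in> edges H}"
    unfolding ends_def by auto
  also have "\<dots> = ends G \<union> ends H"
    unfolding ends_def by (intro arg_cong2[where f = "(\<union>)"] Collect_cong ex_cong1) (auto simp: att_dunion)
  finally show ?thesis .
qed

lemma components_dunion: "components (dunion G H) = components G + components H"
  using ccount_Un[OF ribbon_graphD(2)[OF G] ribbon_graphD(2)[OF H] disj(1) ends_subset[OF G] ends_subset[OF H]]
  by (simp add: components_eq_ccount G H ribbon_graph_dunion ends_dunion)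

lemma neg_dunion_iff: "e \<in> edges G \<Longrightarrow> e \<in> neg H \<longleftrightarrow> False" "e \<in> edges H \<Longrightarrow> e \<in> neg G \<longleftrightarrow> False"
  using ribbon_graphD(5)[OF G] ribbon_graphD(5)[OF H] disj(2) by auto

lemma boundary_components_dunion:
  "boundary_components (dunion G H) = boundary_components G + boundary_components H"
proof -
  let ?R = "\<lambda>G. arcs (verts G) (rotn G) \<union> sides (neg G) (edges G)"
  have sub: "?R K \<subseteq> (half_edges K \<times> UNIV) \<times> (half_edges K \<times> UNIV)" if "ribbon_graph K" for K
    using arcs_subset[of "verts K" "rotn K"] sides_subset[of "neg K" "edges K"]
    unfolding halves_eq_half_edges half_edges_eq[OF that] by blast
  have "sides N (A \<union> B) = sides N A \<union> sides N B" for N A B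
    unfolding sides_def by auto
  moreover have "sides (neg G \<union> neg H) (edges G) = sides (neg G) (edges G)"
    "sides (neg G \<union> neg H) (edges H) = sides (neg H) (edges H)"
    by (rule sides_mono_neg; use neg_dunion_iff in auto)+
  moreover have "arcs (verts G \<union> verts H) (rotn (dunion G H)) = arcs (verts G) (rotn G) \<union> arcs (verts H) (rotn H)"
    by (auto simp: arcs_def)
  ultimately have "?R (dunion G H) = ?R G \<union> ?R H" by auto
  moreover have "half_edges (dunion G H) \<times> (UNIV :: bool set) = half_edges G \<times> UNIV \<union> half_edges H \<times> UNIV"
    by (auto simp: half_edges_dunion)
  moreover have "{v \<in> verts (dunion G H). rotn (dunion G H) v = []} =
      {v \<in> verts G. rotn G v = []} \<union> {v \<in> verts H. rotn H v = []}" by auto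
  moreover have "card ({v \<in> verts G. rotn G v = []} \<union> {v \<in> verts H. rotn H v = []}) =
      card {v \<in> verts G. rotn G v = []} + card {v \<in> verts H. rotn H v = []}"
    using disj(1) ribbon_graphD(2)[OF G] ribbon_graphD(2)[OF H] by (intro card_Un_disjoint) auto
  moreover have "ccount (half_edges G \<times> UNIV \<union> half_edges H \<times> UNIV) (?R G \<union> ?R H) =
      ccount (half_edges G \<times> UNIV) (?R G) + ccount (half_edges H \<times> UNIV) (?R H)"
    using half_edges_disjoint finite_half_edges[OF G] finite_half_edges[OF H]
    by (intro ccount_Un sub G H) auto
  ultimately show ?thesis
    by (simp add: boundary_components_ccount G H ribbon_graph_dunion del: dunion_simps)
qed

lemma orientable_dunion: "orientable (dunion G H) \<longleftrightarrow> orientable G \<and> orientable H"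
proof
  assume "orientable (dunion G H)"
  then obtain f :: "nat \<Rightarrow> bool" where f: "\<forall>e\<in>edges (dunion G H). e \<in> neg (dunion G H) \<longleftrightarrow>
      f (att (dunion G H) (e, False)) \<noteq> f (att (dunion G H) (e, True))"
    unfolding orientable_def by blast
  have "e \<in> neg G \<longleftrightarrow> f (att G (e, False)) \<noteq> f (att G (e, True))" if "e \<in> edges G" for e
    using bspec[OF f, of e] that by (simp add: att_dunion neg_dunion_iff)
  moreover have "e \<in> neg H \<longleftrightarrow> f (att H (e, False)) \<noteq> f (att H (e, True))" if "e \<in> edges H" for e
    using bspec[OF f, of e] that by (simp add: att_dunion neg_dunion_iff)
  ultimately show "orientable G \<and> orientable H" unfolding orientable_def by blast
next
  assume "orientable G \<and> orientable H"
  then obtain f g :: "nat \<Rightarrow> bool" where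
    f: "\<forall>e\<in>edges G. e \<in> neg G \<longleftrightarrow> f (att G (e, False)) \<noteq> f (att G (e, True))" and
    g: "\<forall>e\<in>edges H. e \<in> neg H \<longleftrightarrow> g (att H (e, False)) \<noteq> g (att H (e, True))"
    unfolding orientable_def by blast
  let ?f = "\<lambda>v. if v \<in> verts G then f v else g v"
  have "\<forall>e\<in>edges (dunion G H). e \<in> neg (dunion G H) \<longleftrightarrow>
      ?f (att (dunion G H) (e, False)) \<noteq> ?f (att (dunion G H) (e, True))"
  proof
    fix e assume "e \<in> edges (dunion G H)"
    then consider "e \<in> edges G" | "e \<in> edges H" by auto
    then show "e \<in> neg (dunion G H) \<longleftrightarrow>
        ?f (att (dunion G H) (e, False)) \<noteq> ?f (att (dunion G H) (e, True))"
    proof cases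
      case 1
      then show ?thesis using f att_mem_edge(1)[OF G 1] by (simp add: att_dunion neg_dunion_iff)
    next
      case 2
      then have "att H (e, b) \<notin> verts G" for b using att_mem_edge(1)[OF H 2] disj(1) by blast
      then show ?thesis using g 2 by (simp add: att_dunion neg_dunion_iff)
    qed
  qed
  then show "orientable (dunion G H)" unfolding orientable_def by (intro exI[where x = ?f])
qed

lemma spanning_dunion:
  assumes "A \<subseteq> edges G" "B \<subseteq> edges H"
  shows "spanning (dunion G H) (A \<union> B) = dunion (spanning G A) (spanning H B)"
proof -
  have G': "fst h \<in> A \<union> B \<longleftrightarrow> fst h \<in> A" if "h \<in> set (rotn G v)" for h v
    using that assms disj(2) mem_rotn_iff[OF G] half_edge_iff[OF G] by blast
  have H': "fst h \<in> A \<union> B \<longleftrightarrow> fst h \<in> B" if "h \<in> set (rotn H v)" for h v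
    using that assms disj(2) mem_rotn_iff[OF H] half_edge_iff[OF H] by blast
  have "filter (\<lambda>h. fst h \<in> A \<union> B) (rotn G v) = filter (\<lambda>h. fst h \<in> A) (rotn G v)"
    "filter (\<lambda>h. fst h \<in> A \<union> B) (rotn H v) = filter (\<lambda>h. fst h \<in> B) (rotn H v)" for v
    by (rule filter_cong[OF refl G'] filter_cong[OF refl H']; assumption)+
  then have "filter (\<lambda>h. fst h \<in> A \<union> B) (rotn (dunion G H) v) =
      (if v \<in> verts G then filter (\<lambda>h. fst h \<in> A) (rotn G v) else filter (\<lambda>h. fst h \<in> B) (rotn H v))" for v
    by (simp add: dunion_def)
  moreover have "(neg G \<union> neg H) \<inter> (A \<union> B) = neg G \<inter> A \<union> neg H \<inter> B"
    using assms neg_dunion_iff by blast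
  ultimately show ?thesis
    unfolding spanning_def[of "dunion G H"] by (simp add: dunion_def[of "spanning G A"] cong: if_cong)
qed

lemma disjoint_pair_spanning: "disjoint_pair (spanning G A) (spanning H B)"
  using disj by unfold_locales (auto intro: ribbon_graph_spanning G H)

end

definition all_loops :: "ribbon \<Rightarrow> bool" where
  "all_loops G \<longleftrightarrow> ribbon_graph G \<and> (\<forall>e\<in>edges G. is_loop G e)"

lemma all_loops_spanning: "all_loops G \<Longrightarrow> all_loops (spanning G A)"
  by (auto simp: all_loops_def ribbon_graph_spanning is_loop_def att_spanning half_edge_iff)

text \<open>Loops connect nothing, so the rank vanishes and with it the dependence on x. The last
  bound makes the exponent of z an exact difference.\<close>

lemma all_loops_params:
  assumes "all_loops G"
  shows "components G = card (verts G)" "rank G = 0" "nullity G = card (edges G)"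
    "boundary_components G \<le> components G + nullity G"
proof -
  have "ends G \<subseteq> conn {}" using assms by (auto simp: ends_def all_loops_def is_loop_def)
  then have "conn (ends G) = conn {}" by (intro conn_eqI) auto
  then show "components G = card (verts G)"
    using assms ccount_empty_rel[of "verts G"] by (simp add: components_eq_ccount all_loops_def ccount_def)
  then show "rank G = 0" "nullity G = card (edges G)"
    "boundary_components G \<le> components G + nullity G"
    using assms boundary_components_le[of G] by (simp_all add: rank_def nullity_def all_loops_def)
qed

text \<open>For graphs of loops the exponents of y and z are additive. The union is nonorientable as
  soon as one part is, and idempotence of \<open>w\<close> makes that factor multiplicative as
  well.\<close>

lemma bollobas_riordan_dunion:
  assumes "disjoint_pair G H" "all_loops G" "all_loops H" "w\<^sup>2 = (w :: 'r::comm_ring_1)"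
  shows "bollobas_riordan (dunion G H) x y z w = bollobas_riordan G x y z w * bollobas_riordan H x y z w"
proof -
  interpret disjoint_pair G H by fact
  have D: "all_loops (dunion G H)"
    using assms(2,3) by (auto simp: all_loops_def ribbon_graph_dunion is_loop_def att_dunion)
  have product: "br_term 0 x y z w (spanning (dunion G H) (A \<union> B)) =
      br_term 0 x y z w (spanning G A) * br_term 0 x y z w (spanning H B)"
    if A: "A \<subseteq> edges G" and B: "B \<subseteq> edges H" for A B
  proof -
    interpret s: disjoint_pair "spanning G A" "spanning H B" by (rule disjoint_pair_spanning)
    note AG = all_loops_params[OF all_loops_spanning[OF assms(2)], of A]
    note BH = all_loops_params[OF all_loops_spanning[OF assms(3)], of B]
    note AB = all_loops_params[OF all_loops_spanning[OF D], of "A \<union> B", unfolded spanning_dunion[OF A B]]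
    have "nullity (dunion (spanning G A) (spanning H B)) = nullity (spanning G A) + nullity (spanning H B)"
      unfolding AG(3) BH(3) AB(3) s.edges_dunion
      using s.disj finite_edges[OF s.G] finite_edges[OF s.H] by (intro card_Un_disjoint)
    moreover have "w ^ nonorientability (dunion (spanning G A) (spanning H B)) =
        w ^ nonorientability (spanning G A) * w ^ nonorientability (spanning H B)"
      using assms(4) by (simp add: nonorientability_def s.orientable_dunion power2_eq_square)
    moreover have "components (spanning G A) + components (spanning H B) + (nullity (spanning G A) + nullity (spanning H B)) -
        (boundary_components (spanning G A) + boundary_components (spanning H B)) =
      (components (spanning G A) + nullity (spanning G A) - boundary_components (spanning G A)) +
      (components (spanning H B) + nullity (spanning H B) - boundary_components (spanning H B))"
      using AG(4) BH(4) by simp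
    ultimately show ?thesis
      unfolding spanning_dunion[OF A B] br_term_def s.components_dunion s.boundary_components_dunion AG(2) BH(2) AB(2)
      by (simp only: power_add) (simp add: mult_ac)
  qed
  have inj: "inj_on (\<lambda>(A, B). A \<union> B) (Pow (edges G) \<times> Pow (edges H))"
  proof (rule inj_onI, clarify)
    fix A B A' B' assume *: "A \<subseteq> edges G" "B \<subseteq> edges H" "A' \<subseteq> edges G" "B' \<subseteq> edges H" "A \<union> B = A' \<union> B'"
    have "A = (A \<union> B) \<inter> edges G" "A' = (A' \<union> B') \<inter> edges G" "B = (A \<union> B) \<inter> edges H" "B' = (A' \<union> B') \<inter> edges H"
      using *(1-4) disj(2) by blast+
    then show "A = A' \<and> B = B'" using *(5) by simp
  qed
  have img: "(\<lambda>(A, B). A \<union> B) ` (Pow (edges G) \<times> Pow (edges H)) = Pow (edges (dunion G H))"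
  proof (intro equalityI subsetI)
    fix C assume "C \<in> Pow (edges (dunion G H))"
    then have "C = (\<lambda>(A, B). A \<union> B) (C \<inter> edges G, C \<inter> edges H)" by auto
    then show "C \<in> (\<lambda>(A, B). A \<union> B) ` (Pow (edges G) \<times> Pow (edges H))" by blast
  qed auto
  have "bollobas_riordan (dunion G H) x y z w =
      (\<Sum>(A, B)\<in>Pow (edges G) \<times> Pow (edges H). br_term 0 x y z w (spanning (dunion G H) (A \<union> B)))"
    unfolding bollobas_riordan_eq_sum img[symmetric] sum.reindex[OF inj] all_loops_params(2)[OF D]
    by (simp add: case_prod_unfold comp_def)
  also have "\<dots> = (\<Sum>(A, B)\<in>Pow (edges G) \<times> Pow (edges H).
      br_term 0 x y z w (spanning G A) * br_term 0 x y z w (spanning H B))"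
    by (intro sum.cong refl) (auto simp: product)
  also have "\<dots> = bollobas_riordan G x y z w * bollobas_riordan H x y z w"
    unfolding bollobas_riordan_eq_sum all_loops_params(2)[OF assms(2)] all_loops_params(2)[OF assms(3)]
    by (simp add: sum_product sum.cartesian_product)
  finally show ?thesis .
qed

section \<open>Rank and nullity\<close>

lemma card_le_ccount:
  assumes "finite R" "finite S" "R \<subseteq> S \<times> S"
  shows "card S \<le> ccount S R + card R"
  using assms
proof (induction R rule: finite_induct)
  case (insert p R)
  obtain x y where p: "p = (x, y)" by (cases p)
  have "ccount S R \<le> Suc (ccount S (insert p R))"
    unfolding p using insert(4,5) p by (intro ccount_insert_le) auto
  then show ?case using insert by simp
qed (simp add: ccount_empty_rel)

lemma rank_le: "ribbon_graph G \<Longrightarrow> rank G \<le> card (edges G)"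
proof -
  assume G: "ribbon_graph G"
  have ends: "ends G = (\<lambda>e. (att G (e, False), att G (e, True))) ` edges G" by (auto simp: ends_def)
  have "finite (ends G)" "card (ends G) \<le> card (edges G)"
    unfolding ends using finite_edges[OF G] by (simp_all add: card_image_le)
  moreover have "card (verts G) \<le> ccount (verts G) (ends G) + card (ends G)"
    by (rule card_le_ccount[OF _ ribbon_graphD(2)[OF G] ends_subset[OF G]]) fact
  ultimately show ?thesis by (simp add: rank_def components_eq_ccount G)
qed

lemma nullity_contract:
  assumes "ribbon_graph G" "e \<in> edges G" "\<not> is_loop G e"
  shows "nullity (contract G e) = nullity G"
proof -
  note c = contract_facts[OF assms]
  have "card (verts G) \<ge> 1" using att_mem_edge(1)[OF assms(1,2)] ribbon_graphD(2)[OF assms(1)]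
    by (metis One_nat_def Suc_leI card_gt_0_iff empty_iff)
  then have "components G \<le> card (verts G) - 1" "card (verts G) - 1 < card (verts G)"
    using components_le[OF c(1)] c(3,4) by auto
  moreover have "card (edges (contract G e)) = card (edges G) - 1" "card (edges G) \<ge> 1"
    using assms(2) finite_edges[OF assms(1)] card_gt_0_iff[of "edges G"] by (auto simp: c(2))
  ultimately show ?thesis by (simp add: nullity_def rank_def c(3,4))
qed

text \<open>The rank is unchanged and one edge is lost; \<open>rank_le\<close> for the deletion
  ensures that truncated subtraction does not hide the decrease.\<close>

lemma nullity_delete_ordinary:
  assumes G: "ribbon_graph G" and e: "is_ordinary G e"
  shows "nullity (delete G e) < nullity G"
proof -
  have e': "e \<in> edges G" "\<not> is_bridge G e" using e by (simp_all add: is_ordinary_def)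
  then have "rank (delete G e) = rank G" by (simp add: rank_def components_delete_ordinary[OF G])
  moreover have "rank (delete G e) \<le> card (edges G) - 1"
    using rank_le[OF ribbon_graph_delete[OF G, of e]] e' finite_edges[OF G] by simp
  moreover have "card (edges (delete G e)) = card (edges G) - 1" "card (edges G) \<ge> 1"
    using e' finite_edges[OF G] card_gt_0_iff[of "edges G"] by auto
  ultimately show ?thesis by (simp add: nullity_def)
qed

section \<open>Bouquets and chord words\<close>

text \<open>Unlike in \<open>chord_diagram\<close>, the vertex is arbitrary, so that two bouquets
  can be made disjoint.\<close>

definition bouquet :: "nat \<Rightarrow> half_edge list \<Rightarrow> nat set \<Rightarrow> ribbon" where
  "bouquet v xs N = \<lparr>verts = {v}, rotn = (\<lambda>u. if u = v then xs else []), neg = N\<rparr>"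

text \<open>Exactly the condition for \<open>bouquet\<close> to be a ribbon graph; applied to a
  concatenation, it is also the condition for two-vertex graphs.\<close>

definition chord_word :: "half_edge list \<Rightarrow> nat set \<Rightarrow> bool" where
  "chord_word xs N \<longleftrightarrow> distinct xs \<and> opp ` set xs \<subseteq> set xs \<and> N \<subseteq> fst ` set xs"

lemma bouquet_simps [simp]:
  "verts (bouquet v xs N) = {v}" "rotn (bouquet v xs N) u = (if u = v then xs else [])"
  "neg (bouquet v xs N) = N" "half_edges (bouquet v xs N) = set xs"
  "edges (bouquet v xs N) = fst ` set xs"
  by (simp_all add: bouquet_def half_edges_def edges_def)

lemma ribbon_graph_bouquet_iff: "ribbon_graph (bouquet v xs N) \<longleftrightarrow> chord_word xs N"
  by (auto simp: ribbon_graph_def chord_word_def)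

lemma is_bouquet_bouquet: "chord_word xs N \<Longrightarrow> is_bouquet (bouquet v xs N)"
  by (simp add: is_bouquet_def ribbon_graph_bouquet_iff)

lemma is_bouquetE:
  assumes "is_bouquet G"
  obtains v xs N where "G = bouquet v xs N" "chord_word xs N"
proof -
  obtain v where v: "verts G = {v}" using assms by (auto simp: is_bouquet_def card_1_singleton_iff)
  have G: "ribbon_graph G" using assms by (simp add: is_bouquet_def)
  have "G = bouquet v (rotn G v) (neg G)"
    using v ribbon_graphD(3)[OF G] by (intro ribbon.equality) (auto simp: bouquet_def)
  then show ?thesis using that G ribbon_graph_bouquet_iff by metis
qed

lemma att_bouquet: "chord_word xs N \<Longrightarrow> h \<in> set xs \<Longrightarrow> att (bouquet v xs N) h = v"
  by (rule att_eq) (simp_all add: ribbon_graph_bouquet_iff)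

lemma chord_word_mem: "chord_word xs N \<Longrightarrow> (e, b) \<in> set xs \<longleftrightarrow> e \<in> fst ` set xs"
  using half_edge_iff[of "bouquet 0 xs N" "(e, b)"] by (simp add: ribbon_graph_bouquet_iff)

lemma chord_word_opp: "chord_word xs N \<Longrightarrow> h \<in> set xs \<Longrightarrow> opp h \<in> set xs"
  by (auto simp: chord_word_def)

lemma chord_word_add:
  assumes "chord_word zs N" "e \<notin> fst ` set zs" "distinct ws"
    and "set ws = insert (e, False) (insert (e, True) (set zs))"
  shows "chord_word ws N"
  using assms unfolding chord_word_def assms(4) by auto

lemma all_loops_bouquet: "chord_word xs N \<Longrightarrow> all_loops (bouquet v xs N)"
  using chord_word_mem[of xs N] by (auto simp: all_loops_def ribbon_graph_bouquet_iff is_loop_def att_bouquet)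

lemma spanning_bouquet:
  "spanning (bouquet v xs N) A = bouquet v (filter (\<lambda>h. fst h \<in> A) xs) (N \<inter> A)"
  by (auto simp: spanning_def bouquet_def)

lemma cyclic_equal_bouquet: "cyclic_equal (bouquet v (xs @ ys) N) (bouquet v (ys @ xs) N)"
  by (auto simp: cyclic_equal_def)

lemma orientable_all_loops: "all_loops G \<Longrightarrow> orientable G \<longleftrightarrow> neg G = {}"
  using ribbon_graphD(5)[of G] by (auto simp: orientable_def all_loops_def is_loop_def)

lemma br_term_all_loops:
  assumes "all_loops G"
  shows "br_term 0 x y z w G = y ^ card (edges G) *
    z ^ (card (verts G) + card (edges G) - boundary_components G) * w ^ (if neg G = {} then 0 else 1)"
  using assms by (simp add: br_term_def all_loops_params nonorientability_def orientable_all_loops)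

lemma edgeless_all_loops: "ribbon_graph G \<Longrightarrow> edges G = {} \<Longrightarrow> all_loops G"
  by (simp add: all_loops_def)

lemma br_term_edgeless:
  assumes "ribbon_graph G" "edges G = {}"
  shows "br_term 0 x y z w G = 1"
  using br_term_all_loops[OF edgeless_all_loops[OF assms]] assms ribbon_graphD(5)[OF assms(1)]
  by (simp add: boundary_components_edgeless)

lemma bollobas_riordan_edgeless:
  assumes "ribbon_graph G" "edges G = {}"
  shows "bollobas_riordan G x y z w = 1"
  using br_term_edgeless[OF assms] all_loops_params(2)[OF edgeless_all_loops[OF assms]]
    spanning_edges[OF assms(1)] assms(2)
  by (simp add: bollobas_riordan_eq_sum)

section \<open>The polynomial on one chord and on two crossing chords\<close>

lemma boundary_components_bouquet:
  assumes "chord_word xs N" "xs \<noteq> []"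
  shows "boundary_components (bouquet v xs N) = ccount (set xs \<times> UNIV) (list_arcs xs \<union> sides N (fst ` set xs))"
  using assms by (simp add: boundary_components_ccount ribbon_graph_bouquet_iff arcs_def)

lemma sides_conn:
  assumes "fst h \<in> A" shows "((h, b), (opp h, if fst h \<in> N then b else \<not> b)) \<in> conn (R \<union> sides N A)"
proof -
  obtain e c where h: "h = (e, c)" by (cases h)
  have "((h, b), (opp h, if e \<in> N then b else \<not> b)) \<in> sides N A \<or>
      ((opp h, if e \<in> N then b else \<not> b), (h, b)) \<in> sides N A"
    using assms unfolding h sides_def by (cases c) auto
  then show ?thesis unfolding h fst_conv using conn_base[of _ _ "R \<union> sides N A"] conn_base'[of _ _ "R \<union> sides N A"] by blast
qed

text \<open>The surface is an annulus for a positive chord and a Moebius band for a negative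
  one.\<close>

lemma boundary_components_single:
  assumes "chord_word [k, opp k] N"
  shows "boundary_components (bouquet v [k, opp k] N) = (if fst k \<in> N then 1 else 2)"
proof -
  obtain c b where k: "k = (c, b)" by (cases k)
  let ?p = "\<lambda>x y. ((c, x), y)"
  let ?R = "list_arcs [k, opp k] \<union> sides N (fst ` set [k, opp k])"
  have arcs: "list_arcs [k, opp k] = {(?p False True, ?p True False), (?p True True, ?p False False)}"
    using k by (cases b) (auto simp: list_arcs_eq)
  have set: "set [k, opp k] \<times> UNIV = {?p False True, ?p True False} \<union> {?p True True, ?p False False}"
    using k by (cases b) (auto simp: opp_def)
  have sides: "sides N (fst ` set [k, opp k]) = {(?p False False, ?p True (c \<notin> N)), (?p False True, ?p True (c \<in> N))}"
    using sides_insert[of N c "{}"] k by (simp add: sides_def)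
  show ?thesis
  proof (cases "c \<in> N")
    case True
    have "(?p False True, ?p True False) \<in> conn ?R" "(?p True True, ?p False False) \<in> conn ?R"
      "(?p False True, ?p True True) \<in> conn ?R"
      unfolding arcs sides using True by (auto intro: conn_base)
    then have "(?p False True, x) \<in> conn ?R" if "x \<in> set [k, opp k] \<times> UNIV" for x
      using that unfolding set by (auto intro: conn_trans)
    then have "ccount (set [k, opp k] \<times> UNIV) ?R = 1"
      unfolding set by (intro ccount_one[of "?p False True"]) auto
    then show ?thesis using True assms by (simp add: boundary_components_bouquet k)
  next
    case False
    have "?R = {(?p False True, ?p True False)} \<union> {(?p True True, ?p False False), (?p False False, ?p True True)}"
      unfolding arcs sides using False by auto
    then have "ccount (set [k, opp k] \<times> UNIV) ?R = ccount {?p False True, ?p True False} {(?p False True, ?p True False)} +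
        ccount {?p True True, ?p False False} {(?p True True, ?p False False), (?p False False, ?p True True)}"
      unfolding set by (simp only:) (intro ccount_Un; auto)
    also have "ccount {?p False True, ?p True False} {(?p False True, ?p True False)} = 1"
      by (rule ccount_one[of "?p False True"]) (auto intro: conn_base)
    also have "ccount {?p True True, ?p False False} {(?p True True, ?p False False), (?p False False, ?p True True)} = 1"
      by (rule ccount_one[of "?p True True"]) (auto intro: conn_base)
    finally show ?thesis using False assms by (simp add: boundary_components_bouquet k)
  qed
qed

text \<open>The surface is a torus with one hole: alternating arcs and ribbon sides, a single walk
  from \<open>(l, True)\<close> visits all eight points.\<close>

lemma boundary_components_crossing:
  assumes "chord_word [l, m, opp l, opp m] {}"
  shows "boundary_components (bouquet v [l, m, opp l, opp m] {}) = 1"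
proof -
  let ?xs = "[l, m, opp l, opp m]"
  let ?R = "list_arcs ?xs \<union> sides {} (fst ` set ?xs)"
  have arc: "p \<in> list_arcs ?xs \<Longrightarrow> p \<in> conn ?R" for p
    by (cases p) (auto intro: conn_base)
  have side: "((h, b), (opp h, \<not> b)) \<in> conn ?R" if "h \<in> set ?xs" for h b
    using sides_conn[of h "fst ` set ?xs" b "{}" "list_arcs ?xs"] that by auto
  have 1: "((l, True), (m, False)) \<in> conn ?R" by (rule arc) (simp add: list_arcs_eq)
  have 2: "((m, False), (opp m, True)) \<in> conn ?R" using side[of m False] by simp
  have 3: "((opp m, True), (l, False)) \<in> conn ?R" by (rule arc) (simp add: list_arcs_eq)
  have 4: "((l, False), (opp l, True)) \<in> conn ?R" using side[of l False] by simp
  have 5: "((opp l, True), (opp m, False)) \<in> conn ?R" by (rule arc) (simp add: list_arcs_eq)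
  have 6: "((opp m, False), (m, True)) \<in> conn ?R" using side[of "opp m" False] by simp
  have 7: "((m, True), (opp l, False)) \<in> conn ?R" by (rule arc) (simp add: list_arcs_eq)
  note c2 = conn_trans[OF 1 2]
  note c3 = conn_trans[OF c2 3]
  note c4 = conn_trans[OF c3 4]
  note c5 = conn_trans[OF c4 5]
  note c6 = conn_trans[OF c5 6]
  note c7 = conn_trans[OF c6 7]
  have "(( l, True), (h, b)) \<in> conn ?R" if "h \<in> set ?xs" for h b
    using that 1 c2 c3 c4 c5 c6 c7 conn_refl[of "(l, True)" ?R] by (cases b) auto
  then have "ccount (set ?xs \<times> UNIV) ?R = 1" by (intro ccount_one[of "(l, True)"]) auto
  then show ?thesis using assms by (simp add: boundary_components_bouquet)
qed

lemma bollobas_riordan_bouquet_sum: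
  assumes "chord_word xs N"
  shows "bollobas_riordan (bouquet v xs N) x y z w =
    (\<Sum>A\<in>Pow (fst ` set xs). br_term 0 x y z w (bouquet v (filter (\<lambda>h. fst h \<in> A) xs) (N \<inter> A)))"
  using all_loops_params(2)[OF all_loops_bouquet[OF assms]]
  by (simp add: bollobas_riordan_eq_sum spanning_bouquet)

lemma br_term_single:
  assumes "chord_word [k, opp k] N"
  shows "br_term 0 x y z w (bouquet v [k, opp k] N) = (if fst k \<in> N then y * z * w else y)"
proof -
  have "N = (if fst k \<in> N then {fst k} else {})" using assms by (auto simp: chord_word_def)
  then show ?thesis
    using br_term_all_loops[OF all_loops_bouquet[OF assms], of x y z w v] boundary_components_single[OF assms, of v]
    by (auto split: if_splits)
qed

lemma br_term_bouquet_Nil: "br_term 0 x y z w (bouquet v [] {}) = 1"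
  by (rule br_term_edgeless) (simp_all add: ribbon_graph_bouquet_iff chord_word_def)

lemma bollobas_riordan_single:
  assumes "chord_word [k, opp k] N"
  shows "bollobas_riordan (bouquet v [k, opp k] N) x y z w = 1 + (if fst k \<in> N then y * z * w else y)"
proof -
  have "N \<inter> {fst k} = N" using assms by (auto simp: chord_word_def)
  then show ?thesis
    using br_term_single[OF assms, of x y z w v]
    by (simp add: bollobas_riordan_bouquet_sum[OF assms] Pow_insert br_term_bouquet_Nil)
qed

text \<open>The full chord set has Euler genus 1 + 2 - 1 = 2, whence the square of \<open>z\<close>;
  a single positive chord has Euler genus 0.\<close>

lemma bollobas_riordan_crossing:
  assumes cw: "chord_word [l, m, opp l, opp m] {}"
  shows "bollobas_riordan (bouquet v [l, m, opp l, opp m] {}) x y z w = 1 + 2 * y + y\<^sup>2 * z\<^sup>2"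
proof -
  have lm: "fst l \<noteq> fst m" using cw fst_eq_iff[of l m] by (auto simp: chord_word_def)
  have "{fst l, fst m, fst l, fst m} = {fst l, fst m}" by auto
  then have card_lm: "card {fst l, fst m, fst l, fst m} = 2" using lm by simp
  have single: "chord_word [k, opp k] {}" if "k \<in> {l, m}" for k
    using cw that by (auto simp: chord_word_def)
  have "br_term 0 x y z w (bouquet v [l, m, opp l, opp m] {}) = y\<^sup>2 * z\<^sup>2"
    using br_term_all_loops[OF all_loops_bouquet[OF cw], of x y z w v] boundary_components_crossing[OF cw, of v] card_lm
    by (simp add: numeral_2_eq_2)
  moreover have "br_term 0 x y z w (bouquet v [k, opp k] {}) = y" if "k \<in> {l, m}" for k
    using br_term_single[OF single[OF that]] by simp
  moreover have "Pow (fst ` set [l, m, opp l, opp m]) = {{}, {fst l}, {fst m}, {fst l, fst m}}"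
    using lm by (auto simp: Pow_insert)
  ultimately show ?thesis
    using lm by (simp add: bollobas_riordan_bouquet_sum[OF cw] br_term_bouquet_Nil doubleton_eq_iff)
qed

section \<open>Two-vertex ribbon graphs\<close>

definition link :: "nat \<Rightarrow> nat \<Rightarrow> half_edge list \<Rightarrow> half_edge list \<Rightarrow> nat set \<Rightarrow> ribbon" where
  "link v w xs ys N = \<lparr>verts = {v, w}, rotn = (\<lambda>u. if u = v then xs else if u = w then ys else []), neg = N\<rparr>"

lemma link_simps [simp]:
  "verts (link v w xs ys N) = {v, w}"
  "rotn (link v w xs ys N) u = (if u = v then xs else if u = w then ys else [])"
  "neg (link v w xs ys N) = N"
  by (simp_all add: link_def)

lemma half_edges_link [simp]: "v \<noteq> w \<Longrightarrow> half_edges (link v w xs ys N) = set xs \<union> set ys"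
  by (simp add: half_edges_def)

lemma edges_link [simp]: "v \<noteq> w \<Longrightarrow> edges (link v w xs ys N) = fst ` (set xs \<union> set ys)"
  by (simp add: edges_def)

lemma ribbon_graph_link_iff: "v \<noteq> w \<Longrightarrow> ribbon_graph (link v w xs ys N) \<longleftrightarrow> chord_word (xs @ ys) N"
  by (simp add: ribbon_graph_def chord_word_def image_subset_iff ball_Un) blast

lemma att_link:
  assumes "v \<noteq> w" "chord_word (xs @ ys) N"
  shows "h \<in> set xs \<Longrightarrow> att (link v w xs ys N) h = v" "h \<in> set ys \<Longrightarrow> att (link v w xs ys N) h = w"
  using assms by (auto intro!: att_eq simp: ribbon_graph_link_iff)

lemma contract_pos_link:
  assumes "v \<noteq> w" "chord_word (xs @ ys) N" "(e, False) \<in> set xs" "(e, True) \<in> set ys"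
  shows "contract_pos (link v w xs ys N) e = bouquet v (open_at (e, False) xs @ open_at (e, True) ys) N"
  using assms by (auto simp: contract_pos_def att_link Let_def bouquet_def)

lemma flip_vertex_link:
  assumes "v \<noteq> w"
  shows "flip_vertex w (link v w xs ys N) = link v w xs (rev ys) (neg (flip_vertex w (link v w xs ys N)))"
  using assms by (intro ribbon.equality) auto

text \<open>The second edge \<open>f\<close> keeps the two vertices connected once \<open>e\<close>
  is deleted.\<close>

lemma link_ordinary:
  assumes vw: "v \<noteq> w" and cw: "chord_word (xs @ ys) N"
    and e: "(e, b) \<in> set xs" "(e, \<not> b) \<in> set ys" and f: "(f, c) \<in> set xs" "(f, \<not> c) \<in> set ys" "f \<noteq> e"
  shows "is_ordinary (link v w xs ys N) e"
proof -
  let ?L = "link v w xs ys N"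
  note L = ribbon_graph_link_iff[THEN iffD2, OF vw cw]
  have ends: "att ?L (d, False) = v \<and> att ?L (d, True) = w \<or> att ?L (d, False) = w \<and> att ?L (d, True) = v"
    if "(d, a) \<in> set xs" "(d, \<not> a) \<in> set ys" for d a
    using that att_link[OF vw cw] by (cases a) auto
  have mem: "e \<in> edges ?L" "f \<in> edges ?L" using e f vw by (force simp: image_iff)+
  have "(v, w) \<in> ends (delete ?L e) \<or> (w, v) \<in> ends (delete ?L e)"
    using endsI[of f "delete ?L e"] ends[OF f(1,2)] mem(2) f(3) by (auto simp: att_delete[OF L])
  then have "(v, w) \<in> conn (ends (delete ?L e))" using conn_base conn_base' by metis
  then have "components (delete ?L e) = 1"
    unfolding components_eq_ccount[OF ribbon_graph_delete[OF L]] by (intro ccount_one[of v]) auto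
  moreover have "components ?L \<ge> 1"
    using components_eq_ccount[OF L] by (simp add: ccount_eq_card_image card_insert_if)
  ultimately show ?thesis
    using ends[OF e] mem vw by (auto simp: is_ordinary_def is_bridge_def is_loop_def)
qed

text \<open>The bridge is placed where the two words are cut open, so contracting it concatenates
  them unchanged.\<close>

lemma link_bridge:
  assumes vw: "v \<noteq> w" and cw: "chord_word xs N" "chord_word ys N'" "fst ` set xs \<inter> fst ` set ys = {}"
    and e: "e \<notin> fst ` set xs" "e \<notin> fst ` set ys"
  defines "L \<equiv> link v w ((e, False) # xs) ((e, True) # ys) (N \<union> N')"
  shows "ribbon_graph L" "contract L e = bouquet v (xs @ ys) (N \<union> N')"
    "delete L e = dunion (bouquet v xs N) (bouquet w ys N')" "is_bridge L e"
proof -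
  have disj: "set xs \<inter> set ys = {}" using cw(3) by blast
  have cwL: "chord_word (((e, False) # xs) @ ((e, True) # ys)) (N \<union> N')"
    using cw(1,2) e disj by (auto simp: chord_word_def image_iff)
  show L: "ribbon_graph L" unfolding L_def by (rule ribbon_graph_link_iff[THEN iffD2, OF vw cwL])
  have "e \<notin> neg L" using cw(1,2) e by (auto simp: L_def chord_word_def)
  then show "contract L e = bouquet v (xs @ ys) (N \<union> N')"
    using contract_pos_link[OF vw cwL, of e] open_at_eq[of _ "[]"] by (simp add: contract_def L_def)
  have edges: "edges L = insert e (fst ` set xs \<union> fst ` set ys)"
    using vw by (auto simp: L_def)
  define E where "E = edges L - {e}"
  have fil: "filter (\<lambda>h. fst h \<in> E) xs = xs" "filter (\<lambda>h. fst h \<in> E) ys = ys" "e \<notin> E"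
    using e by (auto simp: E_def edges intro!: filter_True)
  have neg: "neg L \<inter> E = N \<union> N'"
  proof -
    have "neg L = N \<union> N'" by (simp add: L_def)
    then show ?thesis using cw(1,2) e unfolding E_def edges by (auto simp: chord_word_def)
  qed
  have rot: "filter (\<lambda>h. fst h \<in> E) (rotn L u) = (if u \<in> {v} then rotn (bouquet v xs N) u else rotn (bouquet w ys N') u)" for u
    using fil by (simp add: L_def)
  have "spanning L E = dunion (bouquet v xs N) (bouquet w ys N')"
    unfolding spanning_def dunion_def rot neg by (simp add: L_def insert_commute)
  then show del: "delete L e = dunion (bouquet v xs N) (bouquet w ys N')"
    by (simp add: delete_def E_def)
  interpret d: disjoint_pair "bouquet v xs N" "bouquet w ys N'"
    by unfold_locales (use vw cw in \<open>simp_all add: ribbon_graph_bouquet_iff\<close>)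
  have "components (delete L e) = 2"
    unfolding del d.components_dunion using all_loops_params(1)[OF all_loops_bouquet] cw by simp
  moreover have "(v, w) \<in> conn (ends L)"
    using endsI[of e L] att_link[OF vw cwL] by (auto simp: L_def edges[unfolded L_def] intro: conn_base)
  then have "components L = 1"
    unfolding components_eq_ccount[OF L] by (intro ccount_one[of v]) (auto simp: L_def)
  ultimately show "is_bridge L e" by (simp add: is_bridge_def edges)
qed

lemma fresh_edge:
  fixes A :: "nat set"
  assumes "finite A" obtains e where "e \<notin> A"
  using assms ex_new_if_finite[OF infinite_UNIV_nat] by blast

text \<open>A join arises by contracting a bridge between its two bouquets.\<close>

lemma bollobas_riordan_join:
  assumes cw: "chord_word xs N" "chord_word ys N'" "fst ` set xs \<inter> fst ` set ys = {}"
    and vw: "v \<noteq> v'" and w: "w\<^sup>2 = (w :: 'r::comm_ring_1)"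
  shows "bollobas_riordan (bouquet v (xs @ ys) (N \<union> N')) x y z w =
    bollobas_riordan (bouquet v xs N) x y z w * bollobas_riordan (bouquet v' ys N') x y z w"
proof -
  obtain e where "e \<notin> fst ` set xs \<union> fst ` set ys" by (rule fresh_edge[of "fst ` set xs \<union> fst ` set ys"]) auto
  then have e: "e \<notin> fst ` set xs" "e \<notin> fst ` set ys" by simp_all
  note L = link_bridge[OF vw cw e]
  interpret d: disjoint_pair "bouquet v xs N" "bouquet v' ys N'"
    by unfold_locales (use vw cw in \<open>simp_all add: ribbon_graph_bouquet_iff\<close>)
  show ?thesis
    using bollobas_riordan_bridge(1)[OF L(1,4), of x y z w]
      bollobas_riordan_dunion[OF d.disjoint_pair_axioms all_loops_bouquet[OF cw(1)] all_loops_bouquet[OF cw(2)] w]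
    unfolding L(2,3) by simp
qed

section \<open>Equivalences of bouquets\<close>

lemma ribbon_equiv_trans: "ribbon_equiv G H \<Longrightarrow> ribbon_equiv H K \<Longrightarrow> ribbon_equiv G K"
  unfolding ribbon_equiv_def by (rule equivclp_trans)

lemma ribbon_equiv_move: "ribbon_move G H \<Longrightarrow> ribbon_equiv G H"
  unfolding ribbon_equiv_def by (rule r_into_equivclp)

lemma ribbon_equiv_rotate:
  "chord_word (xs @ ys) N \<Longrightarrow> ribbon_equiv (bouquet v (xs @ ys) N) (bouquet v (ys @ xs) N)"
proof (induction xs arbitrary: ys)
  case (Cons h xs)
  have "rotate_vertex v (bouquet v ((h # xs) @ ys) N) = bouquet v (xs @ ys @ [h]) N"
    by (auto simp: rotate_vertex_def bouquet_def)
  then have "ribbon_equiv (bouquet v ((h # xs) @ ys) N) (bouquet v (xs @ ys @ [h]) N)"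
    using ribbon_move.rotate[of "bouquet v ((h # xs) @ ys) N" v] Cons.prems
    by (simp add: ribbon_graph_bouquet_iff ribbon_equiv_move)
  moreover have "chord_word (xs @ ys @ [h]) N" using Cons.prems by (auto simp: chord_word_def)
  then have "ribbon_equiv (bouquet v (xs @ ys @ [h]) N) (bouquet v ((ys @ [h]) @ xs) N)"
    using Cons.IH[of "ys @ [h]"] by simp
  ultimately show ?case using ribbon_equiv_trans by simp
qed (simp add: ribbon_equiv_def)

lemma ribbon_equiv_relabel:
  assumes "chord_word xs N" "inj_on g (set xs)" "\<And>h. h \<in> set xs \<Longrightarrow> g (opp h) = opp (g h)"
  shows "ribbon_equiv (bouquet v xs N) (bouquet v' (map g xs) ((\<lambda>e. fst (g (e, False))) ` N))"
proof -
  have "relabel (\<lambda>_. v') g (bouquet v xs N) = bouquet v' (map g xs) ((\<lambda>e. fst (g (e, False))) ` N)"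
    using inv_into_into[of v' "\<lambda>_. v'" "{v}"] by (auto simp: relabel_def bouquet_def)
  then show ?thesis
    using ribbon_move.relabel[of "bouquet v xs N" "\<lambda>_. v'" g] assms
    by (simp add: ribbon_graph_bouquet_iff ribbon_equiv_move)
qed

lemma ribbon_equiv_single:
  assumes "chord_word [k, opp k] N"
  shows "ribbon_equiv (bouquet v [k, opp k] N) (if fst k \<in> N then D101 else D100)"
proof -
  have k: "opp k \<noteq> k" by (cases k) simp
  \<comment> \<open>Sends \<open>k\<close> to \<open>(0, False)\<close>, whichever half of its edge
    \<open>k\<close> is.\<close>
  let ?g = "\<lambda>h. (0, h \<noteq> k)"
  have equiv: "ribbon_equiv (bouquet v [k, opp k] N)
      (bouquet 0 (map ?g [k, opp k]) ((\<lambda>e. fst (?g (e, False))) ` N))"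
  proof (rule ribbon_equiv_relabel[OF assms])
    show "inj_on ?g (set [k, opp k])" using k by (auto simp: inj_on_def)
    show "?g (opp h) = opp (?g h)" if "h \<in> set [k, opp k]" for h
      using that k by auto
  qed
  have "N = (if fst k \<in> N then {fst k} else {})" using assms by (auto simp: chord_word_def)
  then show ?thesis
    using equiv k by (auto simp: D101_def D100_def chord_diagram_def bouquet_def inj_on_def split: if_splits)
qed

lemma ribbon_equiv_crossing:
  assumes "chord_word [l, m, opp l, opp m] {}"
  shows "ribbon_equiv (bouquet v [l, m, opp l, opp m] {}) D210"
proof -
  have d: "l \<noteq> m" "l \<noteq> opp l" "m \<noteq> opp m" "l \<noteq> opp m" "m \<noteq> opp l" "opp l \<noteq> opp m"
    using assms by (auto simp: chord_word_def)
  let ?g = "\<lambda>h. if h = l then (0 :: nat, False) else if h = m then (1, False) else if h = opp l then (0, True) else (1, True)"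
  have "ribbon_equiv (bouquet v [l, m, opp l, opp m] {})
      (bouquet 0 (map ?g [l, m, opp l, opp m]) ((\<lambda>e. fst (?g (e, False))) ` {}))"
  proof (rule ribbon_equiv_relabel[OF assms])
    show "inj_on ?g (set [l, m, opp l, opp m])" using d by (auto simp: inj_on_def)
    show "?g (opp h) = opp (?g h)" if h: "h \<in> set [l, m, opp l, opp m]" for h
    proof -
      consider "h = l" | "h = m" | "h = opp l" | "h = opp m" using h by auto
      then show ?thesis by cases (use d d[symmetric] in simp_all)
    qed
  qed
  then have "ribbon_equiv (bouquet v [l, m, opp l, opp m] {}) (bouquet 0 (map ?g [l, m, opp l, opp m]) {})" by simp
  also have "bouquet 0 (map ?g [l, m, opp l, opp m]) {} = D210"
    using d by (auto simp: bouquet_def D210_def chord_diagram_def)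
  finally show ?thesis .
qed

section \<open>The recursion on a minor-closed class\<close>

locale deletion_contraction =
  fixes M :: "ribbon set"
    and F :: "ribbon \<Rightarrow> 'r::comm_ring_1"
    and \<alpha> \<alpha>inv x u v s q r :: 'r
  assumes M_class: "ribbon_class M"
    and M_minor: "minor_closed M"
    and M_expand: "expansion_closed M"
    and M_summand: "summand_closed M"
    and F_equiv: "\<And>G H. G \<in> M \<Longrightarrow> ribbon_equiv G H \<Longrightarrow> F G = F H"
    and s_def: "s = F D210" and q_def: "q = F D100" and r_def: "r = F D101"
    and unit: "\<alpha> * \<alpha>inv = 1"
    and ordinary: "\<And>G e. G \<in> M \<Longrightarrow> is_ordinary G e \<Longrightarrow> F G = F (contract G e) + F (delete G e)"
    and bridge: "\<And>G e. G \<in> M \<Longrightarrow> is_bridge G e \<Longrightarrow> F G = x * F (contract G e)"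
    and dunion: "\<And>G H. is_bouquet G \<Longrightarrow> is_bouquet_union H \<Longrightarrow>
          verts G \<inter> verts H = {} \<Longrightarrow> edges G \<inter> edges H = {} \<Longrightarrow>
          G \<in> M \<Longrightarrow> H \<in> M \<Longrightarrow> dunion G H \<in> M \<Longrightarrow> F (dunion G H) = F G * F H"
    and join: "\<And>G H. is_bouquet G \<Longrightarrow> is_bouquet H \<Longrightarrow> edges G \<inter> edges H = {} \<Longrightarrow>
          G \<in> M \<Longrightarrow> H \<in> M \<Longrightarrow> join G H \<in> M \<Longrightarrow> \<alpha> * F (join G H) = F G * F H"
    and edgeless: "\<And>G. G \<in> M \<Longrightarrow> edges G = {} \<Longrightarrow> F G = \<alpha> ^ card (verts G)"
    and params: "(q - \<alpha>)\<^sup>2 * u\<^sup>2 = \<alpha> * (s - 2 * q + \<alpha>)" "(q - \<alpha>) * u * v = r - \<alpha>" "v = v\<^sup>2"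
begin

abbreviation BR :: "ribbon \<Rightarrow> 'r" where
  "BR G \<equiv> bollobas_riordan G x (\<alpha>inv * q - 1) u v"

definition P :: "ribbon \<Rightarrow> 'r" where
  "P G = \<alpha> ^ components G * BR G"

section \<open>Closure properties of the class and the relations satisfied by
  \<open>P\<close>\<close>

lemma graph: "G \<in> M \<Longrightarrow> ribbon_graph G"
  using M_class by (auto simp: ribbon_class_def)

lemma M_equiv: "G \<in> M \<Longrightarrow> ribbon_equiv G H \<Longrightarrow> H \<in> M"
  using M_class by (auto simp: ribbon_class_def)

lemma M_delete: "G \<in> M \<Longrightarrow> e \<in> edges G \<Longrightarrow> delete G e \<in> M"
  and M_contract: "G \<in> M \<Longrightarrow> e \<in> edges G \<Longrightarrow> \<not> is_loop G e \<Longrightarrow> contract G e \<in> M"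
  using M_minor by (auto simp: minor_closed_def)

text \<open>The complement of \<open>A\<close> is deleted edge by edge; this puts the factors of a
  join into the class.\<close>

lemma M_spanning:
  assumes "G \<in> M" "A \<subseteq> edges G" shows "spanning G A \<in> M"
proof -
  have "spanning G (edges G - B) \<in> M" if "finite B" "B \<subseteq> edges G" for B
    using that
  proof (induction B rule: finite_induct)
    case empty
    then show ?case using assms(1) by (simp add: spanning_edges[OF graph])
  next
    case (insert e B)
    have "delete (spanning G (edges G - B)) e = spanning G (edges G - insert e B)"
      unfolding delete_def spanning_spanning by (intro arg_cong[where f = "spanning G"]) auto
    moreover have "e \<in> edges (spanning G (edges G - B))" using insert by auto
    ultimately show ?case using M_delete[of "spanning G (edges G - B)" e] insert by auto
  qed
  from this[of "edges G - A"] show ?thesis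
    using finite_edges[OF graph[OF assms(1)]] assms(2) by (simp add: double_diff)
qed

lemma P_ordinary: "ribbon_graph G \<Longrightarrow> is_ordinary G e \<Longrightarrow> P G = P (contract G e) + P (delete G e)"
  by (simp add: P_def bollobas_riordan_ordinary is_ordinary_def contract_facts(3) components_delete_ordinary algebra_simps)

lemma P_bridge: "ribbon_graph G \<Longrightarrow> is_bridge G e \<Longrightarrow> P G = x * P (contract G e)"
  using bridge_not_loop[of G e]
  by (simp add: P_def bollobas_riordan_bridge(2) contract_facts(3) is_bridge_def algebra_simps)

lemma P_bouquet: "chord_word xs N \<Longrightarrow> P (bouquet a xs N) = \<alpha> * BR (bouquet a xs N)"
  by (simp add: P_def all_loops_params(1)[OF all_loops_bouquet])

lemma unit_cancel: "\<alpha> * a = \<alpha> * b \<Longrightarrow> a = b"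
  using unit by (metis mult.left_commute mult.commute mult_1)

text \<open>Brings the substituted value of y into the form in which condition (4) is
  stated.\<close>

lemma alpha_y: "\<alpha> * (\<alpha>inv * q - 1) = q - \<alpha>"
  using unit by (simp add: algebra_simps) (metis mult.assoc mult_1)

section \<open>Chord slides as reductions between bouquets\<close>

definition settled_below :: "ribbon \<Rightarrow> bool" where
  "settled_below G \<longleftrightarrow> (\<forall>K\<in>M. nullity K < nullity G \<longrightarrow> F K = P K)"

text \<open>Reduces the claim for \<open>G\<close> to the claim for \<open>H\<close>, granted all
  lower nullities. Membership and equal nullity are included so that reductions can be chained. Not
  only chord slides satisfy it: rotations do as well.\<close>

definition slides :: "ribbon \<Rightarrow> ribbon \<Rightarrow> bool" where
  "slides G H \<longleftrightarrow> H \<in> M \<and> nullity H = nullity G \<and> (settled_below G \<longrightarrow> F H = P H \<longrightarrow> F G = P G)"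

lemma slides_trans: "slides G H \<Longrightarrow> slides H K \<Longrightarrow> slides G K"
  by (simp add: slides_def settled_below_def)

text \<open>Both expansions of \<open>F L - P L\<close> leave only the contraction, since \<open>F = P\<close> at lower nullity.\<close>

lemma slides_contract:
  assumes L: "L \<in> M" and e: "is_ordinary L e" and f: "is_ordinary L f"
  shows "slides (contract L e) (contract L f)"
proof -
  have G: "ribbon_graph L" using L by (rule graph)
  have e': "e \<in> edges L" "\<not> is_loop L e" and f': "f \<in> edges L" "\<not> is_loop L f"
    using e f by (simp_all add: is_ordinary_def)
  have null: "nullity (contract L e) = nullity L" "nullity (contract L f) = nullity L"
    by (rule nullity_contract[OF G e'] nullity_contract[OF G f'])+
  have "F (contract L e) = P (contract L e)"
    if "settled_below (contract L e)" "F (contract L f) = P (contract L f)"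
  proof -
    have "F (delete L e) = P (delete L e)" "F (delete L f) = P (delete L f)"
      using that(1) M_delete[OF L] e' f' nullity_delete_ordinary[OF G e] nullity_delete_ordinary[OF G f]
      by (auto simp: settled_below_def null)
    then show ?thesis
      using ordinary[OF L e] ordinary[OF L f] P_ordinary[OF G e] P_ordinary[OF G f] that(2)
      by (metis add_right_cancel)
  qed
  then show ?thesis
    using M_contract[OF L f'] by (simp add: slides_def null)
qed

text \<open>\<open>expansion_closed\<close> brings the two-vertex graph into \<open>M\<close>, since
  it contracts to a bouquet of \<open>M\<close>; either connecting edge shows the other one to be
  ordinary.\<close>

lemma slides_link:
  assumes ab: "a \<noteq> b" and cw: "chord_word (xs @ ys) N"
    and e: "(e, c) \<in> set xs" "(e, \<not> c) \<in> set ys" and f: "(f, d) \<in> set xs" "(f, \<not> d) \<in> set ys" and ef: "f \<noteq> e"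
    and contr: "contract (link a b xs ys N) e = bouquet a zs N'" "bouquet a zs N' \<in> M"
  shows "slides (bouquet a zs N') (contract (link a b xs ys N) f)"
proof -
  let ?L = "link a b xs ys N"
  have oe: "is_ordinary ?L e" and of: "is_ordinary ?L f"
    using link_ordinary[OF ab cw e f ef] link_ordinary[OF ab cw f e] ef by auto
  have "?L \<in> M"
    using M_expand oe contr ribbon_graph_link_iff[THEN iffD2, OF ab cw] graph[OF contr(2)]
    unfolding expansion_closed_def is_ordinary_def by (metis is_bouquet_bouquet ribbon_graph_bouquet_iff)
  from slides_contract[OF this oe of] show ?thesis by (simp add: contr(1))
qed

lemma M_chord_word: "bouquet a xs N \<in> M \<Longrightarrow> chord_word xs N"
  using graph ribbon_graph_bouquet_iff by blast

lemma slides_rotate: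
  assumes "bouquet a (xs @ ys) N \<in> M"
  shows "slides (bouquet a (xs @ ys) N) (bouquet a (ys @ xs) N)"
proof -
  have cw: "chord_word (xs @ ys) N" by (rule M_chord_word[OF assms])
  have equiv: "ribbon_equiv (bouquet a (xs @ ys) N) (bouquet a (ys @ xs) N)"
    by (rule ribbon_equiv_rotate[OF cw])
  note M = M_equiv[OF assms equiv]
  note BR = bollobas_riordan_cyclic_equal[OF graph[OF assms] cyclic_equal_bouquet]
  have "nullity (bouquet a (ys @ xs) N) = nullity (bouquet a (xs @ ys) N)"
    using all_loops_params(3)[OF all_loops_bouquet] cw M_chord_word[OF M] by (simp add: Un_commute)
  then show ?thesis
    using M F_equiv[OF assms equiv] by (simp add: slides_def P_def BR)
qed

text \<open>The vertex is split by a new edge \<open>e\<close> into the parts \<open>a1 c a2\<close>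
  and \<open>b1 c b2\<close>; contracting \<open>c\<close> in place of \<open>e\<close> reads both
  parts from \<open>c\<close> onwards and leaves \<open>e\<close> as the new chord.\<close>

lemma slides_positive_aux:
  assumes M: "bouquet a (a1 @ (c, False) # a2 @ b1 @ (c, True) # b2) N \<in> M" and c: "c \<notin> N"
  shows "\<exists>e. slides (bouquet a (a1 @ (c, False) # a2 @ b1 @ (c, True) # b2) N)
    (bouquet a (a2 @ (e, False) # a1 @ b2 @ (e, True) # b1) N)"
proof -
  let ?zs = "a1 @ (c, False) # a2 @ b1 @ (c, True) # b2"
  have cw: "chord_word ?zs N" by (rule M_chord_word[OF M])
  obtain e where e: "e \<notin> fst ` set ?zs" by (rule fresh_edge[of "fst ` set ?zs"]) auto
  have ec: "c \<noteq> e" using e by auto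
  obtain b where ab: "a \<noteq> b" using n_not_Suc_n by blast
  let ?xs = "(e, False) # a1 @ (c, False) # a2" and ?ys = "(e, True) # b1 @ (c, True) # b2"
  have cwL: "chord_word (?xs @ ?ys) N"
  proof (rule chord_word_add[OF cw e])
    have "(e, c) \<notin> set ?zs" for c using e by (metis fst_conv image_eqI)
    then show "distinct (?xs @ ?ys)" using cw by (auto simp: chord_word_def)
  qed auto
  have eN: "e \<notin> N" using cw e by (auto simp: chord_word_def)
  have "contract (link a b ?xs ?ys N) e = bouquet a ?zs N"
    using eN contract_pos_link[OF ab cwL, of e] open_at_eq[of _ "[]"] by (simp add: contract_def)
  then have "slides (bouquet a ?zs N) (contract (link a b ?xs ?ys N) c)"
    by (intro slides_link[OF ab cwL, of e False c False]) (use ec M in auto)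
  moreover have "(c, False) \<notin> set ((e, False) # a1)" "(c, True) \<notin> set ((e, True) # b1)"
    using cw ec by (auto simp: chord_word_def)
  then have "contract (link a b ?xs ?ys N) c = bouquet a ((a2 @ (e, False) # a1) @ (b2 @ (e, True) # b1)) N"
    using c contract_pos_link[OF ab cwL, of c] open_at_eq[of "(c, False)" "(e, False) # a1" a2]
      open_at_eq[of "(c, True)" "(e, True) # b1" b2]
    by (simp add: contract_def)
  ultimately show ?thesis by auto
qed

text \<open>The cut between \<open>a2\<close> and \<open>b1\<close> may be chosen freely, and this
  choice is what moves other half-edges across the chord.\<close>

lemma slides_positive:
  assumes M: "bouquet a (a1 @ p # a2 @ b1 @ opp p # b2) N \<in> M" and p: "fst p \<notin> N"
  obtains k where "slides (bouquet a (a1 @ p # a2 @ b1 @ opp p # b2) N)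
    (bouquet a (a2 @ k # a1 @ b2 @ opp k # b1) N)"
proof (cases "snd p")
  case False
  then show ?thesis
    using slides_positive_aux[of a a1 "fst p" a2 b1 b2 N] that[of "(_, False)"] M p by (cases p) auto
next
  case True
  \<comment> \<open>Here \<open>p\<close> is the \<open>True\<close> half of its edge: the two parts
    are interchanged by a rotation, slid, and interchanged back.\<close>
  let ?A = "a1 @ p # a2" and ?B = "b1 @ opp p # b2"
  have 1: "slides (bouquet a (?A @ ?B) N) (bouquet a (?B @ ?A) N)"
    using M by (intro slides_rotate) simp
  then have "bouquet a (?B @ ?A) N \<in> M" by (simp add: slides_def)
  then obtain e where 2: "slides (bouquet a (?B @ ?A) N) (bouquet a ((b2 @ (e, False) # b1) @ (a2 @ (e, True) # a1)) N)"
    using slides_positive_aux[of a b1 "fst p" b2 a1 a2 N] True p by (cases p) auto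
  then have "bouquet a ((b2 @ (e, False) # b1) @ (a2 @ (e, True) # a1)) N \<in> M" by (simp add: slides_def)
  from slides_trans[OF slides_trans[OF 1 2] slides_rotate[OF this]] show ?thesis
    using that[of "(e, True)"] by simp
qed

text \<open>Contracting a negative edge reverses the second rotation. The new edge \<open>e\<close>,
  placed directly before \<open>c\<close> at both vertices, therefore ends up after \<open>c\<close>
  on one side only, and its two half-edges become neighbours. The signs \<open>N'\<close> may be
  arbitrary, because an isolated chord of either sign can be settled.\<close>

lemma slides_negative:
  assumes M: "bouquet a ((c, False) # xs @ (c, True) # ys) N \<in> M" and c: "c \<in> N"
  obtains e zs N' where "slides (bouquet a ((c, False) # xs @ (c, True) # ys) N)
    (bouquet a ((e, False) # (e, True) # zs) N')"
proof -
  let ?ws = "(c, False) # xs @ (c, True) # ys"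
  have cw: "chord_word ?ws N" by (rule M_chord_word[OF M])
  obtain e where e: "e \<notin> fst ` set ?ws" by (rule fresh_edge[of "fst ` set ?ws"]) auto
  have ec: "c \<noteq> e" using e by auto
  obtain b where ab: "a \<noteq> b" using n_not_Suc_n by blast
  let ?xs = "(e, False) # (c, False) # xs" and ?ys = "(e, True) # (c, True) # ys"
  let ?L = "link a b ?xs ?ys N"
  let ?N = "neg (flip_vertex b ?L)"
  have cwL: "chord_word (?xs @ ?ys) N"
  proof (rule chord_word_add[OF cw e])
    have "(e, c) \<notin> set ?ws" for c using e by (metis fst_conv image_eqI)
    then show "distinct (?xs @ ?ys)" using cw by (auto simp: chord_word_def)
  qed auto
  have eN: "e \<notin> N" using cw e by (auto simp: chord_word_def)
  have flip: "flip_vertex b ?L = link a b ?xs (rev ?ys) ?N"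
    by (rule flip_vertex_link[OF ab])
  have "ribbon_graph (link a b ?xs (rev ?ys) ?N)"
    using ribbon_graph_flip_vertex[OF ribbon_graph_link_iff[THEN iffD2, OF ab cwL], of b] unfolding flip[symmetric] .
  then have cwF: "chord_word (?xs @ rev ?ys) ?N" by (rule ribbon_graph_link_iff[THEN iffD1, OF ab])
  have "contract ?L e = bouquet a ?ws N"
    using eN contract_pos_link[OF ab cwL, of e] open_at_eq[of _ "[]"] by (simp add: contract_def)
  then have 1: "slides (bouquet a ?ws N) (contract ?L c)"
    by (intro slides_link[OF ab cwL, of e False c False]) (use ec M in auto)
  have "att ?L (c, True) = b" using att_link(2)[OF ab cwL] by simp
  then have "contract ?L c = contract_pos (link a b ?xs (rev ?ys) ?N) c"
    using c flip by (simp add: contract_def)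
  also have "\<dots> = bouquet a (open_at (c, False) ?xs @ open_at (c, True) (rev ?ys)) ?N"
    by (rule contract_pos_link[OF ab cwF]) auto
  also have "open_at (c, False) ?xs = xs @ [(e, False)]"
    using open_at_eq[of "(c, False)" "[(e, False)]" xs] ec by simp
  \<comment> \<open>Reversed, the second word ends in \<open>c\<close>, \<open>e\<close>; read from
    \<open>c\<close> it starts with \<open>e\<close>, while the first word, read from
    \<open>c\<close>, ends with \<open>e\<close>.\<close>
  also have "open_at (c, True) (rev ?ys) = (e, True) # rev ys"
    using open_at_eq[of "(c, True)" "rev ys" "[(e, True)]"] cw by (auto simp: chord_word_def)
  finally have 2: "contract ?L c = bouquet a (xs @ ((e, False) # (e, True) # rev ys)) ?N" by simp
  have "bouquet a (xs @ ((e, False) # (e, True) # rev ys)) ?N \<in> M"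
    using 1 unfolding 2 by (simp add: slides_def)
  from slides_trans[OF 1[unfolded 2] slides_rotate[OF this]] show ?thesis
    using that[of e "rev ys @ xs"] by simp
qed

section \<open>Settling every bouquet with at least one chord\<close>

definition settles :: "ribbon \<Rightarrow> bool" where
  "settles G \<longleftrightarrow> (settled_below G \<longrightarrow> F G = P G)"

lemma settles_slides: "slides G H \<Longrightarrow> settles H \<Longrightarrow> settles G"
  by (auto simp: slides_def settles_def settled_below_def)

text \<open>No chord runs between \<open>xs\<close> and \<open>ys\<close>, so both are spanning
  subgraphs lying in \<open>M\<close>. Being nonempty, each leaves the other with smaller nullity,
  so \<open>settled_below\<close> covers both factors.\<close>

lemma settles_join:
  assumes M: "bouquet a (xs @ ys) N \<in> M" and closed: "opp ` set xs \<subseteq> set xs" and ne: "xs \<noteq> []" "ys \<noteq> []"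
  shows "settles (bouquet a (xs @ ys) N)"
  unfolding settles_def
proof
  let ?G = "bouquet a (xs @ ys) N"
  assume below: "settled_below ?G"
  have cw: "chord_word (xs @ ys) N" by (rule M_chord_word[OF M])
  have opp: "opp h \<in> set zs \<Longrightarrow> opp ` set zs \<subseteq> set zs \<Longrightarrow> h \<in> set zs" for h zs
    by (metis image_subset_iff opp_opp)
  have "opp ` set ys \<subseteq> set ys"
  proof (rule image_subsetI)
    fix h assume "h \<in> set ys"
    then have "h \<notin> set xs" "opp h \<in> set xs \<union> set ys" using cw by (auto simp: chord_word_def)
    then show "opp h \<in> set ys" using opp[OF _ closed, of h] by blast
  qed
  have disj: "fst ` set xs \<inter> fst ` set ys = {}"
  proof (rule equals0I)
    fix e assume "e \<in> fst ` set xs \<inter> fst ` set ys"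
    then obtain h k where hk: "h \<in> set xs" "k \<in> set ys" "fst h = fst k" by auto
    then have "k = h \<or> k = opp h" using fst_eq_iff[of k h] by simp
    then have "k \<in> set xs" using hk(1) closed by auto
    then show False using hk(2) cw by (auto simp: chord_word_def)
  qed
  let ?N1 = "N \<inter> fst ` set xs" and ?N2 = "N \<inter> fst ` set ys"
  have N: "N = ?N1 \<union> ?N2" using cw by (auto simp: chord_word_def)
  have "filter (\<lambda>h. fst h \<in> fst ` set xs) (xs @ ys) = xs" "filter (\<lambda>h. fst h \<in> fst ` set ys) (xs @ ys) = ys"
    using disj by (auto simp: filter_empty_conv intro!: filter_True)
  then have span: "spanning ?G (fst ` set xs) = bouquet a xs ?N1" "spanning ?G (fst ` set ys) = bouquet a ys ?N2"
    by (simp_all only: spanning_bouquet)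
  have M1: "bouquet a xs ?N1 \<in> M" and M2: "bouquet a ys ?N2 \<in> M"
    using M_spanning[OF M, of "fst ` set xs"] M_spanning[OF M, of "fst ` set ys"] unfolding span by auto
  note cw1 = M_chord_word[OF M1] and cw2 = M_chord_word[OF M2]
  \<comment> \<open>The second factor is moved to another vertex because
    \<open>bollobas_riordan_join\<close> takes bouquets on distinct vertices.\<close>
  obtain b where ab: "a \<noteq> b" using n_not_Suc_n by blast
  have equiv: "ribbon_equiv (bouquet a ys ?N2) (bouquet b ys ?N2)"
    using ribbon_equiv_relabel[OF cw2, of "\<lambda>h. h" a b] by simp
  note M3 = M_equiv[OF M2 equiv]
  note null = all_loops_params(3)[OF all_loops_bouquet]
  have "card (fst ` set xs \<union> fst ` set ys) = card (fst ` set xs) + card (fst ` set ys)"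
    using disj by (simp add: card_Un_disjoint)
  moreover have "0 < card (fst ` set xs)" "0 < card (fst ` set ys)" using ne by (simp_all add: card_gt_0_iff)
  ultimately have "nullity (bouquet a xs ?N1) < nullity ?G" "nullity (bouquet b ys ?N2) < nullity ?G"
    by (simp_all add: null[OF cw] null[OF cw1] null[OF cw2] image_Un)
  then have F1: "F (bouquet a xs ?N1) = \<alpha> * BR (bouquet a xs ?N1)" and
    F2: "F (bouquet a ys ?N2) = \<alpha> * BR (bouquet b ys ?N2)"
    using below M1 M3 F_equiv[OF M2 equiv] by (simp_all add: settled_below_def P_bouquet cw1 cw2)
  have J: "join (bouquet a xs ?N1) (bouquet a ys ?N2) = ?G"
    unfolding join_def bouquet_def using N by auto
  have "\<alpha> * F ?G = F (bouquet a xs ?N1) * F (bouquet a ys ?N2)"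
    using join[of "bouquet a xs ?N1" "bouquet a ys ?N2"] M M1 M2 disj
    by (simp add: J is_bouquet_bouquet cw1 cw2)
  also have "\<dots> = \<alpha> * (\<alpha> * BR ?G)"
    unfolding F1 F2
    using bollobas_riordan_join[OF cw1 cw2 disj ab params(3)[symmetric], of x "\<alpha>inv * q - 1" u]
    by (simp add: N[symmetric] mult_ac)
  finally show "F ?G = P ?G" by (simp add: P_bouquet[OF cw] unit_cancel)
qed

text \<open>If other chords are present, the isolated one is a factor of a join. Alone, it is
  \<open>D100\<close> or \<open>D101\<close>, settled by the choice of y and by the second equation
  of \<open>params\<close>.\<close>

lemma settles_isolated:
  assumes M: "bouquet a (k # opp k # zs) N \<in> M"
  shows "settles (bouquet a (k # opp k # zs) N)"
proof (cases "zs = []")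
  case False
  then show ?thesis using settles_join[of a "[k, opp k]" zs N] M by simp
next
  case True
  then have M': "bouquet a [k, opp k] N \<in> M" using M by simp
  note cw = M_chord_word[OF M']
  have F: "F (bouquet a [k, opp k] N) = (if fst k \<in> N then r else q)"
    using F_equiv[OF M' ribbon_equiv_single[OF cw]] by (simp add: r_def q_def)
  have "P (bouquet a [k, opp k] N) = \<alpha> + \<alpha> * (if fst k \<in> N then (\<alpha>inv * q - 1) * u * v else \<alpha>inv * q - 1)"
    unfolding P_bouquet[OF cw] bollobas_riordan_single[OF cw] by (simp add: distrib_left)
  also have "\<dots> = (if fst k \<in> N then \<alpha> + (q - \<alpha>) * u * v else q)"
    by (simp add: alpha_y mult.assoc[symmetric])
  also have "\<dots> = F (bouquet a [k, opp k] N)" unfolding F params(2) by simp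
  finally show ?thesis using True by (simp add: settles_def)
qed

lemma settles_crossing:
  assumes M: "bouquet a ([l, m, opp l, opp m] @ zs) {} \<in> M"
  shows "settles (bouquet a ([l, m, opp l, opp m] @ zs) {})"
proof (cases "zs = []")
  case False
  then show ?thesis using settles_join[OF M] by simp
next
  case True
  then have M': "bouquet a [l, m, opp l, opp m] {} \<in> M" using M by simp
  note cw = M_chord_word[OF M']
  let ?y = "\<alpha>inv * q - 1"
  have F: "F (bouquet a [l, m, opp l, opp m] {}) = s"
    using F_equiv[OF M' ribbon_equiv_crossing[OF cw]] by (simp add: s_def)
  \<comment> \<open>A further factor \<open>\<alpha>\<close> makes y occur only through
    \<open>\<alpha> * ?y\<close>, which is q - \<alpha>; then the first equation of
    \<open>params\<close> applies, and the unit is cancelled.\<close>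
  have "\<alpha> * (\<alpha> * (1 + 2 * ?y + ?y\<^sup>2 * u\<^sup>2)) = \<alpha> * \<alpha> + 2 * \<alpha> * (\<alpha> * ?y) + (\<alpha> * ?y)\<^sup>2 * u\<^sup>2"
    by (simp add: algebra_simps power2_eq_square)
  also have "\<dots> = \<alpha> * s"
    unfolding alpha_y params(1) by (simp add: algebra_simps)
  finally have "P (bouquet a [l, m, opp l, opp m] {}) = s"
    unfolding P_bouquet[OF cw] bollobas_riordan_crossing[OF cw] by (rule unit_cancel)
  then show ?thesis using F True by (simp add: settles_def)
qed

text \<open>Four slides gather the four half-edges of the two crossing chords at the front.\<close>

lemma settles_crossing_chords:
  assumes M: "bouquet a (p # x1 @ g # x2 @ opp p # y1 @ opp g # y2) {} \<in> M"
  shows "settles (bouquet a (p # x1 @ g # x2 @ opp p # y1 @ opp g # y2) {})"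
proof -
  let ?B = "\<lambda>ws. bouquet a ws {}"
  have pos: "\<exists>k. slides (?B (a1 @ p # a2 @ b1 @ opp p # b2)) (?B (a2 @ k # a1 @ b2 @ opp k # b1)) \<and>
      ?B (a2 @ k # a1 @ b2 @ opp k # b1) \<in> M"
    if m: "?B (a1 @ p # a2 @ b1 @ opp p # b2) \<in> M" for a1 p a2 b1 b2
  proof -
    obtain k where "slides (?B (a1 @ p # a2 @ b1 @ opp p # b2)) (?B (a2 @ k # a1 @ b2 @ opp k # b1))"
      by (rule slides_positive[OF m]) simp_all
    then show ?thesis unfolding slides_def by blast
  qed
  have rot: "slides (?B (xs @ ys)) (?B (ys @ xs)) \<and> ?B (ys @ xs) \<in> M" if "?B (xs @ ys) \<in> M" for xs ys
    using slides_rotate[OF that] by (auto simp: slides_def)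
  obtain k where k: "slides (?B (p # x1 @ g # x2 @ opp p # y1 @ opp g # y2)) (?B (x1 @ k # y1 @ opp g # y2 @ opp k # g # x2))"
      "?B (x1 @ k # y1 @ opp g # y2 @ opp k # g # x2) \<in> M"
    using pos[of "[]" p x1 "g # x2" "y1 @ opp g # y2"] M by auto
  \<comment> \<open>With g' for \<open>opp g\<close>, the word is
    \<open>x1 k y1 g' y2 k' g x2\<close>; rotation brings \<open>x2\<close> and \<open>x1\<close>
    together.\<close>
  let ?Z = "x2 @ x1"
  have 2: "slides (?B (x1 @ k # y1 @ opp g # y2 @ opp k # g # x2)) (?B (k # y1 @ opp g # y2 @ opp k # g # ?Z))"
      "?B (k # y1 @ opp g # y2 @ opp k # g # ?Z) \<in> M"
    using rot[of x1 "k # y1 @ opp g # y2 @ opp k # g # x2"] k(2) by auto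
  obtain j where j: "slides (?B (k # y1 @ opp g # y2 @ opp k # g # ?Z)) (?B (y1 @ j # g # ?Z @ opp j # opp g # y2))"
      "?B (y1 @ j # g # ?Z @ opp j # opp g # y2) \<in> M"
    using pos[of "[]" k y1 "opp g # y2" "g # ?Z"] 2(2) by auto
  \<comment> \<open>The second slide and a rotation likewise join \<open>y2\<close> and
    \<open>y1\<close>, giving \<open>g Z j' g' W j\<close>.\<close>
  let ?W = "y2 @ y1"
  have 4: "slides (?B (y1 @ j # g # ?Z @ opp j # opp g # y2)) (?B (g # ?Z @ opp j # opp g # ?W @ [j]))"
      "?B (g # ?Z @ opp j # opp g # ?W @ [j]) \<in> M"
    using rot[of "y1 @ [j]" "g # ?Z @ opp j # opp g # y2"] j(2) by auto
  \<comment> \<open>The last two slides expel the blocks \<open>Z\<close> and \<open>W\<close> from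
    between the crossing half-edges: the words are \<open>Z i W j i' j'\<close>, and after a
    rotation and a slide \<open>Z l i' l' i W\<close>.\<close>
  obtain i where i: "slides (?B (g # ?Z @ opp j # opp g # ?W @ [j])) (?B (?Z @ i # ?W @ j # opp i # [opp j]))"
      "?B (?Z @ i # ?W @ j # opp i # [opp j]) \<in> M"
    using pos[of "[]" g ?Z "[opp j]" "?W @ [j]"] 4(2) by auto
  have 6: "slides (?B (?Z @ i # ?W @ j # opp i # [opp j])) (?B (opp j # ?Z @ i # ?W @ j # [opp i]))"
      "?B (opp j # ?Z @ i # ?W @ j # [opp i]) \<in> M"
    using rot[of "?Z @ i # ?W @ j # [opp i]" "[opp j]"] i(2) by auto
  obtain l where l: "slides (?B (opp j # ?Z @ i # ?W @ j # [opp i])) (?B (?Z @ l # opp i # opp l # i # ?W))"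
      "?B (?Z @ l # opp i # opp l # i # ?W) \<in> M"
    using pos[of "[]" "opp j" ?Z "i # ?W" "[opp i]"] 6(2) by auto
  have 8: "slides (?B (?Z @ l # opp i # opp l # i # ?W)) (?B ([l, opp i, opp l, opp (opp i)] @ ?W @ ?Z))"
      "?B ([l, opp i, opp l, opp (opp i)] @ ?W @ ?Z) \<in> M"
    using rot[of ?Z "l # opp i # opp l # i # ?W"] l(2) by auto
  show ?thesis
    by (rule settles_slides[OF k(1)], rule settles_slides[OF 2(1)], rule settles_slides[OF j(1)],
        rule settles_slides[OF 4(1)], rule settles_slides[OF i(1)], rule settles_slides[OF 6(1)],
        rule settles_slides[OF l(1)], rule settles_slides[OF 8(1)]) (rule settles_crossing[OF 8(2)])
qed

lemma settles_bouquet: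
  assumes M: "bouquet a ws N \<in> M" and ne: "ws \<noteq> []"
  shows "settles (bouquet a ws N)"
proof -
  have front: "\<exists>xs ys. slides (bouquet a ws N) (bouquet a (h # xs @ opp h # ys) N)"
    if h: "h \<in> set ws" for h
  proof -
    obtain as bs where ws: "ws = as @ h # bs" using h by (auto dest: split_list)
    have 1: "slides (bouquet a ws N) (bouquet a ((h # bs) @ as) N)"
      using slides_rotate[of a as "h # bs" N] M ws by simp
    have "opp h \<in> set (bs @ as)"
    proof -
      have "opp h \<noteq> h" by (cases h) simp
      then show ?thesis using chord_word_opp[OF M_chord_word[OF M] h] ws by auto
    qed
    then obtain xs ys where "bs @ as = xs @ opp h # ys" by (meson split_list)
    with 1 show ?thesis by auto
  qed
  show ?thesis
  proof (cases "N = {}")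
    case False
    then obtain c where c: "c \<in> N" "c \<in> fst ` set ws"
      using M_chord_word[OF M] unfolding chord_word_def by blast
    then have "(c, False) \<in> set ws" using chord_word_mem[OF M_chord_word[OF M]] by blast
    from front[OF this] obtain xs ys where 1: "slides (bouquet a ws N) (bouquet a ((c, False) # xs @ (c, True) # ys) N)"
      by auto
    then have "bouquet a ((c, False) # xs @ (c, True) # ys) N \<in> M" by (simp add: slides_def)
    from slides_negative[OF this c(1)] obtain e zs N' where 2: "slides (bouquet a ((c, False) # xs @ (c, True) # ys) N)
        (bouquet a ((e, False) # opp (e, False) # zs) N')"
      unfolding opp_pair not_False_eq_True by blast
    then have "bouquet a ((e, False) # opp (e, False) # zs) N' \<in> M" by (simp add: slides_def)
    from settles_slides[OF slides_trans[OF 1 2] settles_isolated[OF this]] show ?thesis .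
  next
    case True
    from front[OF hd_in_set[OF ne]] obtain p xs ys where
      1: "slides (bouquet a ws N) (bouquet a (p # xs @ opp p # ys) N)" by metis
    then have M1: "bouquet a (p # xs @ opp p # ys) N \<in> M" by (simp add: slides_def)
    note cw = M_chord_word[OF M1]
    \<comment> \<open>The set between \<open>p\<close> and \<open>opp p\<close> is closed under
      \<open>opp\<close> exactly when no chord crosses \<open>p\<close>.\<close>
    show ?thesis
    proof (cases "opp ` set xs \<subseteq> set xs")
      case closed: True
      show ?thesis
      proof (cases "xs = []")
        case True
        then show ?thesis using settles_slides[OF 1] settles_isolated M1 by simp
      next
        case False
        \<comment> \<open>Moving \<open>p\<close> to the end puts the closed block \<open>xs\<close>
          in front, as a factor of a join.\<close>
        have 2: "slides (bouquet a (p # xs @ opp p # ys) N) (bouquet a (xs @ opp p # ys @ [p]) N)"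
          using slides_rotate[of a "[p]" "xs @ opp p # ys" N] M1 by simp
        then have "bouquet a (xs @ opp p # ys @ [p]) N \<in> M" by (simp add: slides_def)
        from settles_slides[OF slides_trans[OF 1 2] settles_join[OF this closed False]] show ?thesis by simp
      qed
    next
      case False
      then obtain g where g: "g \<in> set xs" "opp g \<notin> set xs" unfolding image_subset_iff by blast
      have "g \<noteq> p" "g \<noteq> opp p" using g cw by (auto simp: chord_word_def)
      then have "opp g \<noteq> opp p" "opp g \<noteq> p" by (metis opp_opp)+
      then have "opp g \<in> set ys"
        using chord_word_opp[OF cw, of g] g by auto
      then obtain x1 x2 y1 y2 where "xs = x1 @ g # x2" "ys = y1 @ opp g # y2"
        using g(1) by (metis split_list)
      with M1 True have "settles (bouquet a (p # xs @ opp p # ys) N)"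
        using settles_crossing_chords[of a p x1 g x2 y1 y2] by simp
      from settles_slides[OF 1 this] show ?thesis .
    qed
  qed
qed

text \<open>When every edge is a loop, the half-edges at \<open>a\<close> form whole chords, so
  \<open>a\<close> with its chords separates from the rest; the rest is nonempty by
  \<open>ne\<close>.\<close>

lemma split_vertex:
  assumes G: "all_loops G" and a: "a \<in> verts G" and ne: "verts G \<noteq> {a}"
  obtains xs N H where "G = dunion (bouquet a xs N) H" "chord_word xs N" "is_bouquet_union H"
    "disjoint_pair (bouquet a xs N) H" "all_loops H"
proof -
  have rg: "ribbon_graph G" using G by (simp add: all_loops_def)
  let ?xs = "rotn G a" and ?V = "verts G - {a}"
  let ?E = "fst ` set ?xs"
  let ?H = "\<lparr>verts = ?V, rotn = (\<lambda>u. if u = a then [] else rotn G u), neg = neg G - ?E\<rparr>"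
  have att: "att G (e, b) = att G (e, c)" if "e \<in> edges G" for e b c
    using G that by (cases b; cases c) (auto simp: all_loops_def is_loop_def)
  have mem: "h \<in> set ?xs \<longleftrightarrow> h \<in> half_edges G \<and> att G h = a" for h by (rule mem_rotn_iff[OF rg])
  have E: "h \<in> set ?xs \<longleftrightarrow> h \<in> half_edges G \<and> fst h \<in> ?E" for h
  proof
    assume "h \<in> half_edges G \<and> fst h \<in> ?E"
    then obtain k where "h \<in> half_edges G" "k \<in> half_edges G" "att G k = a" "fst h = fst k" by (auto simp: mem)
    then show "h \<in> set ?xs" using att[of "fst h" "snd h" "snd k"] half_edge_iff[OF rg, of h]
      by (cases h; cases k) (simp add: mem)
  qed (auto simp: mem)
  have hH: "half_edges ?H = half_edges G - set ?xs"
  proof (rule set_eqI)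
    fix h
    have "h \<in> half_edges ?H \<longleftrightarrow> (\<exists>u\<in>?V. h \<in> set (rotn G u))" by (auto simp: half_edges_def)
    also have "\<dots> \<longleftrightarrow> h \<in> half_edges G - set ?xs"
      unfolding mem_rotn_iff[OF rg] Diff_iff using att_mem(1)[OF rg, of h] by auto
    finally show "h \<in> half_edges ?H \<longleftrightarrow> h \<in> half_edges G - set ?xs" .
  qed
  have opp: "opp h \<in> set ?xs \<longleftrightarrow> h \<in> set ?xs" if "h \<in> half_edges G" for h
    using E[of h] E[of "opp h"] ribbon_graphD(4)[OF rg that] that by simp
  have eH: "edges ?H = edges G - ?E"
    unfolding edges_def hH using E by fastforce
  have cw: "chord_word ?xs (neg G \<inter> ?E)"
    using ribbon_graphD(6)[OF rg] opp mem by (auto simp: chord_word_def)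
  have rgH: "ribbon_graph ?H"
    unfolding ribbon_graph_iff hH eH
  proof (intro conjI allI ballI impI)
    show "rotation_system (verts ?H) (rotn ?H)"
      using ribbon_graphD(1)[OF rg] by (auto simp: rotation_system_def)
    show "rotn ?H u = []" if "u \<notin> verts ?H" for u using that ribbon_graphD(3)[OF rg] by auto
    show "opp h \<in> half_edges G - set ?xs" if "h \<in> half_edges G - set ?xs" for h
      using that opp ribbon_graphD(4)[OF rg] by auto
  qed (use ribbon_graphD(5)[OF rg] in auto)
  have attH: "att ?H h = att G h" if "h \<in> half_edges ?H" for h
  proof (rule att_eq[OF rgH])
    have "h \<in> half_edges G" "att G h \<noteq> a" using that unfolding hH by (auto simp: mem)
    then show "att G h \<in> verts ?H" "h \<in> set (rotn ?H (att G h))" using att_mem[OF rg] by auto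
  qed
  have loopsH: "all_loops ?H"
    unfolding all_loops_def is_loop_def
  proof (intro conjI ballI rgH)
    fix e assume e: "e \<in> edges ?H"
    then show "att ?H (e, False) = att ?H (e, True)"
      using att[of e False True] by (simp add: attH half_edge_iff[OF rgH] eH)
  qed
  have "G = dunion (bouquet a ?xs (neg G \<inter> ?E)) ?H"
    using a by (intro ribbon.equality) (auto simp: dunion_def)
  moreover have "is_bouquet_union ?H"
    using loopsH ne a by (auto simp: is_bouquet_union_def all_loops_def)
  moreover have "disjoint_pair (bouquet a ?xs (neg G \<inter> ?E)) ?H"
    by unfold_locales (use rgH cw in \<open>auto simp: ribbon_graph_bouquet_iff eH\<close>)
  ultimately show ?thesis using that cw loopsH by blast
qed

text \<open>The lexicographic order serves three reductions: deletion of an ordinary edge lowers the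
  nullity, contraction keeps it but loses an edge, and splitting a disjoint union may leave both
  unchanged when the other part is edgeless, but then loses vertices.\<close>

lemma F_eq_P: "G \<in> M \<Longrightarrow> F G = P G"
proof (induction G rule: wf_induct_rule[OF wf_measures[of "[nullity, \<lambda>G. card (edges G), \<lambda>G. card (verts G)]"]])
  case (1 G)
  have rg: "ribbon_graph G" using 1(2) by (rule graph)
  have IH: "F K = P K" if "K \<in> M" "nullity K < nullity G \<or> nullity K = nullity G \<and>
      (card (edges K) < card (edges G) \<or> card (edges K) = card (edges G) \<and> card (verts K) < card (verts G))" for K
    using 1(1)[of K] that by auto
  have card_edges: "card (edges G - {e}) < card (edges G)" if "e \<in> edges G" for e
    by (rule card_Diff1_less[OF finite_edges[OF rg] that])
  consider "edges G = {}" | e where "e \<in> edges G" "\<not> is_loop G e" | "all_loops G" "edges G \<noteq> {}"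
    using rg by (auto simp: all_loops_def)
  then show ?case
  proof cases
    case 1
    then show ?thesis
      using edgeless[OF \<open>G \<in> M\<close>] all_loops_params(1)[OF edgeless_all_loops[OF rg]]
      by (simp add: P_def bollobas_riordan_edgeless[OF rg])
  next
    case (2 e)
    have contr: "F (contract G e) = P (contract G e)"
      using M_contract[OF \<open>G \<in> M\<close> 2] nullity_contract[OF rg 2] contract_facts(2)[OF rg 2] card_edges[OF 2(1)]
      by (intro IH) simp_all
    show ?thesis
    proof (cases "is_bridge G e")
      case True
      then show ?thesis using bridge[OF \<open>G \<in> M\<close> True] P_bridge[OF rg True] contr by simp
    next
      case False
      then have ord: "is_ordinary G e" using 2 by (simp add: is_ordinary_def)
      have "F (delete G e) = P (delete G e)"
        using M_delete[OF \<open>G \<in> M\<close> 2(1)] nullity_delete_ordinary[OF rg ord] by (intro IH) simp_all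
      then show ?thesis using ordinary[OF \<open>G \<in> M\<close> ord] P_ordinary[OF rg ord] contr by simp
    qed
  next
    case 3
    \<comment> \<open>Choosing a vertex that carries a half-edge makes the chord word nonempty in
      the one-vertex case.\<close>
    obtain h where h: "h \<in> half_edges G" using 3(2) by (auto simp: edges_def)
    let ?a = "att G h"
    have a: "?a \<in> verts G" by (rule att_mem(1)[OF rg h])
    show ?thesis
    proof (cases "verts G = {?a}")
      case True
      then have "is_bouquet G" using rg by (simp add: is_bouquet_def)
      then obtain b ws N where G: "G = bouquet b ws N" by (rule is_bouquetE)
      have "ws \<noteq> []" using h unfolding G by auto
      then have "settles G" using settles_bouquet[of b ws N] \<open>G \<in> M\<close> unfolding G by simp
      moreover have "settled_below G" unfolding settled_below_def using IH by blast
      ultimately show ?thesis by (simp add: settles_def)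
    next
      case False
      obtain xs N H where G: "G = dunion (bouquet ?a xs N) H" and cw: "chord_word xs N"
        and H: "is_bouquet_union H" and dp: "disjoint_pair (bouquet ?a xs N) H" and lH: "all_loops H"
        using split_vertex[OF 3(1) a False] by metis
      let ?B = "bouquet ?a xs N"
      interpret d: disjoint_pair ?B H by (rule dp)
      note lB = all_loops_bouquet[OF cw, of ?a]
      have mem: "?B \<in> M" "H \<in> M"
        using M_summand is_bouquet_bouquet[OF cw, of ?a] H d.disj \<open>G \<in> M\<close> G
        unfolding summand_closed_def by metis+
      have "verts G = verts ?B \<union> verts H" "edges G = edges ?B \<union> edges H"
        by (subst G, rule d.dunion_simps d.edges_dunion)+
      then have cards: "card (verts G) = card (verts ?B) + card (verts H)" "card (edges G) = card (edges ?B) + card (edges H)"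
        by (simp_all only:, intro card_Un_disjoint ribbon_graphD(2) d.G d.H d.disj)
          (intro card_Un_disjoint finite_edges d.G d.H d.disj)
      have pos: "card (verts ?B) > 0" "card (verts H) > 0"
        using H ribbon_graphD(2) by (auto simp: is_bouquet_union_def card_gt_0_iff)
      have "F ?B = P ?B" "F H = P H"
        using cards pos mem all_loops_params(3)[OF 3(1)] all_loops_params(3)[OF lB] all_loops_params(3)[OF lH]
        by (intro IH; linarith | simp)+
      moreover have "F G = F ?B * F H"
        using dunion[OF is_bouquet_bouquet[OF cw, of ?a] H d.disj mem] \<open>G \<in> M\<close> G by simp
      moreover have "P G = P ?B * P H"
        unfolding P_def using d.components_dunion bollobas_riordan_dunion[OF dp lB lH params(3)[symmetric]] G
        by (simp add: power_add mult_ac)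
      ultimately show ?thesis by simp
    qed
  qed
qed

end

theorem theorem3p1:
  fixes M :: "ribbon set"
    and F :: "ribbon \<Rightarrow> 'r::comm_ring_1"
    and \<alpha> \<alpha>inv x u v s q r :: 'r
  assumes M_class: "ribbon_class M"
    and M_minor: "minor_closed M"
    and M_D: "D100 \<in> M" "D101 \<in> M" "D210 \<in> M"
    and M_expand: "expansion_closed M"
    and M_summand: "summand_closed M"
    and F_equiv: "\<And>G H. G \<in> M \<Longrightarrow> ribbon_equiv G H \<Longrightarrow> F G = F H"
    and s_def: "s = F D210" and q_def: "q = F D100" and r_def: "r = F D101"
    and unit: "\<alpha> * \<alpha>inv = 1"
    and ordinary: "\<And>G e. G \<in> M \<Longrightarrow> is_ordinary G e \<Longrightarrow> F G = F (contract G e) + F (delete G e)"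
    and bridge: "\<And>G e. G \<in> M \<Longrightarrow> is_bridge G e \<Longrightarrow> F G = x * F (contract G e)"
    and dunion: "\<And>G H. is_bouquet G \<Longrightarrow> is_bouquet_union H \<Longrightarrow>
          verts G \<inter> verts H = {} \<Longrightarrow> edges G \<inter> edges H = {} \<Longrightarrow>
          G \<in> M \<Longrightarrow> H \<in> M \<Longrightarrow> dunion G H \<in> M \<Longrightarrow> F (dunion G H) = F G * F H"
    and join: "\<And>G H. is_bouquet G \<Longrightarrow> is_bouquet H \<Longrightarrow> edges G \<inter> edges H = {} \<Longrightarrow>
          G \<in> M \<Longrightarrow> H \<in> M \<Longrightarrow> join G H \<in> M \<Longrightarrow> \<alpha> * F (join G H) = F G * F H"
    and edgeless: "\<And>G. G \<in> M \<Longrightarrow> edges G = {} \<Longrightarrow> F G = \<alpha> ^ card (verts G)"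
    and params: "(q - \<alpha>)\<^sup>2 * u\<^sup>2 = \<alpha> * (s - 2 * q + \<alpha>)" "(q - \<alpha>) * u * v = r - \<alpha>" "v = v\<^sup>2"
  shows "\<forall>G\<in>M. F G = \<alpha> ^ components G * bollobas_riordan G x (\<alpha>inv * q - 1) u v"
proof -
  interpret deletion_contraction M F \<alpha> \<alpha>inv x u v s q r
    by unfold_locales (fact assms)+
  show ?thesis using F_eq_P by (simp add: P_def)
qed

end
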